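(* Let $p_1\equiv p_2\equiv1\pmod4$ be primes, $k=\mathbb{Q}(\sqrt{2p_1p_2},i)$, $k^{( * )}=\mathbb{Q}(\sqrt2,\sqrt{p_1},\sqrt{p_2},i)$ its absolute genus field, $Q$ the unit index $q(\mathbb{Q}(\sqrt2,\sqrt{p_1p_2})/\mathbb{Q})$, and $\varepsilon_3$ the fundamental unit of $\mathbb{Q}(\sqrt{2p_1p_2})$. (1) If $N(\varepsilon_3)=-1$, then $Am_s(k/\mathbb{Q}(i))=\langle[\mathcal{H}_0],[\mathcal{H}_1],[\mathcal{H}_2]\rangle\subseteq\ker J_{k^{( * )}}$. (2) If $N(\varepsilon_3)=1$: (i) if $Q=2$, then $Am_s(k/\mathbb{Q}(i))=\langle[\mathcal{H}_0],[\mathcal{H}_1],[\mathcal{H}_2],[\mathcal{H}_3]\rangle\subseteq\ker J_{k^{( * )}}$; (ii) if $Q=1$, then $Am_s(k/\mathbb{Q}(i))=\langle[\mathcal{H}_0],[\mathcal{H}_1],[\mathcal{H}_3]\rangle\subseteq\ker J_{k^{( * )}}$.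
   Context: $i=\sqrt{-1}$; $N$ is the norm to $\mathbb{Q}$. For a real biquadratic field $K$ with quadratic subfields $k_1,k_2,k_3$, $q(K/\mathbb{Q})=[E_K:E_{k_1}E_{k_2}E_{k_3}]$, $E$ denoting unit groups. Write $p_1=e^2+4f^2$, $p_2=g^2+4h^2$ with integers $e,f,g,h$, and $\pi_1=e+2if$, $\pi_2=e-2if$, $\pi_3=g+2ih$, $\pi_4=g-2ih$. For $j=1,\dots,4$, $\mathcal{H}_j$ is the prime ideal of $k$ above $\pi_j$ ($\mathcal{H}_j^2=\pi_j\mathcal{O}_k$), and $\mathcal{H}_0$ the prime of $k$ above $1+i$ ($\mathcal{H}_0^2=(1+i)\mathcal{O}_k$). $J_L:\mathbf{C}_k\to\mathbf{C}_L$ is the map on class groups induced by extension of ideals. $Am_s(k/\mathbb{Q}(i))$ is the subgroup of $\mathbf{C}_k$ generated by classes containing an ideal invariant under the nontrivial automorphism of $k/\mathbb{Q}(i)$. *)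

theory Defs
  imports Complex_Main "HOL-Computational_Algebra.Polynomial" "HOL-Computational_Algebra.Primes"
begin

text \<open>Number fields are modelled as subfields of the complex numbers.\<close>

definition is_subfield :: "complex set \<Rightarrow> bool" where
  "is_subfield F \<longleftrightarrow> 0 \<in> F \<and> 1 \<in> F \<and>
     (\<forall>x\<in>F. \<forall>y\<in>F. x + y \<in> F \<and> x - y \<in> F \<and> x * y \<in> F) \<and>
     (\<forall>x\<in>F. x \<noteq> 0 \<longrightarrow> inverse x \<in> F)"

definition field_gen :: "complex set \<Rightarrow> complex set" where
  "field_gen S = \<Inter>{F. is_subfield F \<and> S \<subseteq> F}"

definition alg_int :: "complex \<Rightarrow> bool" where
  "alg_int z \<longleftrightarrow> (\<exists>p :: int poly. lead_coeff p = 1 \<and> poly (map_poly of_int p) z = 0)"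

definition OK :: "complex set \<Rightarrow> complex set" where
  "OK K = {z \<in> K. alg_int z}"

definition units_OK :: "complex set \<Rightarrow> complex set" where
  "units_OK K = {u \<in> OK K. u \<noteq> 0 \<and> inverse u \<in> OK K}"

definition is_ideal :: "complex set \<Rightarrow> complex set \<Rightarrow> bool" where
  "is_ideal R I \<longleftrightarrow> I \<subseteq> R \<and> 0 \<in> I \<and> (\<forall>x\<in>I. \<forall>y\<in>I. x + y \<in> I) \<and>
     (\<forall>r\<in>R. \<forall>x\<in>I. r * x \<in> I)"

definition nz_ideal :: "complex set \<Rightarrow> complex set \<Rightarrow> bool" where
  "nz_ideal R I \<longleftrightarrow> is_ideal R I \<and> I \<noteq> {0}"

definition gen_ideal :: "complex set \<Rightarrow> complex set \<Rightarrow> complex set" where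
  "gen_ideal R S = \<Inter>{L. is_ideal R L \<and> S \<subseteq> L}"

definition ideal_mult :: "complex set \<Rightarrow> complex set \<Rightarrow> complex set \<Rightarrow> complex set" where
  "ideal_mult R I J = gen_ideal R {a * b | a b. a \<in> I \<and> b \<in> J}"

definition principal :: "complex set \<Rightarrow> complex set \<Rightarrow> bool" where
  "principal R I \<longleftrightarrow> (\<exists>a\<in>R. I = gen_ideal R {a})"

definition ideal_equiv :: "complex set \<Rightarrow> complex set \<Rightarrow> complex set \<Rightarrow> bool" where
  "ideal_equiv R I J \<longleftrightarrow> (\<exists>a\<in>R. \<exists>b\<in>R. a \<noteq> 0 \<and> b \<noteq> 0 \<and> (\<lambda>x. a * x) ` I = (\<lambda>x. b * x) ` J)"

definition cls :: "complex set \<Rightarrow> complex set \<Rightarrow> complex set set" where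
  "cls R I = {J. nz_ideal R J \<and> ideal_equiv R I J}"

definition classes :: "complex set \<Rightarrow> complex set set set" where
  "classes R = {cls R I | I. nz_ideal R I}"

definition class_mult :: "complex set \<Rightarrow> complex set set \<Rightarrow> complex set set \<Rightarrow> complex set set" where
  "class_mult R C D = cls R (ideal_mult R (SOME I. I \<in> C) (SOME J. J \<in> D))"

inductive_set class_subgroup :: "complex set \<Rightarrow> complex set set \<Rightarrow> complex set set set"
  for R G where
  gen: "I \<in> G \<Longrightarrow> nz_ideal R I \<Longrightarrow> cls R I \<in> class_subgroup R G"
| one: "cls R R \<in> class_subgroup R G"
| mult: "C \<in> class_subgroup R G \<Longrightarrow> D \<in> class_subgroup R G \<Longrightarrow> class_mult R C D \<in> class_subgroup R G"
| inv: "C \<in> class_subgroup R G \<Longrightarrow> D \<in> classes R \<Longrightarrow> class_mult R C D = cls R R \<Longrightarrow> D \<in> class_subgroup R G"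

definition field_aut :: "complex set \<Rightarrow> (complex \<Rightarrow> complex) \<Rightarrow> bool" where
  "field_aut K \<tau> \<longleftrightarrow> bij_betw \<tau> K K \<and> \<tau> 1 = 1 \<and>
     (\<forall>x\<in>K. \<forall>y\<in>K. \<tau> (x + y) = \<tau> x + \<tau> y \<and> \<tau> (x * y) = \<tau> x * \<tau> y)"

definition rel_nontriv_aut :: "complex set \<Rightarrow> complex set \<Rightarrow> (complex \<Rightarrow> complex) \<Rightarrow> bool" where
  "rel_nontriv_aut K F \<sigma> \<longleftrightarrow> field_aut K \<sigma> \<and> (\<forall>x\<in>F. \<sigma> x = x) \<and> (\<exists>y\<in>K. \<sigma> y \<noteq> y)"

definition Am_s :: "complex set \<Rightarrow> complex set \<Rightarrow> complex set set set" where
  "Am_s K F = class_subgroup (OK K)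
     {I. nz_ideal (OK K) I \<and> (\<exists>\<sigma>. rel_nontriv_aut K F \<sigma> \<and> \<sigma> ` I = I)}"

definition capit_ker :: "complex set \<Rightarrow> complex set \<Rightarrow> complex set set set" where
  "capit_ker K L = {C \<in> classes (OK K). \<forall>I\<in>C. principal (OK L) (gen_ideal (OK L) I)}"

definition qnorm :: "complex set \<Rightarrow> complex \<Rightarrow> complex" where
  "qnorm K x = (THE n. \<exists>\<tau>. rel_nontriv_aut K (field_gen {}) \<tau> \<and> n = x * \<tau> x)"

definition fund_unit :: "complex set \<Rightarrow> complex" where
  "fund_unit K = (THE u. u \<in> units_OK K \<and> Im u = 0 \<and> Re u > 1 \<and>
      (\<forall>v\<in>units_OK K. Im v = 0 \<and> Re v > 1 \<longrightarrow> Re u \<le> Re v))"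

text \<open>Unit index q(K/Q) = [E_K : E_k1 E_k2 E_k3] for a real biquadratic field K
  with quadratic subfields k1, k2, k3.\<close>
definition unit_index :: "complex set \<Rightarrow> complex set \<Rightarrow> complex set \<Rightarrow> complex set \<Rightarrow> nat" where
  "unit_index K k1 k2 k3 =
     (let H = {a * b * c | a b c. a \<in> units_OK k1 \<and> b \<in> units_OK k2 \<and> c \<in> units_OK k3}
      in card {(\<lambda>x. u * x) ` H | u. u \<in> units_OK K})"

definition csqrt_nat :: "nat \<Rightarrow> complex" where
  "csqrt_nat n = complex_of_real (sqrt (real n))"

definition ram_prime :: "complex set \<Rightarrow> complex \<Rightarrow> complex set" where
  "ram_prime R \<pi> = (THE P. nz_ideal R P \<and> P \<noteq> R \<and>
      (\<forall>a\<in>R. \<forall>b\<in>R. a * b \<in> P \<longrightarrow> a \<in> P \<or> b \<in> P) \<and>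
      ideal_mult R P P = gen_ideal R {\<pi>})"

end

(*
  Put m = p1 p2 and theta = sqrt(2m) / (1 + i), so theta^2 = -i m. The ring of integers of k is
  Z[i] + Z[i] theta, and the primes of k ramified over Q(i) lie above 1 + i, pi1, ..., pi4. For a divisor
  c of (1 + i) m let Ic c be the ideal of all x + y theta with c dividing x - m y; for prime c this is
  the ramified prime above c. Every ideal invariant under theta -> -theta is t (Ic c) for Gaussian integers t, c,
  so the five ramified primes generate the strongly ambiguous classes, and theta gives the relation
  H1 H2 H3 H4 ~ 1. Let e be the fundamental unit of Q(sqrt(2m)).

  If N e = -1, the ideal generated by 1 + i e is invariant, hence equals t (Ic c); comparing norms at p2 shows
  that exactly one of pi3, pi4 divides c, which expresses H3 through H0, H1, H2. If N e = 1, the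
  descent on x^2 - 2m y^2 = 1 makes one of 2 e, p1 e, p2 e a square in Q(sqrt(2m)). In the first case sqrt e
  is a unit of Q(sqrt 2, sqrt m), and taking norms to Q(sqrt(2m)) shows that it is not a product of units of the
  three quadratic subfields, so Q is not 1. In the other cases H1 H2 or H3 H4 is principal.

  Capitulation: Ic c becomes principal in a field containing b as soon as b^2 is a unit times c. For
  c = 1 + i take b = 1 - zeta8. For c = pi_j choose x^2 + 1 = p y^2; then 1 + i x is a unit times pi_j or its
  conjugate times a square, and 1 + i (x + y sqrt p) has square 2 (1 + i x) up to units.
*)

theory Submission
  imports Defs "Jordan_Normal_Form.Char_Poly" "HOL-Analysis.Kronecker_Approximation_Theorem"
    "HOL-Computational_Algebra.Nth_Powers"
begin

(* Char_Poly loads HOL-Algebra, whose notation of this name would capture the constant in Defs. *)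
no_notation eq_classes (\<open>classes\<index>\<close>)

section \<open>Algebraic integers\<close>

text \<open>No unique factorisation of ideals is used: everything rests on the explicit lattices Ic
  c and on Bezout identities in Z[i]. One congruence serves all five ramified primes because it
  amounts to substituting -m for theta. This value is 0 modulo the divisors of m and 1 modulo 1 + i,
  and it is compatible with theta^2 = -i m modulo m (m + i), a multiple of (1 + i) m. The ideal of 1
  + i e is invariant when N e = -1 since 1 + i e' = (1 + i e) i e', where e' is the conjugate of e.
  The same identity in Q(sqrt p), with x + y sqrt p in place of e, produces the square roots needed
  for capitulation. When N e = 1, the descent could also make e itself a square; the minimality of e
  excludes this. The fundamental unit, the ramified primes and the norm are definite descriptions,
  so existence and uniqueness have to be established for each. For the fundamental unit this
  requires a solution of Pell's equation.\<close>

interpretation zmod: Modules.module "\<lambda>(k::int) (z::complex). of_int k * z"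
  by unfold_locales (simp_all add: algebra_simps)

lemma alg_int_iff_algebraic_int: "alg_int z \<longleftrightarrow> algebraic_int z"
  unfolding alg_int_def algebraic_int_altdef_ipoly by auto

text \<open>The determinant trick: multiplication by \<open>z\<close> acts on the generators through
  an integer matrix, and the vector of generators, nonzero because of \<open>s0\<close>, is an
  eigenvector for \<open>z\<close>. So \<open>z\<close> is a root of the monic characteristic
  polynomial.\<close>

lemma alg_int_if_stable_lattice:
  fixes z :: complex
  assumes S: "finite S" "s0 \<in> S" "s0 \<noteq> 0"
    and stable: "\<And>s. s \<in> S \<Longrightarrow> z * s \<in> zmod.span S"
  shows "alg_int z"
proof -
  obtain b where b: "bij_betw b {0..<card S} S"
    using ex_bij_betw_nat_finite[OF S(1)] by blast
  define n where "n = card S"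
  have "\<exists>c. z * b i = (\<Sum>j=0..<n. of_int (c j) * b j)" if "i < n" for i
  proof -
    have "b i \<in> S" using b that by (auto simp: n_def bij_betw_def)
    then obtain u where "z * b i = (\<Sum>s\<in>S. of_int (u s) * s)"
      using stable[of "b i"] unfolding zmod.span_finite[OF S(1)] by auto
    also have "\<dots> = (\<Sum>j=0..<n. of_int (u (b j)) * b j)"
      using sum.reindex_bij_betw[OF b, of "\<lambda>s. of_int (u s) * s"] by (simp add: n_def)
    finally show ?thesis by (rule exI[of _ "u \<circ> b", unfolded o_def])
  qed
  then obtain c where c: "\<And>i. i < n \<Longrightarrow> z * b i = (\<Sum>j=0..<n. of_int (c i j) * b j)"
    by metis
  define A where "A = Matrix.mat n n (\<lambda>(i,j). c i j)"
  define v where "v = Matrix.vec n b"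
  have A: "A \<in> carrier_mat n n" by (simp add: A_def)
  have Ac: "map_mat of_int A \<in> carrier_mat n n" using A by simp
  have "eigenvector (map_mat of_int A) v z"
    unfolding eigenvector_def
  proof (intro conjI)
    show "v \<in> carrier_vec (dim_row (map_mat of_int A))" by (simp add: v_def A_def)
    from b S(2) obtain i where i: "i < n" "b i = s0"
      unfolding n_def bij_betw_def by (metis atLeastLessThan_iff imageE)
    show "v \<noteq> 0\<^sub>v (dim_row (map_mat of_int A))"
    proof
      assume "v = 0\<^sub>v (dim_row (map_mat of_int A))"
      then have "vec_index v i = vec_index (0\<^sub>v n) i" by (simp add: A_def)
      then show False using i S(3) by (simp add: v_def)
    qed
    show "map_mat of_int A *\<^sub>v v = z \<cdot>\<^sub>v v"
      by (rule eq_vecI) (auto simp: A_def v_def scalar_prod_def c)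
  qed
  then have "poly (char_poly (map_mat of_int A)) z = 0"
    using eigenvalue_root_char_poly[OF Ac] unfolding eigenvalue_def by blast
  then have "poly (map_poly of_int (char_poly A)) z = 0"
    by (simp add: of_int_hom.char_poly_hom[OF A])
  moreover have "lead_coeff (char_poly A) = 1"
    using degree_monic_char_poly[OF A] by simp
  ultimately show ?thesis unfolding alg_int_def by blast
qed

lemma alg_int_power_reduction:
  assumes "alg_int z"
  obtains n c where "0 < n" "z ^ n = (\<Sum>k<n. of_int (c k) * z ^ k)"
proof -
  from assms obtain p :: "int poly"
    where p: "lead_coeff p = 1" "poly (map_poly of_int p) z = 0" unfolding alg_int_def by blast
  define n where "n = degree p"
  have "(\<Sum>k\<le>n. of_int (coeff p k) * z ^ k) = 0"
    using p(2) by (simp add: poly_altdef n_def coeff_map_poly degree_map_poly)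
  then have *: "z ^ n = (\<Sum>k<n. of_int (- coeff p k) * z ^ k)"
    using p(1) by (simp add: n_def lessThan_Suc_atMost[symmetric] sum_negf add_eq_0_iff2)
  \<comment> \<open>For n = 0 the relation would read 1 = 0.\<close>
  have "n \<noteq> 0"
    using * by (cases "n = 0") auto
  with * show ?thesis by (intro that[of n "\<lambda>k. - coeff p k"]) auto
qed

text \<open>The monomials x^i y^j with exponents below the two degrees span a lattice stable under
  both numbers, hence under their sum and product.\<close>

lemma alg_int_common_lattice:
  assumes x: "alg_int x" and y: "alg_int y"
  obtains S where "finite S" "1 \<in> S"
    "\<forall>s\<in>zmod.span S. x * s \<in> zmod.span S" "\<forall>s\<in>zmod.span S. y * s \<in> zmod.span S"
proof -
  obtain n c where n: "0 < n" and c: "x ^ n = (\<Sum>k<n. of_int (c k) * x ^ k)"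
    using alg_int_power_reduction[OF x] .
  obtain m d where m: "0 < m" and d: "y ^ m = (\<Sum>k<m. of_int (d k) * y ^ k)"
    using alg_int_power_reduction[OF y] .
  define S where "S = (\<lambda>(i,j). x ^ i * y ^ j) ` ({..<n} \<times> {..<m})"
  have S: "x ^ i * y ^ j \<in> zmod.span S" if "i < n" "j < m" for i j
    using that by (intro zmod.span_base) (auto simp: S_def)
  have x1: "x * s \<in> zmod.span S" if "s \<in> S" for s
  proof -
    from that obtain i j where ij: "i < n" "j < m" "s = x ^ i * y ^ j" by (auto simp: S_def)
    show ?thesis
    proof (cases "Suc i = n")
      case True
      have "x * s = x ^ n * y ^ j" unfolding ij(3) True[symmetric] by simp
      also have "\<dots> = (\<Sum>k<n. of_int (c k) * (x ^ k * y ^ j))"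
        by (simp add: c sum_distrib_right mult.assoc)
      also have "\<dots> \<in> zmod.span S"
        by (intro zmod.span_sum zmod.span_scale S) (use ij in auto)
      finally show ?thesis .
    next
      case False
      then have "x ^ Suc i * y ^ j \<in> zmod.span S" using ij by (intro S) auto
      then show ?thesis by (simp add: ij(3) mult.assoc)
    qed
  qed
  have y1: "y * s \<in> zmod.span S" if "s \<in> S" for s
  proof -
    from that obtain i j where ij: "i < n" "j < m" "s = x ^ i * y ^ j" by (auto simp: S_def)
    show ?thesis
    proof (cases "Suc j = m")
      case True
      have "y * s = x ^ i * y ^ m" unfolding ij(3) True[symmetric] by simp
      also have "\<dots> = (\<Sum>k<m. of_int (d k) * (x ^ i * y ^ k))"
        by (simp add: d sum_distrib_left mult_ac)
      also have "\<dots> \<in> zmod.span S"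
        by (intro zmod.span_sum zmod.span_scale S) (use ij in auto)
      finally show ?thesis .
    next
      case False
      then have "x ^ i * y ^ Suc j \<in> zmod.span S" using ij by (intro S) auto
      then show ?thesis by (simp add: ij(3) mult_ac)
    qed
  qed
  have ext: "w * s \<in> zmod.span S"
    if w: "\<And>s. s \<in> S \<Longrightarrow> w * s \<in> zmod.span S" and s: "s \<in> zmod.span S" for w s
    using s
  proof (induction rule: zmod.span_induct_alt)
    case base
    then show ?case by (simp add: zmod.span_zero)
  next
    case (step k a b)
    have "w * (of_int k * a + b) = of_int k * (w * a) + w * b" by (simp add: algebra_simps)
    then show ?case using step w by (simp add: zmod.span_add zmod.span_scale)
  qed
  show ?thesis
  proof (rule that[of S])
    show "finite S" by (simp add: S_def)
    show "1 \<in> S" using n m by (auto simp: S_def intro!: image_eqI[of _ _ "(0,0)"])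
  qed (use ext x1 y1 in blast)+
qed

lemma alg_int_add:
  assumes "alg_int x" "alg_int y"
  shows "alg_int (x + y)"
proof -
  obtain S where S: "finite S" "1 \<in> S"
    "\<forall>s\<in>zmod.span S. x * s \<in> zmod.span S" "\<forall>s\<in>zmod.span S. y * s \<in> zmod.span S"
    using alg_int_common_lattice[OF assms] .
  have "(x + y) * s \<in> zmod.span S" if "s \<in> S" for s
    unfolding distrib_right using S(3,4) zmod.span_base[OF that] zmod.span_add by blast
  then show ?thesis using alg_int_if_stable_lattice[OF S(1,2)] by simp
qed

lemma alg_int_mult:
  assumes "alg_int x" "alg_int y"
  shows "alg_int (x * y)"
proof -
  obtain S where S: "finite S" "1 \<in> S"
    "\<forall>s\<in>zmod.span S. x * s \<in> zmod.span S" "\<forall>s\<in>zmod.span S. y * s \<in> zmod.span S"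
    using alg_int_common_lattice[OF assms] .
  have "x * y * s \<in> zmod.span S" if "s \<in> S" for s
    unfolding mult.assoc using S(3,4) zmod.span_base[OF that] by blast
  then show ?thesis using alg_int_if_stable_lattice[OF S(1,2)] by simp
qed

lemma alg_int_of_int [simp]: "alg_int (of_int k)"
  by (simp add: alg_int_iff_algebraic_int int_imp_algebraic_int)

lemma alg_int_of_nat [simp]: "alg_int (of_nat k)"
  using alg_int_of_int[of "int k"] by simp

lemma alg_int_0 [simp]: "alg_int 0" and alg_int_1 [simp]: "alg_int 1"
  and alg_int_ii [simp]: "alg_int \<i>"
  using alg_int_of_int[of 0] alg_int_of_int[of 1] by (simp_all add: alg_int_iff_algebraic_int)

lemma alg_int_minus: "alg_int x \<Longrightarrow> alg_int (- x)"
  using alg_int_mult[OF alg_int_of_int[of "-1"]] by simp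

lemma alg_int_diff: "alg_int x \<Longrightarrow> alg_int y \<Longrightarrow> alg_int (x - y)"
  using alg_int_add[OF _ alg_int_minus] by force

lemma alg_int_if_power2: "alg_int (x^2) \<Longrightarrow> alg_int x"
  unfolding alg_int_iff_algebraic_int
  by (rule algebraic_int_root[where p = "monom 1 2"])
     (auto simp: poly_monom degree_monom_eq)

lemma alg_int_Rats_imp_Ints: "alg_int x \<Longrightarrow> x \<in> \<rat> \<Longrightarrow> x \<in> \<int>"
  by (simp add: alg_int_iff_algebraic_int rational_algebraic_int_is_int)

section \<open>Pell's equation\<close>

lemma sqrt_nat_irrational:
  assumes "\<And>s::nat. s^2 \<noteq> D"
  shows "sqrt (real D) \<notin> \<rat>"
proof
  assume "sqrt (real D) \<in> \<rat>"
  moreover have "algebraic_int (sqrt (real D))" by auto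
  ultimately have "sqrt (real D) \<in> \<int>" by (rule rational_algebraic_int_is_int[rotated])
  then obtain k where k: "sqrt (real D) = of_int k" by (auto elim: Ints_cases)
  have "real_of_int (int D) = (sqrt (real D))^2" by simp
  also have "\<dots> = real_of_int (k^2)" by (simp add: k)
  finally have "int D = \<bar>k\<bar>^2" by (simp only: of_int_eq_iff power2_abs)
  then have "D = (nat \<bar>k\<bar>)^2" by (metis nat_int nat_power_eq abs_ge_zero)
  with assms[of "nat \<bar>k\<bar>"] show False by simp
qed

lemma pell_solution_nonzero:
  fixes x y :: int
  assumes "x^2 - int D * y^2 = 1"
  shows "x \<noteq> 0"
proof
  assume "x = 0"
  then have "int D * y^2 = -1" using assms by simp
  moreover have "0 \<le> int D * y^2" by simp
  ultimately show False by linarith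
qed

lemma coprime_fraction_unique:
  fixes h k h' k' :: int
  assumes k: "k > 0" "k' > 0" "coprime h k" "coprime h' k'" and eq: "h * k' = h' * k"
  shows "h = h' \<and> k = k'"
proof -
  have "coprime k h" "coprime k' h'" using k(3,4) by (simp_all add: coprime_commute)
  moreover have "k dvd h * k'" "k' dvd h' * k" using eq by (metis dvd_triv_right)+
  ultimately have "k dvd k'" "k' dvd k" by (metis coprime_dvd_mult_right_iff)+
  then have "k = k'" using k(1,2) by (intro zdvd_antisym_nonneg) simp_all
  with eq k show ?thesis by simp
qed

text \<open>Infinitely many rational approximations h/k to sqrt D have bounded norm h^2 - D k^2. By
  the pigeonhole principle two of them share the norm N and both residues modulo N, and then the
  quotient of h + k sqrt D by h' + k' sqrt D has norm 1 and integral coordinates.\<close>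

lemma pell_equation_solvable:
  assumes D: "\<And>s::nat. s^2 \<noteq> D"
  obtains x y :: int where "x^2 - int D * y^2 = 1" "0 < x" "0 < y"
proof -
  define t where "t = sqrt (real D)"
  have t: "t \<notin> \<rat>" unfolding t_def using D by (rule sqrt_nat_irrational)
  have t0: "0 \<le> t" and t2: "t * t = real D" by (simp_all add: t_def)
  define Nm where "Nm = (\<lambda>(h::int, k::int). h^2 - int D * k^2)"
  \<comment> \<open>With r = t k - h the norm is r^2 - 2 t r k, and the approximations satisfy |r| k
    <= 1, whence the bound 1 + 2 t.\<close>
  define B where "B = \<lceil>1 + 2 * t\<rceil>"
  define f where "f = (\<lambda>(h::int, k::int). (Nm (h,k), h mod Nm (h,k), k mod Nm (h,k)))"
  have N0: "Nm (h,k) \<noteq> 0" if "k \<noteq> 0" for h k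
  proof
    assume "Nm (h,k) = 0"
    then have "real_of_int (h^2) = real_of_int (int D * k^2)" by (simp add: Nm_def)
    then have "(of_int h)^2 = (t * of_int k)^2" by (simp add: power2_eq_square t2[symmetric] algebra_simps)
    then have "t * of_int k = of_int h \<or> t * of_int k = - of_int h"
      by (metis power2_eq_iff)
    then have "t = of_int h / of_int k \<or> t = of_int (-h) / of_int k"
      using that by (auto simp: field_simps)
    then have "t \<in> \<rat>" by (metis Rats_divide Rats_of_int)
    with t show False ..
  qed
  have NB: "\<bar>Nm (h,k)\<bar> \<le> B" if "(h,k) \<in> approx_set t" for h k
  proof -
    from that have k: "k \<ge> 1" and a: "\<bar>t - of_int h / of_int k\<bar> < 1 / k^2" by (auto simp: approx_set_def)
    define r where "r = t * of_int k - of_int h"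
    have k': "real_of_int k \<ge> 1" using k by simp
    have "\<bar>r\<bar> = \<bar>t - of_int h / of_int k\<bar> * k"
    proof -
      have "r = (t - of_int h / of_int k) * k" using k' by (simp add: r_def field_simps)
      then show ?thesis using k' by (simp add: abs_mult)
    qed
    also have "\<dots> < 1 / k^2 * k" using a k' by (intro mult_strict_right_mono) auto
    also have "\<dots> = 1 / k" using k' by (simp add: power2_eq_square)
    finally have r: "\<bar>r\<bar> < 1 / k" .
    have rk: "\<bar>r\<bar> * k \<le> 1" using r k' by (simp add: field_simps)
    have r1: "\<bar>r\<bar> \<le> 1" using rk k' mult_left_mono[OF k', of "\<bar>r\<bar>"] by simp
    have "real_of_int (Nm (h,k)) = r * r - 2 * t * (r * k)"
      by (simp add: Nm_def r_def power2_eq_square algebra_simps t2[symmetric])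
    also have "\<bar>\<dots>\<bar> \<le> \<bar>r * r\<bar> + \<bar>2 * t * (r * k)\<bar>" by (rule abs_triangle_ineq4)
    also have "\<bar>r * r\<bar> \<le> 1" using mult_mono[OF r1 r1] by simp
    also have "\<bar>2 * t * (r * k)\<bar> \<le> 2 * t * 1"
      using rk t0 k' by (simp add: abs_mult mult_left_le)
    finally show ?thesis unfolding B_def by linarith
  qed
  have "f ` approx_set t \<subseteq> {-B..B} \<times> {-B..B} \<times> {-B..B}"
  proof safe
    fix h k a b c assume hk: "(h,k) \<in> approx_set t" and e: "(a,b,c) = f (h,k)"
    have "k \<noteq> 0" using hk by (auto simp: approx_set_def)
    then have le: "\<bar>x mod Nm (h,k)\<bar> \<le> \<bar>Nm (h,k)\<bar>" for x
      using abs_mod_less[OF N0, of k x h] by simp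
    then have "\<bar>a\<bar> \<le> B" "\<bar>b\<bar> \<le> B" "\<bar>c\<bar> \<le> B"
      using NB[OF hk] e order_trans[OF le NB[OF hk]] by (simp_all add: f_def)
    then show "a \<in> {-B..B}" "b \<in> {-B..B}" "c \<in> {-B..B}" by auto
  qed
  then have "finite (f ` approx_set t)" by (rule finite_subset) simp
  moreover have "infinite (approx_set t)" using t rational_iff_finite_approx_set by blast
  ultimately have "\<not> inj_on f (approx_set t)" using finite_imageD by blast
  then obtain h k h' k' where A: "(h,k) \<in> approx_set t" "(h',k') \<in> approx_set t"
    and ne: "(h,k) \<noteq> (h',k')" and f: "f (h,k) = f (h',k')"
    unfolding inj_on_def by (metis surj_pair)
  define N where "N = Nm (h,k)"
  have k: "k > 0" "k' > 0" "coprime h k" "coprime h' k'" using A by (auto simp: approx_set_def)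
  have N: "N \<noteq> 0" using N0 k(1) by (auto simp: N_def)
  have N': "N = h^2 - int D * k^2" "N = h'^2 - int D * k'^2"
    and m: "h mod N = h' mod N" "k mod N = k' mod N"
    using f by (auto simp: f_def N_def Nm_def)
  have d1: "N dvd h - h'" "N dvd k - k'" using m by (auto simp: mod_eq_dvd_iff)
  \<comment> \<open>The quotient (h + k sqrt D) / (h' + k' sqrt D) is x - y sqrt D; equal residues
    modulo N make both coordinates integral.\<close>
  have "h * h' - int D * (k * k') = N - (h * (h - h') - int D * k * (k - k'))"
    unfolding N'(1) by (simp add: algebra_simps power2_eq_square)
  also have "N dvd \<dots>" by (intro dvd_diff[OF dvd_refl dvd_diff[OF dvd_mult[OF d1(1)] dvd_mult[OF d1(2)]]])
  finally obtain x where x: "h * h' - int D * (k * k') = N * x" ..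
  have "h * k' - h' * k = (h - h') * k' - h' * (k - k')" by (simp add: algebra_simps)
  also have "N dvd \<dots>" by (intro dvd_diff[OF dvd_mult2[OF d1(1)] dvd_mult[OF d1(2)]])
  finally obtain y where y: "h * k' - h' * k = N * y" ..
  have "N^2 * (x^2 - int D * y^2) = (h * h' - int D * (k * k'))^2 - int D * (h * k' - h' * k)^2"
    unfolding x y by (simp add: algebra_simps power2_eq_square)
  also have "\<dots> = (h^2 - int D * k^2) * (h'^2 - int D * k'^2)"
    by (simp add: algebra_simps power2_eq_square)
  also have "\<dots> = N^2" using N' by (simp add: power2_eq_square)
  finally have 1: "x^2 - int D * y^2 = 1" using N by simp
  have "y \<noteq> 0"
  proof (rule notI)
    assume "y = 0"
    with y have "h * k' = h' * k" by simp
    from coprime_fraction_unique[OF k this] ne show False by blast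
  qed
  moreover have "x \<noteq> 0" using pell_solution_nonzero[OF 1] .
  ultimately show ?thesis using 1 by (intro that[of "\<bar>x\<bar>" "\<bar>y\<bar>"]) simp_all
qed

section \<open>Gaussian integers\<close>

text \<open>In the field of complex numbers \<open>dvd\<close> is trivial; on a type of their own
  the Gaussian integers carry the arithmetic divisibility relation.\<close>

typedef gint = "{z::complex. Re z \<in> \<int> \<and> Im z \<in> \<int>}"
  morphisms gc Abs_gint
  by (intro exI[of _ 0]) auto

setup_lifting type_definition_gint

instantiation gint :: idom
begin

lift_definition zero_gint :: gint is 0 by simp
lift_definition one_gint :: gint is 1 by simp
lift_definition plus_gint :: "gint \<Rightarrow> gint \<Rightarrow> gint" is "(+)" by auto
lift_definition minus_gint :: "gint \<Rightarrow> gint \<Rightarrow> gint" is "(-)" by auto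
lift_definition uminus_gint :: "gint \<Rightarrow> gint" is "uminus" by auto
lift_definition times_gint :: "gint \<Rightarrow> gint \<Rightarrow> gint" is "(*)" by auto

instance
  by standard (transfer; simp add: algebra_simps)+

end

lift_definition gcnj :: "gint \<Rightarrow> gint" is cnj by auto

lift_definition gcomplex :: "int \<Rightarrow> int \<Rightarrow> gint" is "\<lambda>a b. Complex (of_int a) (of_int b)" by auto

definition gi :: gint where "gi = gcomplex 0 1"

definition gnorm :: "gint \<Rightarrow> int" where
  "gnorm z = \<lfloor>Re (gc z)\<rfloor>^2 + \<lfloor>Im (gc z)\<rfloor>^2"

lemma gc_inject_iff: "gc x = gc y \<longleftrightarrow> x = y" by (rule gc_inject)

lemma gc_0 [simp]: "gc 0 = 0" and gc_1 [simp]: "gc 1 = 1"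
  and gc_add [simp]: "gc (x + y) = gc x + gc y"
  and gc_diff [simp]: "gc (x - y) = gc x - gc y"
  and gc_minus [simp]: "gc (- x) = - gc x"
  and gc_mult [simp]: "gc (x * y) = gc x * gc y"
  and gc_gcnj [simp]: "gc (gcnj x) = cnj (gc x)"
  and gc_gcomplex [simp]: "gc (gcomplex a b) = Complex (of_int a) (of_int b)"
  by (transfer; simp)+

lemma gc_gi [simp]: "gc gi = \<i>"
  by (simp add: gi_def complex_eq_iff)

lemma gc_of_nat [simp]: "gc (of_nat n) = of_nat n"
  by (induction n) auto

lemma gc_of_int [simp]: "gc (of_int n) = of_int n"
  by (cases n) (auto simp del: of_nat_Suc)

lemma gc_numeral [simp]: "gc (numeral n) = numeral n"
  using gc_of_nat[of "numeral n"] by simp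

lemma gc_eq_0_iff [simp]: "gc x = 0 \<longleftrightarrow> x = 0"
  using gc_inject[of x 0] by simp

lemma gint_exhaust: obtains a b where "x = gcomplex a b"
proof -
  obtain a b where "Re (gc x) = of_int a" "Im (gc x) = of_int b"
    using gc[of x] by (auto elim!: Ints_cases)
  then show ?thesis by (intro that[of a b]) (simp add: complex_eq_iff flip: gc_inject_iff)
qed

lemma gcomplex_eq_iff [simp]: "gcomplex a b = gcomplex c d \<longleftrightarrow> a = c \<and> b = d"
  by (simp flip: gc_inject_iff)

lemma of_int_gcomplex: "of_int n = gcomplex n 0"
  by (simp add: complex_eq_iff flip: gc_inject_iff)

lemma gcomplex_simps:
  "gcomplex a b + gcomplex c d = gcomplex (a + c) (b + d)"
  "gcomplex a b - gcomplex c d = gcomplex (a - c) (b - d)"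
  "- gcomplex a b = gcomplex (- a) (- b)"
  "gcomplex a b * gcomplex c d = gcomplex (a * c - b * d) (a * d + b * c)"
  "gcnj (gcomplex a b) = gcomplex a (- b)"
  by (simp_all add: complex_eq_iff flip: gc_inject_iff)

lemma gnorm_gcomplex [simp]: "gnorm (gcomplex a b) = a^2 + b^2"
  by (simp add: gnorm_def)

lemma gi_squared [simp]: "gi * gi = -1"
  by (simp flip: gc_inject_iff)

lemma gi_mult_gi [simp]: "gi * (gi * x) = - x"
  by (simp flip: mult.assoc)

lemma gnorm_mult: "gnorm (x * y) = gnorm x * gnorm y"
  by (cases x rule: gint_exhaust, cases y rule: gint_exhaust)
    (simp add: gcomplex_simps power2_eq_square algebra_simps)

lemma mult_gcnj: "x * gcnj x = of_int (gnorm x)"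
  by (cases x rule: gint_exhaust) (simp add: of_int_gcomplex gcomplex_simps power2_eq_square)

lemma gnorm_nonneg [simp]: "0 \<le> gnorm x"
  by (simp add: gnorm_def)

lemma gcomplex_eq_0_iff [simp]: "gcomplex a b = 0 \<longleftrightarrow> a = 0 \<and> b = 0"
  by (simp add: complex_eq_iff flip: gc_inject_iff)

lemma gnorm_eq_0_iff [simp]: "gnorm x = 0 \<longleftrightarrow> x = 0"
  by (cases x rule: gint_exhaust) (simp add: sum_power2_eq_zero_iff)

lemma gnorm_of_int [simp]: "gnorm (of_int n) = n^2"
  by (simp add: of_int_gcomplex)

lemma gnorm_gcnj [simp]: "gnorm (gcnj x) = gnorm x"
  by (cases x rule: gint_exhaust) (simp add: gcomplex_simps)

lemma gcnj_mult: "gcnj (x * y) = gcnj x * gcnj y"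
  by (simp flip: gc_inject_iff)

lemma gnorm_dvd: "x dvd y \<Longrightarrow> gnorm x dvd gnorm y"
  by (auto elim!: dvdE simp: gnorm_mult)

lemma gnorm_unit_iff: "gnorm u = 1 \<longleftrightarrow> u dvd 1"
proof
  assume "gnorm u = 1"
  then show "u dvd 1" using mult_gcnj[of u] by (metis dvdI of_int_1)
next
  assume "u dvd 1"
  then have "gnorm u dvd 1" using gnorm_dvd[of u 1] gnorm_of_int[of 1] by simp
  then show "gnorm u = 1" using gnorm_nonneg[of u] by (auto simp: abs_if)
qed

lemma gi_unit: "gi dvd 1"
  by (metis gi_squared dvd_minus_iff dvd_triv_left minus_minus)

lemma of_int_dvd_gcomplex_iff: "of_int n dvd gcomplex a b \<longleftrightarrow> n dvd a \<and> n dvd b"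
proof
  assume "of_int n dvd gcomplex a b"
  then obtain c where "gcomplex a b = of_int n * c" by (auto elim: dvdE)
  then show "n dvd a \<and> n dvd b"
    by (cases c rule: gint_exhaust) (simp add: of_int_gcomplex gcomplex_simps)
next
  assume "n dvd a \<and> n dvd b"
  then obtain c d where "a = n * c" "b = n * d" by (auto elim!: dvdE)
  then have "gcomplex a b = of_int n * gcomplex c d" by (simp add: of_int_gcomplex gcomplex_simps)
  then show "of_int n dvd gcomplex a b" by simp
qed

text \<open>With n the norm of \<open>d\<close>, the coordinates of \<open>x * gcnj d\<close>
  divided by n are rounded to integers. Both errors are at most 1/2, so the remainder has norm at
  most n/2.\<close>

lemma gint_euclid:
  assumes "d \<noteq> 0"
  obtains q where "gnorm (x - q * d) < gnorm d"
proof -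
  obtain a b where ab: "x * gcnj d = gcomplex a b" by (rule gint_exhaust)
  define n where "n = gnorm d"
  have n: "n > 0" using assms gnorm_nonneg[of d] by (simp add: n_def less_le)
  \<comment> \<open>\<open>(2 * a + n) div (2 * n)\<close> is a / n rounded to a nearest
    integer.\<close>
  define r s where "r = (2 * a + n) div (2 * n)" and "s = (2 * b + n) div (2 * n)"
  have *: "\<bar>2 * (c - ((2 * c + n) div (2 * n)) * n)\<bar> \<le> n" for c :: int
  proof -
    define t where "t = (2 * c + n) div (2 * n)"
    define e where "e = (2 * c + n) mod (2 * n)"
    have "2 * c + n = t * (2 * n) + e" unfolding t_def e_def by (rule div_mult_mod_eq[symmetric])
    moreover have "0 \<le> e" "e < 2 * n" using n by (simp_all add: e_def)
    ultimately show ?thesis unfolding t_def[symmetric] by (simp add: algebra_simps)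
  qed
  define q where "q = gcomplex r s"
  have "(x - q * d) * gcnj d = x * gcnj d - q * (d * gcnj d)" by (simp add: algebra_simps)
  also have "\<dots> = gcomplex (a - r * n) (b - s * n)"
    by (simp add: ab mult_gcnj q_def n_def[symmetric] of_int_gcomplex gcomplex_simps)
  finally have "gnorm (x - q * d) * n = (a - r * n)^2 + (b - s * n)^2"
    by (metis gnorm_mult gnorm_gcomplex gnorm_gcnj n_def)
  moreover have "(2 * (a - r * n))^2 \<le> n^2" "(2 * (b - s * n))^2 \<le> n^2"
    using *[of a] *[of b] n unfolding r_def s_def by (simp_all add: abs_le_square_iff[symmetric])
  ultimately have "4 * (gnorm (x - q * d) * n) \<le> 2 * n^2"
    by (simp add: power2_eq_square algebra_simps)
  then have "(4 * gnorm (x - q * d)) * n \<le> (2 * n) * n" by (simp add: power2_eq_square)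
  then have "4 * gnorm (x - q * d) \<le> 2 * n" using n mult_le_cancel_right_pos by blast
  then show ?thesis using n by (intro that[of q]) (simp add: n_def[symmetric])
qed

text \<open>Division by a nonzero element of least norm leaves no remainder.\<close>

lemma gint_ideal_principal:
  assumes zero: "0 \<in> I" and add: "\<And>x y. x \<in> I \<Longrightarrow> y \<in> I \<Longrightarrow> x + y \<in> I"
    and mult: "\<And>r x. x \<in> I \<Longrightarrow> r * x \<in> I"
  obtains d :: gint where "I = {x. d dvd x}"
proof (cases "I = {0}")
  case True
  then show ?thesis by (intro that[of 0]) auto
next
  case False
  then have "\<exists>x. x \<in> I \<and> x \<noteq> 0" using zero by blast
  then obtain d where d: "d \<in> I" "d \<noteq> 0"
    and least: "\<And>x. x \<in> I \<Longrightarrow> x \<noteq> 0 \<Longrightarrow> nat (gnorm d) \<le> nat (gnorm x)"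
    using ex_has_least_nat[of "\<lambda>x. x \<in> I \<and> x \<noteq> 0" _ "\<lambda>x. nat (gnorm x)"] by blast
  have "d dvd x" if x: "x \<in> I" for x
  proof -
    obtain q where q: "gnorm (x - q * d) < gnorm d" using gint_euclid[OF d(2)] .
    have "x - q * d \<in> I" using add[OF x mult[OF d(1), of "- q"]] by simp
    moreover have "\<not> nat (gnorm d) \<le> nat (gnorm (x - q * d))"
      using q gnorm_nonneg[of "x - q * d"] by linarith
    ultimately have "x - q * d = 0" using least[of "x - q * d"] by blast
    then show ?thesis by simp
  qed
  moreover have "x \<in> I" if "d dvd x" for x
    using that mult[OF d(1)] by (auto elim!: dvdE simp: mult.commute)
  ultimately show ?thesis by (intro that[of d]) auto
qed

text \<open>The type of Gaussian integers is no instance of a gcd class, so coprimality is expressed by Bezout coefficients.\<close>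
definition bezout :: "gint \<Rightarrow> gint \<Rightarrow> bool" where
  "bezout a b \<longleftrightarrow> (\<exists>u v. u * a + v * b = 1)"

lemma bezoutI: "u * a + v * b = 1 \<Longrightarrow> bezout a b"
  unfolding bezout_def by blast

lemma bezout_commute: "bezout a b \<longleftrightarrow> bezout b a"
  unfolding bezout_def by (metis add.commute)

lemma bezout_dvd_mult: "bezout a b \<Longrightarrow> a dvd b * c \<Longrightarrow> a dvd c"
proof -
  assume "bezout a b" and d: "a dvd b * c"
  then obtain u v where uv: "u * a + v * b = 1" by (auto simp: bezout_def)
  have "c = (u * a + v * b) * c" by (simp add: uv)
  also have "\<dots> = a * (u * c) + v * (b * c)" by (simp add: algebra_simps)
  also have "a dvd \<dots>" using d by simp
  finally show ?thesis .
qed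

lemma bezout_mult_dvd: "bezout a b \<Longrightarrow> a dvd c \<Longrightarrow> b dvd c \<Longrightarrow> a * b dvd c"
proof -
  assume ab: "bezout a b" and "a dvd c" "b dvd c"
  then obtain t where t: "c = b * t" by (auto elim: dvdE)
  with \<open>a dvd c\<close> have "a dvd t" using bezout_dvd_mult[OF ab] by blast
  then show ?thesis unfolding t mult.commute[of a b] by (rule mult_dvd_mono[OF dvd_refl])
qed

lemma bezout_mult: "bezout a b \<Longrightarrow> bezout a c \<Longrightarrow> bezout a (b * c)"
proof -
  assume "bezout a b" "bezout a c"
  then obtain u v s t where 1: "u * a + v * b = 1" and 2: "s * a + t * c = 1"
    by (auto simp: bezout_def)
  have "(u * s * a + u * t * c + v * b * s) * a + (v * t) * (b * c)
      = (u * a + v * b) * (s * a + t * c)" by (simp add: algebra_simps)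
  also have "\<dots> = 1" by (simp add: 1 2)
  finally show ?thesis by (rule bezoutI)
qed

lemma bezout_dvd_left: "bezout a b \<Longrightarrow> c dvd a \<Longrightarrow> bezout c b"
  unfolding bezout_def by (auto elim!: dvdE) (metis mult.assoc mult.commute)

lemma gint_gcd_exists:
  obtains d s t :: gint where "d = s * a + t * b" "d dvd a" "d dvd b"
proof -
  define I where "I = {x. \<exists>s t. x = s * a + t * b}"
  obtain d where d: "I = {x. d dvd x}"
  proof (rule gint_ideal_principal[of I])
    show "0 \<in> I" by (auto simp: I_def intro!: exI[of _ 0])
    show "x + y \<in> I" if "x \<in> I" "y \<in> I" for x y
    proof -
      from that obtain s t s' t' where "x = s * a + t * b" "y = s' * a + t' * b"
        by (auto simp: I_def)
      then have "x + y = (s + s') * a + (t + t') * b" by (simp add: algebra_simps)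
      then show ?thesis unfolding I_def by blast
    qed
    show "r * x \<in> I" if "x \<in> I" for r x
    proof -
      from that obtain s t where "x = s * a + t * b" by (auto simp: I_def)
      then have "r * x = (r * s) * a + (r * t) * b" by (simp add: algebra_simps)
      then show ?thesis unfolding I_def by blast
    qed
  qed
  have "d \<in> I" by (simp add: d)
  moreover have "a \<in> I" "b \<in> I"
    unfolding I_def using exI[of _ 1] exI[of _ 0] by (force intro: exI[of _ 0] exI[of _ 1])+
  ultimately have "d dvd a" "d dvd b" unfolding d by simp_all
  moreover have "\<exists>s t. d = s * a + t * b" using \<open>d \<in> I\<close> by (simp add: I_def)
  ultimately show ?thesis using that by blast
qed

text \<open>A common divisor of \<open>p\<close> and \<open>x\<close> has norm 1 or the norm of
  \<open>p\<close>. In the second case it is associated to \<open>p\<close>, which would then divide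
  \<open>x\<close>.\<close>

lemma bezout_if_prime_gnorm:
  assumes p: "prime (gnorm p)" and nd: "\<not> p dvd x"
  shows "bezout p x"
proof -
  obtain d s t where d: "d = s * p + t * x" "d dvd p" "d dvd x" by (rule gint_gcd_exists)
  from d(2) obtain e where e: "p = d * e" by (auto elim: dvdE)
  have "gnorm e \<noteq> 1"
  proof
    assume "gnorm e = 1"
    then have "e dvd 1" by (simp add: gnorm_unit_iff)
    then obtain e' where "1 = e * e'" by (auto elim: dvdE)
    then have "p * e' = d" by (simp add: e mult.assoc)
    then have "p dvd x" using d(3) by (metis dvd_trans dvd_triv_left)
    with nd show False ..
  qed
  moreover have "gnorm e = 1" if "gnorm d = gnorm p"
  proof -
    have "gnorm p * gnorm e = gnorm p * 1"
      using gnorm_mult[of d e] unfolding e[symmetric] that by simp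
    moreover have "gnorm p \<noteq> 0" using p by (metis not_prime_0)
    ultimately show ?thesis by (simp only: mult_cancel_left) blast
  qed
  moreover have "gnorm d = 1 \<or> gnorm d = gnorm p"
    using p gnorm_dvd[OF d(2)] by (simp add: prime_int_iff)
  ultimately have "gnorm d = 1" by blast
  then obtain w where "1 = d * w" by (auto simp: gnorm_unit_iff elim: dvdE)
  then have "(w * s) * p + (w * t) * x = 1" unfolding d(1) by (simp add: algebra_simps)
  then show ?thesis by (rule bezoutI)
qed

lemma prime_gnorm_dvd_mult:
  assumes "prime (gnorm p)" "p dvd x * y"
  shows "p dvd x \<or> p dvd y"
  using bezout_if_prime_gnorm[OF assms(1), of x] bezout_dvd_mult assms(2) by blast

lemma prime_gnorm_not_unit: "prime (gnorm p) \<Longrightarrow> \<not> p dvd 1"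
  by (metis gnorm_unit_iff not_prime_1)

text \<open>Let d = gcd(u, z). Since z^2 = u v, the square d^2 is a multiple of u; conversely d^2
  divides u = p u^2 + q z^2, where p u + q v = 1. Hence u and d^2 are associated.\<close>

lemma bezout_square_factor:
  assumes uv: "bezout u v" "u * v = z^2" and u0: "u \<noteq> 0"
  obtains w d where "w dvd 1" "u = w * d^2"
proof -
  obtain d s t where d: "d = s * u + t * z" "d dvd u" "d dvd z" by (rule gint_gcd_exists)
  have "d^2 = u * (s^2 * u + 2 * s * t * z + t^2 * v)"
    by (simp add: d(1) power2_eq_square algebra_simps uv(2)[unfolded power2_eq_square, symmetric])
  then obtain e where e: "d^2 = u * e" by blast
  obtain p q where pq: "p * u + q * v = 1" using uv(1) by (auto simp: bezout_def)
  have "u = (p * u + q * v) * u" by (simp add: pq)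
  also have "\<dots> = p * (u * u) + q * z^2" by (simp add: uv(2)[symmetric] algebra_simps)
  also have "d^2 dvd \<dots>"
    using d(2,3) by (simp add: power2_eq_square mult_dvd_mono)
  finally obtain w where w: "u = d^2 * w" by (auto elim: dvdE)
  have "u * (e * w) = u * 1" using w e by (simp add: mult_ac)
  then have "e * w = 1" using u0 by (metis mult_cancel_left)
  then have "w dvd 1" by (metis dvd_triv_right)
  then show ?thesis using w by (intro that[of w d]) (simp_all add: mult.commute)
qed

section \<open>Divisibility by the prime 1 + i\<close>

lemma one_plus_gi_dvd_iff: "1 + gi dvd gcomplex a b \<longleftrightarrow> even (a + b)"
proof
  have e: "1 + gi = gcomplex 1 1" by (simp add: complex_eq_iff flip: gc_inject_iff)
  assume "1 + gi dvd gcomplex a b"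
  then obtain c where "gcomplex a b = (1 + gi) * c" by (auto elim: dvdE)
  then show "even (a + b)" unfolding e by (cases c rule: gint_exhaust) (simp add: gcomplex_simps)
next
  have e: "1 + gi = gcomplex 1 1" by (simp add: complex_eq_iff flip: gc_inject_iff)
  assume "even (a + b)"
  then obtain k where "a + b = 2 * k" by (rule evenE)
  then have "a = 2 * k - b" by simp
  then have "gcomplex a b = (1 + gi) * gcomplex k (b - k)"
    unfolding e by (simp add: gcomplex_simps)
  then show "1 + gi dvd gcomplex a b" by (metis dvd_triv_left)
qed

lemma gnorm_one_plus_gi [simp]: "gnorm (1 + gi) = 2"
proof -
  have "1 + gi = gcomplex 1 1" by (simp add: complex_eq_iff flip: gc_inject_iff)
  then show ?thesis by simp
qed

lemma one_plus_gi_squared: "(1 + gi) * (1 + gi) = 2 * gi"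
  by (simp add: algebra_simps)

lemma bezout_one_plus_gi: "\<not> 1 + gi dvd x \<Longrightarrow> bezout (1 + gi) x"
  by (rule bezout_if_prime_gnorm) simp_all

text \<open>Squares in the Gaussian integers are rational modulo 2, so the two summands cannot cancel
  modulo 2 unless both are divisible by 2.\<close>
lemma two_dvd_square_plus_i_square:
  fixes x y :: gint and m :: int
  assumes m: "odd m" and d: "2 dvd x^2 + gi * of_int m * y^2"
  shows "1 + gi dvd x" "1 + gi dvd y"
proof -
  obtain a b c d where xy: "x = gcomplex a b" "y = gcomplex c d" by (metis gint_exhaust)
  have "x^2 + gi * of_int m * y^2 = gcomplex (a * a - b * b - m * (2 * (c * d))) (2 * (a * b) + m * (c * c - d * d))"
    unfolding xy gi_def power2_eq_square by (simp add: of_int_gcomplex gcomplex_simps algebra_simps)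
  with d have "of_int 2 dvd gcomplex (a * a - b * b - m * (2 * (c * d))) (2 * (a * b) + m * (c * c - d * d))"
    by simp
  then have "even (a * a - b * b - m * (2 * (c * d)))" "even (2 * (a * b) + m * (c * c - d * d))"
    unfolding of_int_dvd_gcomplex_iff by simp_all
  then have "even (a + b)" "even (c + d)" using m by auto
  then show "1 + gi dvd x" "1 + gi dvd y" by (simp_all add: xy one_plus_gi_dvd_iff)
qed

text \<open>A factor 1 + i comes out of x and y, and (1 + i)^2 = 2 i, so the cofactors satisfy the
  congruence modulo 2 once more. This is what rules out denominators 2 in the integers of k.\<close>

lemma four_dvd_square_plus_i_square:
  fixes x y :: gint and m :: int
  assumes m: "odd m" and d: "4 dvd x^2 + gi * of_int m * y^2"
  shows "2 dvd x" "2 dvd y"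
proof -
  have "2 dvd (4::gint)" by (rule dvdI[of _ _ 2]) simp
  then have "2 dvd x^2 + gi * of_int m * y^2" using d by (rule dvd_trans)
  then obtain x' y' where xy: "x = (1 + gi) * x'" "y = (1 + gi) * y'"
    using two_dvd_square_plus_i_square[OF m, of x y] unfolding dvd_def by blast
  have ring: "((1 + g) * x)^2 + g * n * ((1 + g) * y)^2 = ((1 + g) * (1 + g)) * (x^2 + g * n * y^2)"
    for g n x y :: gint by (simp add: power2_eq_square algebra_simps)
  have "x^2 + gi * of_int m * y^2 = ((1 + gi) * (1 + gi)) * (x'^2 + gi * of_int m * y'^2)"
    unfolding xy by (rule ring)
  also have "\<dots> = 2 * (gi * (x'^2 + gi * of_int m * y'^2))" unfolding one_plus_gi_squared by (simp only: mult.assoc)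
  finally have "2 * 2 dvd 2 * (gi * (x'^2 + gi * of_int m * y'^2))" using d by simp
  then have "2 dvd gi * (x'^2 + gi * of_int m * y'^2)"
    unfolding dvd_mult_cancel_left by (simp flip: gc_inject_iff)
  then have "2 dvd gi * (gi * (x'^2 + gi * of_int m * y'^2))" by (rule dvd_mult)
  then have "2 dvd x'^2 + gi * of_int m * y'^2" unfolding gi_mult_gi dvd_minus_iff .
  then obtain x'' y'' where "x' = (1 + gi) * x''" "y' = (1 + gi) * y''"
    using two_dvd_square_plus_i_square[OF m, of x' y'] unfolding dvd_def by blast
  then have "x = 2 * (gi * x'')" "y = 2 * (gi * y'')"
    unfolding xy by (simp_all flip: mult.assoc add: one_plus_gi_squared)
  then show "2 dvd x" "2 dvd y" by simp_all
qed

section \<open>Ideal classes\<close>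

definition is_subring :: "complex set \<Rightarrow> bool" where
  "is_subring R \<longleftrightarrow> 0 \<in> R \<and> 1 \<in> R \<and> (\<forall>x\<in>R. \<forall>y\<in>R. x + y \<in> R \<and> x - y \<in> R \<and> x * y \<in> R)"

lemma is_subring_uminus: "is_subring R \<Longrightarrow> x \<in> R \<Longrightarrow> - x \<in> R"
  unfolding is_subring_def by (metis diff_0)

lemma is_idealI:
  assumes "I \<subseteq> R" "0 \<in> I" "\<And>x y. x \<in> I \<Longrightarrow> y \<in> I \<Longrightarrow> x + y \<in> I"
    "\<And>r x. r \<in> R \<Longrightarrow> x \<in> I \<Longrightarrow> r * x \<in> I"
  shows "is_ideal R I"
  using assms unfolding is_ideal_def by blast

lemma is_idealD:
  assumes "is_ideal R I"
  shows "x \<in> I \<Longrightarrow> x \<in> R" "0 \<in> I" "x \<in> I \<Longrightarrow> y \<in> I \<Longrightarrow> x + y \<in> I"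
    "r \<in> R \<Longrightarrow> x \<in> I \<Longrightarrow> r * x \<in> I"
  using assms unfolding is_ideal_def by blast+

lemma is_ideal_self: "is_subring R \<Longrightarrow> is_ideal R R"
  by (rule is_idealI) (auto simp: is_subring_def)

lemma gen_ideal_superset: "S \<subseteq> gen_ideal R S"
  unfolding gen_ideal_def by blast

lemma gen_ideal_least: "is_ideal R L \<Longrightarrow> S \<subseteq> L \<Longrightarrow> gen_ideal R S \<subseteq> L"
  unfolding gen_ideal_def by blast

lemma is_ideal_gen_ideal:
  assumes R: "is_subring R" and S: "S \<subseteq> R"
  shows "is_ideal R (gen_ideal R S)"
proof (rule is_idealI)
  show "gen_ideal R S \<subseteq> R" by (rule gen_ideal_least[OF is_ideal_self[OF R] S])
qed (auto simp: gen_ideal_def is_ideal_def)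

lemma is_ideal_times:
  assumes R: "is_subring R" and I: "is_ideal R I" and a: "a \<in> R"
  shows "is_ideal R ((*) a ` I)"
proof (rule is_idealI)
  show "(*) a ` I \<subseteq> R" using R a is_idealD(1)[OF I] by (auto simp: is_subring_def)
  show "0 \<in> (*) a ` I" using is_idealD(2)[OF I] by force
  show "x + y \<in> (*) a ` I" if "x \<in> (*) a ` I" "y \<in> (*) a ` I" for x y
    using that is_idealD(3)[OF I] by (auto simp flip: distrib_left)
  show "r * x \<in> (*) a ` I" if "r \<in> R" "x \<in> (*) a ` I" for r x
  proof -
    from that(2) obtain y where "y \<in> I" "x = a * y" by blast
    then have "r * x = a * (r * y)" "r * y \<in> I" using is_idealD(4)[OF I that(1)] by simp_all
    then show ?thesis by blast
  qed
qed

text \<open>With this colon ideal, an inclusion of a multiple of a generated ideal in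
  \<open>I\<close> needs to be checked on generators only.\<close>

lemma is_ideal_quotient:
  assumes R: "is_subring R" and I: "is_ideal R I" and a: "a \<in> R"
  shows "is_ideal R {x \<in> R. a * x \<in> I}"
proof (rule is_idealI)
  show "0 \<in> {x \<in> R. a * x \<in> I}" using R is_idealD(2)[OF I] by (auto simp: is_subring_def)
  show "x + y \<in> {x \<in> R. a * x \<in> I}" if "x \<in> {x \<in> R. a * x \<in> I}" "y \<in> {x \<in> R. a * x \<in> I}" for x y
    using that R is_idealD(3)[OF I] by (auto simp: is_subring_def distrib_left)
  show "r * x \<in> {x \<in> R. a * x \<in> I}" if "r \<in> R" "x \<in> {x \<in> R. a * x \<in> I}" for r x
    using that R is_idealD(4)[OF I that(1), of "a * x"] by (simp add: is_subring_def mult.left_commute[of a r x])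
qed auto

lemma gen_ideal_times:
  assumes R: "is_subring R" and S: "S \<subseteq> R" and a: "a \<in> R"
  shows "gen_ideal R ((*) a ` S) = (*) a ` gen_ideal R S"
proof
  show "gen_ideal R ((*) a ` S) \<subseteq> (*) a ` gen_ideal R S"
    by (intro gen_ideal_least is_ideal_times R a is_ideal_gen_ideal S image_mono gen_ideal_superset)
  have aS: "(*) a ` S \<subseteq> R" using R S a by (auto simp: is_subring_def)
  have "gen_ideal R S \<subseteq> {x \<in> R. a * x \<in> gen_ideal R ((*) a ` S)}"
    by (intro gen_ideal_least is_ideal_quotient R a is_ideal_gen_ideal aS)
      (use S gen_ideal_superset[of "(*) a ` S" R] in blast)
  then show "(*) a ` gen_ideal R S \<subseteq> gen_ideal R ((*) a ` S)" by blast
qed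

lemma gen_ideal_singleton:
  assumes R: "is_subring R" and a: "a \<in> R"
  shows "gen_ideal R {a} = (*) a ` R"
proof -
  have "1 \<in> R" using R by (simp add: is_subring_def)
  then have "gen_ideal R {1} = R"
    using gen_ideal_least[OF is_ideal_self[OF R], of "{1}"] is_idealD(4)[OF is_ideal_gen_ideal[OF R, of "{1}"]]
      gen_ideal_superset[of "{1}" R] by fastforce
  then show ?thesis using gen_ideal_times[OF R, of "{1}" a] \<open>1 \<in> R\<close> a by simp
qed

lemma image_times_image: "(*) a ` ((*) b ` I) = (*) (a * b) ` I" for I :: "complex set"
  unfolding image_image by (rule image_cong) (simp_all add: mult.assoc)

lemma image_times_cancel:
  fixes a :: complex
  assumes "a \<noteq> 0" "(*) a ` I = (*) a ` J"
  shows "I = J"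
  using assms inj_image_eq_iff[of "\<lambda>x. a * x"] by (auto simp: inj_on_def)

lemma ideal_equiv_refl: "is_subring R \<Longrightarrow> ideal_equiv R I I"
  unfolding ideal_equiv_def is_subring_def by (auto intro!: bexI[of _ 1])

lemma ideal_equiv_sym: "ideal_equiv R I J \<Longrightarrow> ideal_equiv R J I"
  unfolding ideal_equiv_def by metis

lemma ideal_equiv_trans:
  assumes R: "is_subring R" and "ideal_equiv R I J" "ideal_equiv R J K"
  shows "ideal_equiv R I K"
proof -
  from assms(2) obtain a b where ab: "a \<in> R" "b \<in> R" "a \<noteq> 0" "b \<noteq> 0" "(*) a ` I = (*) b ` J"
    unfolding ideal_equiv_def by blast
  from assms(3) obtain c d where cd: "c \<in> R" "d \<in> R" "c \<noteq> 0" "d \<noteq> 0" "(*) c ` J = (*) d ` K"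
    unfolding ideal_equiv_def by blast
  have "(*) (c * a) ` I = (*) (b * d) ` K"
    unfolding image_times_image[symmetric] ab(5) cd(5)[symmetric]
    unfolding image_times_image by (simp only: mult.commute)
  moreover have "c * a \<in> R" "b * d \<in> R" "c * a \<noteq> 0" "b * d \<noteq> 0"
    using R ab cd by (auto simp: is_subring_def)
  ultimately show ?thesis unfolding ideal_equiv_def by blast
qed

lemma cls_eq_iff:
  assumes R: "is_subring R" and I: "nz_ideal R I"
  shows "cls R I = cls R J \<longleftrightarrow> ideal_equiv R J I"
proof
  assume "cls R I = cls R J"
  moreover have "I \<in> cls R I" using I ideal_equiv_refl[OF R] by (simp add: cls_def)
  ultimately show "ideal_equiv R J I" by (simp add: cls_def)
next
  assume JI: "ideal_equiv R J I"
  have "ideal_equiv R I K \<longleftrightarrow> ideal_equiv R J K" for K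
    by (rule iffI[OF ideal_equiv_trans[OF R JI] ideal_equiv_trans[OF R ideal_equiv_sym[OF JI]]])
  then show "cls R I = cls R J" by (simp add: cls_def)
qed

section \<open>Multiplication of ideals and of ideal classes\<close>

lemma ideal_products_subset:
  assumes "is_subring R" "is_ideal R I" "is_ideal R J"
  shows "{a * b | a b. a \<in> I \<and> b \<in> J} \<subseteq> R"
  using assms by (auto simp: is_subring_def is_ideal_def)

lemma is_ideal_ideal_mult:
  assumes "is_subring R" "is_ideal R I" "is_ideal R J"
  shows "is_ideal R (ideal_mult R I J)"
  unfolding ideal_mult_def using assms(1) ideal_products_subset[OF assms] by (rule is_ideal_gen_ideal)

lemma ideal_multI: "a \<in> I \<Longrightarrow> b \<in> J \<Longrightarrow> a * b \<in> ideal_mult R I J"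
  unfolding ideal_mult_def by (rule gen_ideal_superset[THEN subsetD]) blast

lemma ideal_mult_least:
  "is_ideal R L \<Longrightarrow> (\<And>a b. a \<in> I \<Longrightarrow> b \<in> J \<Longrightarrow> a * b \<in> L) \<Longrightarrow> ideal_mult R I J \<subseteq> L"
  unfolding ideal_mult_def by (rule gen_ideal_least) auto

lemma nz_ideal_ideal_mult:
  assumes R: "is_subring R" and I: "nz_ideal R I" and J: "nz_ideal R J"
  shows "nz_ideal R (ideal_mult R I J)"
proof -
  obtain a b where "a \<in> I" "a \<noteq> 0" "b \<in> J" "b \<noteq> 0"
    using I J unfolding nz_ideal_def is_ideal_def by blast
  then have "a * b \<in> ideal_mult R I J" "a * b \<noteq> 0" by (auto intro: ideal_multI)
  then have "ideal_mult R I J \<noteq> {0}" by (metis singletonD)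
  moreover have "is_ideal R (ideal_mult R I J)"
    using R I J by (intro is_ideal_ideal_mult) (simp_all add: nz_ideal_def)
  ultimately show ?thesis by (simp add: nz_ideal_def)
qed

lemma ideal_mult_commute: "ideal_mult R I J = ideal_mult R J I"
  unfolding ideal_mult_def by (rule arg_cong[where f = "gen_ideal R"]) (metis mult.commute)

lemma ideal_mult_times:
  assumes R: "is_subring R" and I: "is_ideal R I" and J: "is_ideal R J" and a: "a \<in> R"
  shows "ideal_mult R ((*) a ` I) J = (*) a ` ideal_mult R I J"
proof -
  have "{x * b | x b. x \<in> (*) a ` I \<and> b \<in> J} = (*) a ` {x * b | x b. x \<in> I \<and> b \<in> J}"
  proof (intro equalityI subsetI)
    fix y assume "y \<in> (*) a ` {x * b | x b. x \<in> I \<and> b \<in> J}"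
    then obtain x b where "x \<in> I" "b \<in> J" "y = (a * x) * b" by (auto simp: mult.assoc)
    then show "y \<in> {x * b | x b. x \<in> (*) a ` I \<and> b \<in> J}" by blast
  next
    fix y assume "y \<in> {x * b | x b. x \<in> (*) a ` I \<and> b \<in> J}"
    then obtain x b where "x \<in> I" "b \<in> J" "y = a * (x * b)" by (auto simp: mult.assoc)
    then show "y \<in> (*) a ` {x * b | x b. x \<in> I \<and> b \<in> J}" by blast
  qed
  then show ?thesis
    unfolding ideal_mult_def using gen_ideal_times[OF R ideal_products_subset[OF R I J] a] by simp
qed

lemma ideal_equiv_mult_left:
  assumes R: "is_subring R" and I: "is_ideal R I" "is_ideal R I'" and J: "is_ideal R J"
    and eq: "ideal_equiv R I I'"
  shows "ideal_equiv R (ideal_mult R I J) (ideal_mult R I' J)"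
proof -
  from eq obtain a b where "a \<in> R" "b \<in> R" "a \<noteq> 0" "b \<noteq> 0" "(*) a ` I = (*) b ` I'"
    unfolding ideal_equiv_def by blast
  then show ?thesis
    unfolding ideal_equiv_def using ideal_mult_times[OF R] I J by metis
qed

lemma ideal_equiv_mult:
  assumes R: "is_subring R" and I: "is_ideal R I" "is_ideal R I'" and J: "is_ideal R J" "is_ideal R J'"
    and "ideal_equiv R I I'" "ideal_equiv R J J'"
  shows "ideal_equiv R (ideal_mult R I J) (ideal_mult R I' J')"
  using ideal_equiv_trans[OF R ideal_equiv_mult_left[OF R I J(1)]]
    ideal_equiv_mult_left[OF R J I(2)] assms(6,7) by (simp add: ideal_mult_commute)

text \<open>\<open>class_mult\<close> multiplies chosen representatives; it can be evaluated because
  multiplication of ideals respects equivalence.\<close>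

lemma class_mult_cls:
  assumes R: "is_subring R" and I: "nz_ideal R I" and J: "nz_ideal R J"
  shows "class_mult R (cls R I) (cls R J) = cls R (ideal_mult R I J)"
proof -
  define I' J' where "I' = (SOME I'. I' \<in> cls R I)" and "J' = (SOME J'. J' \<in> cls R J)"
  have "I \<in> cls R I" "J \<in> cls R J" using I J ideal_equiv_refl[OF R] by (simp_all add: cls_def)
  then have "I' \<in> cls R I" "J' \<in> cls R J" unfolding I'_def J'_def by (metis someI)+
  then have *: "nz_ideal R I'" "nz_ideal R J'" "ideal_equiv R I I'" "ideal_equiv R J J'"
    by (simp_all add: cls_def)
  then have "ideal_equiv R (ideal_mult R I J) (ideal_mult R I' J')"
    using I J by (intro ideal_equiv_mult[OF R]) (simp_all add: nz_ideal_def)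
  then have "cls R (ideal_mult R I' J') = cls R (ideal_mult R I J)"
    using cls_eq_iff[OF R nz_ideal_ideal_mult[OF R *(1,2)], of "ideal_mult R I J"] by simp
  then show ?thesis unfolding class_mult_def I'_def J'_def .
qed

lemma class_subgroup_subset_classes:
  assumes R: "is_subring R" and C: "C \<in> class_subgroup R G"
  shows "C \<in> classes R"
  using C
proof induction
  case one
  have "nz_ideal R R" using is_ideal_self[OF R] R by (auto simp: nz_ideal_def is_subring_def)
  then show ?case unfolding classes_def by blast
next
  case (mult C D)
  then obtain I J where "nz_ideal R I" "nz_ideal R J" "C = cls R I" "D = cls R J"
    unfolding classes_def by blast
  then show ?case using class_mult_cls[OF R] nz_ideal_ideal_mult[OF R] unfolding classes_def by blast
qed (auto simp: classes_def)

lemma class_subgroup_subsetI: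
  assumes "\<And>I. I \<in> G \<Longrightarrow> nz_ideal R I \<Longrightarrow> cls R I \<in> class_subgroup R H"
  shows "class_subgroup R G \<subseteq> class_subgroup R H"
proof
  fix C assume "C \<in> class_subgroup R G"
  then show "C \<in> class_subgroup R H"
    by induction (blast intro: assms class_subgroup.intros)+
qed

lemma class_subgroup_mult:
  assumes "is_subring R" "nz_ideal R I" "nz_ideal R J"
    "cls R I \<in> class_subgroup R G" "cls R J \<in> class_subgroup R G"
  shows "cls R (ideal_mult R I J) \<in> class_subgroup R G"
  using class_subgroup.mult[OF assms(4,5)] class_mult_cls[OF assms(1-3)] by simp

text \<open>The rule \<open>inv\<close> admits any class inverse to a member, so a relation I J ~ 1
  transfers membership from the class of I to that of J.\<close>

lemma class_subgroup_cancel: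
  assumes "is_subring R" "nz_ideal R I" "nz_ideal R J"
    "cls R I \<in> class_subgroup R G" "cls R (ideal_mult R I J) = cls R R"
  shows "cls R J \<in> class_subgroup R G"
  using assms class_mult_cls[OF assms(1-3)]
  by (intro class_subgroup.inv[OF assms(4)]) (auto simp: classes_def)

lemma cls_times:
  assumes R: "is_subring R" and I: "nz_ideal R I" and a: "a \<in> R" "a \<noteq> 0"
  shows "cls R ((*) a ` I) = cls R I"
proof -
  have "1 \<in> R" using R by (simp add: is_subring_def)
  then have "ideal_equiv R ((*) a ` I) I"
    unfolding ideal_equiv_def using a by (intro bexI[of _ 1] bexI[of _ a]) auto
  then show ?thesis using cls_eq_iff[OF R I, of "(*) a ` I"] by simp
qed

lemma cls_principal:
  assumes R: "is_subring R" and a: "a \<in> R" "a \<noteq> 0"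
  shows "cls R ((*) a ` R) = cls R R"
proof -
  have "nz_ideal R R" using is_ideal_self[OF R] R by (auto simp: nz_ideal_def is_subring_def)
  then show ?thesis using cls_times[OF R _ a] by blast
qed

text \<open>Multiplicativity of extension when \<open>I\<close> becomes principal. For one
  inclusion, g times the extension of J is contracted to R. For the other, two colon ideals lead
  from the products a b to the products g b, and from these to all of g times the extension of
  J.\<close>

lemma gen_ideal_extension_times:
  assumes S: "is_subring S" and RS: "R \<subseteq> S" and I: "is_ideal R I" and J: "is_ideal R J" and R: "is_subring R"
    and g: "g \<in> S" "gen_ideal S I = (*) g ` S"
  shows "gen_ideal S (ideal_mult R I J) = (*) g ` gen_ideal S J"
proof
  have IS: "I \<subseteq> S" and JS: "J \<subseteq> S" using I J RS by (auto simp: is_ideal_def)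
  have IJ: "ideal_mult R I J \<subseteq> S" using is_ideal_ideal_mult[OF R I J] RS by (auto simp: is_ideal_def)
  have gJ: "is_ideal S (gen_ideal S J)" by (rule is_ideal_gen_ideal[OF S JS])
  then have L: "is_ideal S ((*) g ` gen_ideal S J)" by (rule is_ideal_times[OF S _ g(1)])
  have "is_ideal R (R \<inter> (*) g ` gen_ideal S J)"
    by (rule is_idealI) (use L R RS in \<open>auto simp: is_ideal_def is_subring_def\<close>)
  then have "ideal_mult R I J \<subseteq> R \<inter> (*) g ` gen_ideal S J"
  proof (rule ideal_mult_least)
    fix a b assume ab: "a \<in> I" "b \<in> J"
    then have "a * b \<in> R" using R I J by (auto simp: is_ideal_def is_subring_def)
    moreover obtain s where s: "a = g * s" "s \<in> S" using ab g(2) gen_ideal_superset[of I S] by blast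
    moreover have "s * b \<in> gen_ideal S J"
      using is_idealD(4)[OF gJ s(2)] ab gen_ideal_superset[of J S] by blast
    ultimately show "a * b \<in> R \<inter> (*) g ` gen_ideal S J" by (auto simp: mult.assoc)
  qed
  then show "gen_ideal S (ideal_mult R I J) \<subseteq> (*) g ` gen_ideal S J"
    by (intro gen_ideal_least L) blast
  define M where "M = gen_ideal S (ideal_mult R I J)"
  have M: "is_ideal S M" unfolding M_def by (rule is_ideal_gen_ideal[OF S IJ])
  have IM: "a * b \<in> M" if "a \<in> I" "b \<in> J" for a b
    unfolding M_def by (rule gen_ideal_superset[THEN subsetD]) (rule ideal_multI[OF that])
  have "g * b \<in> M" if b: "b \<in> J" for b
  proof -
    have "gen_ideal S I \<subseteq> {x \<in> S. b * x \<in> M}"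
      by (intro gen_ideal_least is_ideal_quotient[OF S M]) (use b JS IS IM in \<open>auto simp: mult.commute\<close>)
    moreover have "g * 1 \<in> gen_ideal S I" unfolding g(2) using S by (auto simp only: is_subring_def)
    ultimately show ?thesis by (auto simp: mult.commute)
  qed
  then have "gen_ideal S J \<subseteq> {x \<in> S. g * x \<in> M}"
    by (intro gen_ideal_least is_ideal_quotient[OF S M g(1)]) (use JS in auto)
  then show "(*) g ` gen_ideal S J \<subseteq> gen_ideal S (ideal_mult R I J)" unfolding M_def by blast
qed

lemma principal_iff:
  assumes "is_subring S"
  shows "principal S I \<longleftrightarrow> (\<exists>g\<in>S. I = (*) g ` S)"
  unfolding principal_def using gen_ideal_singleton[OF assms] by auto

lemma principal_times_cancel:
  assumes S: "is_subring S" and I: "I \<subseteq> S" and b: "b \<noteq> 0"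
    and eq: "(*) b ` I = (*) c ` S"
  shows "principal S I"
proof -
  have "1 \<in> S" using S by (simp add: is_subring_def)
  then have "c \<in> (*) b ` I" unfolding eq by force
  then obtain h where h: "h \<in> I" "c = b * h" by blast
  have "I = (*) h ` S"
    using eq unfolding h(2) image_times_image[symmetric] by (rule image_times_cancel[OF b])
  then show ?thesis unfolding principal_iff[OF S] using h I by blast
qed

text \<open>Proportional ideals have proportional extensions, so capitulation is a property of the
  class.\<close>

lemma principal_extension_cong:
  assumes S: "is_subring S" and RS: "R \<subseteq> S" and I: "is_ideal R I" and J: "is_ideal R J"
    and eq: "ideal_equiv R I J" and pI: "principal S (gen_ideal S I)"
  shows "principal S (gen_ideal S J)"
proof -
  have IS: "I \<subseteq> S" and JS: "J \<subseteq> S" using I J RS by (auto simp: is_ideal_def)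
  from eq obtain a b where ab: "a \<in> S" "b \<in> S" "b \<noteq> 0" "(*) a ` I = (*) b ` J"
    unfolding ideal_equiv_def using RS by blast
  obtain g where g: "g \<in> S" "gen_ideal S I = (*) g ` S" using pI principal_iff[OF S] by blast
  have "(*) b ` gen_ideal S J = (*) a ` gen_ideal S I"
    using gen_ideal_times[OF S IS ab(1)] gen_ideal_times[OF S JS ab(2)] ab(4) by simp
  also have "\<dots> = (*) (a * g) ` S" unfolding g(2) image_times_image ..
  finally show ?thesis
    using principal_times_cancel[OF S _ ab(3)] is_idealD(1)[OF is_ideal_gen_ideal[OF S JS]] by blast
qed

text \<open>Induction over the rules of the subgroup. In the rule \<open>inv\<close>, I extends to g
  S and I J has a principal extension; this extension is g times that of J, and g cancels.\<close>

lemma class_subgroup_capitulates: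
  assumes R: "is_subring R" and S: "is_subring S" and RS: "R \<subseteq> S"
    and G: "\<And>I. I \<in> G \<Longrightarrow> nz_ideal R I \<Longrightarrow> principal S (gen_ideal S I)"
    and C: "C \<in> class_subgroup R G"
  shows "C \<in> classes R \<and> (\<forall>I\<in>C. principal S (gen_ideal S I))"
proof -
  have all: "\<forall>J\<in>cls R I. principal S (gen_ideal S J)"
    if "nz_ideal R I" "principal S (gen_ideal S I)" for I
    using principal_extension_cong[OF S RS _ _ _ that(2)] that(1) by (auto simp: cls_def nz_ideal_def)
  have mem: "I \<in> cls R I" if "nz_ideal R I" for I
    using that ideal_equiv_refl[OF R] by (simp add: cls_def)
  have RR: "nz_ideal R R" using is_ideal_self[OF R] R by (auto simp: nz_ideal_def is_subring_def)
  have "1 \<in> R" "1 \<in> S" using R S by (simp_all add: is_subring_def)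
  have "S \<subseteq> gen_ideal S R"
  proof
    fix x assume "x \<in> S"
    moreover have "1 \<in> gen_ideal S R" using gen_ideal_superset[of R S] \<open>1 \<in> R\<close> by blast
    ultimately show "x \<in> gen_ideal S R" using is_idealD(4)[OF is_ideal_gen_ideal[OF S RS], of x 1] by simp
  qed
  then have "gen_ideal S R = S" using gen_ideal_least[OF is_ideal_self[OF S] RS] by blast
  then have pR: "principal S (gen_ideal S R)"
    unfolding principal_iff[OF S] using \<open>1 \<in> S\<close> by (intro bexI[of _ 1]) auto
  from C have "\<forall>I\<in>C. principal S (gen_ideal S I)"
  proof induction
    case (gen I)
    then show ?case using all G by blast
  next
    case one
    then show ?case using all[OF RR pR] .
  next
    case (mult C D)
    then obtain I J where IJ: "nz_ideal R I" "nz_ideal R J" "C = cls R I" "D = cls R J"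
      using class_subgroup_subset_classes[OF R] unfolding classes_def by blast
    then have "principal S (gen_ideal S I)" "principal S (gen_ideal S J)"
      using mult.IH mem by blast+
    then obtain g h where gh: "g \<in> S" "gen_ideal S I = (*) g ` S"
      "h \<in> S" "gen_ideal S J = (*) h ` S" unfolding principal_iff[OF S] by blast
    have "gen_ideal S (ideal_mult R I J) = (*) (g * h) ` S"
      using gen_ideal_extension_times[OF S RS _ _ R gh(1,2), of J] IJ(1,2)
      unfolding gh(4) image_times_image by (simp add: nz_ideal_def)
    moreover have "g * h \<in> S" using gh S by (simp add: is_subring_def)
    ultimately have "principal S (gen_ideal S (ideal_mult R I J))" unfolding principal_iff[OF S] by blast
    then show ?case
      unfolding IJ(3,4) class_mult_cls[OF R IJ(1,2)] using all nz_ideal_ideal_mult[OF R IJ(1,2)] by blast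
  next
    case (inv C D)
    then obtain I J where IJ: "nz_ideal R I" "nz_ideal R J" "C = cls R I" "D = cls R J"
      using class_subgroup_subset_classes[OF R] unfolding classes_def by blast
    have II: "is_ideal R I" "is_ideal R J" "is_ideal R (ideal_mult R I J)"
      using IJ(1,2) nz_ideal_ideal_mult[OF R IJ(1,2)] by (simp_all add: nz_ideal_def)
    have "principal S (gen_ideal S I)" using inv.IH IJ mem by blast
    then obtain g where g: "g \<in> S" "gen_ideal S I = (*) g ` S" unfolding principal_iff[OF S] by blast
    have "g \<noteq> 0"
    proof
      assume "g = 0"
      then have "gen_ideal S I \<subseteq> {0}" using g(2) by auto
      then show False using IJ(1) gen_ideal_superset[of I S] by (auto simp: nz_ideal_def is_ideal_def)
    qed
    have "cls R (ideal_mult R I J) = cls R R" using inv(3) IJ class_mult_cls[OF R IJ(1,2)] by simp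
    then have "ideal_equiv R R (ideal_mult R I J)"
      using cls_eq_iff[OF R nz_ideal_ideal_mult[OF R IJ(1,2)], of R] by simp
    then have "principal S (gen_ideal S (ideal_mult R I J))"
      using principal_extension_cong[OF S RS is_ideal_self[OF R] II(3) _ pR] by blast
    then obtain c where "gen_ideal S (ideal_mult R I J) = (*) c ` S" unfolding principal_iff[OF S] by blast
    then have "(*) g ` gen_ideal S J = (*) c ` S"
      using gen_ideal_extension_times[OF S RS II(1,2) R g] by simp
    moreover have "gen_ideal S J \<subseteq> S"
      using II(2) RS by (intro gen_ideal_least is_ideal_self S) (auto simp: is_ideal_def)
    ultimately have "principal S (gen_ideal S J)" using principal_times_cancel[OF S _ \<open>g \<noteq> 0\<close>] by blast
    then show ?case unfolding IJ(4) using all IJ(2) by blast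
  qed
  with class_subgroup_subset_classes[OF R C] show ?thesis by blast
qed

section \<open>Quadratic extensions\<close>

lemma is_subfieldD:
  assumes "is_subfield F"
  shows "0 \<in> F" "1 \<in> F" "x \<in> F \<Longrightarrow> y \<in> F \<Longrightarrow> x + y \<in> F" "x \<in> F \<Longrightarrow> y \<in> F \<Longrightarrow> x - y \<in> F"
    "x \<in> F \<Longrightarrow> y \<in> F \<Longrightarrow> x * y \<in> F" "x \<in> F \<Longrightarrow> inverse x \<in> F" "x \<in> F \<Longrightarrow> - x \<in> F"
    "x \<in> F \<Longrightarrow> y \<in> F \<Longrightarrow> x / y \<in> F" "x \<in> F \<Longrightarrow> x ^ n \<in> F"
proof -
  note F = assms[unfolded is_subfield_def]
  show 0: "0 \<in> F" and 1: "1 \<in> F" using F by blast+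
  show "x \<in> F \<Longrightarrow> y \<in> F \<Longrightarrow> x + y \<in> F" for x y using F by blast
  show d: "x \<in> F \<Longrightarrow> y \<in> F \<Longrightarrow> x - y \<in> F" for x y using F by blast
  show m: "x \<in> F \<Longrightarrow> y \<in> F \<Longrightarrow> x * y \<in> F" for x y using F by blast
  show i: "x \<in> F \<Longrightarrow> inverse x \<in> F" for x using F 0 by (cases "x = 0") auto
  show "x \<in> F \<Longrightarrow> - x \<in> F" using d[OF 0] by simp
  show "x \<in> F \<Longrightarrow> y \<in> F \<Longrightarrow> x / y \<in> F" unfolding divide_inverse by (intro m i)
  show "x \<in> F \<Longrightarrow> x ^ n \<in> F" by (induction n) (auto simp: 1 m)
qed

lemma subfield_of_int: assumes "is_subfield F" shows "of_int k \<in> F"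
proof -
  have n: "of_nat n \<in> F" for n by (induction n) (auto simp: is_subfieldD[OF assms])
  show ?thesis
    by (cases k) (use n is_subfieldD[OF assms] in \<open>auto simp del: of_nat_Suc\<close>)
qed

lemma subfield_Rats: "is_subfield F \<Longrightarrow> \<rat> \<subseteq> F"
  by (auto elim!: Rats_cases' intro!: is_subfieldD(8) subfield_of_int)

lemma is_subfield_field_gen: "is_subfield (field_gen S)"
  unfolding field_gen_def is_subfield_def by (intro conjI ballI impI) auto

lemma field_gen_superset: "S \<subseteq> field_gen S"
  unfolding field_gen_def by blast

lemma field_gen_least: "is_subfield L \<Longrightarrow> S \<subseteq> L \<Longrightarrow> field_gen S \<subseteq> L"
  unfolding field_gen_def by blast

lemma is_subfield_Rats: "is_subfield \<rat>"
  unfolding is_subfield_def by auto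

lemma field_gen_empty: "field_gen {} = \<rat>"
  using field_gen_least[OF is_subfield_Rats, of "{}"] subfield_Rats[OF is_subfield_field_gen] by blast

lemma is_subring_OK: assumes K: "is_subfield K" shows "is_subring (OK K)"
  unfolding is_subring_def OK_def
  using is_subfieldD[OF K] by (auto intro: alg_int_add alg_int_diff alg_int_mult)

lemma OK_mono: "K \<subseteq> L \<Longrightarrow> OK K \<subseteq> OK L"
  unfolding OK_def by blast

text \<open>Adjunction of one square root. It is instantiated by k over Q(i), by the three real
  quadratic fields over the rationals, and by Q(sqrt 2, sqrt m) over Q(sqrt(2m)).\<close>

locale quad_ext =
  fixes F :: "complex set" and t :: complex
  assumes F: "is_subfield F" and tt: "t * t \<in> F" and t_notin: "t \<notin> F"
begin

definition E :: "complex set" where "E = {a + b * t | a b. a \<in> F \<and> b \<in> F}"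

definition conj :: "complex \<Rightarrow> complex" where
  "conj z = (THE w. \<exists>a\<in>F. \<exists>b\<in>F. z = a + b * t \<and> w = a - b * t)"

lemmas Fs = is_subfieldD[OF F]

lemma E_I: "a \<in> F \<Longrightarrow> b \<in> F \<Longrightarrow> a + b * t \<in> E" unfolding E_def by blast

lemma E_cases: assumes "z \<in> E" obtains a b where "a \<in> F" "b \<in> F" "z = a + b * t"
  using assms unfolding E_def by blast

lemma repr_unique:
  assumes "a \<in> F" "b \<in> F" "c \<in> F" "d \<in> F" and eq: "a + b * t = c + d * t"
  shows "a = c \<and> b = d"
proof -
  have "b = d"
  proof (rule ccontr)
    assume "b \<noteq> d"
    then have "t = (c - a) / (b - d)" using eq by (simp add: field_simps)
    then have "t \<in> F" using assms by (simp add: Fs)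
    with t_notin show False ..
  qed
  with eq show ?thesis by simp
qed

lemma conj_eq: "a \<in> F \<Longrightarrow> b \<in> F \<Longrightarrow> conj (a + b * t) = a - b * t"
  unfolding conj_def by (rule the_equality) (use repr_unique in blast)+

lemma F_subset_E: "F \<subseteq> E"
proof
  fix a assume "a \<in> F"
  then show "a \<in> E" using E_I[of a 0] Fs by simp
qed

lemma t_in_E: "t \<in> E"
  using E_I[of 0 1] Fs by simp

lemma conj_F: "a \<in> F \<Longrightarrow> conj a = a"
  using conj_eq[of a 0] Fs by simp

lemma conj_t: "conj t = - t"
  using conj_eq[of 0 1] Fs by simp

lemma conj_in_E: "z \<in> E \<Longrightarrow> conj z \<in> E"
proof (elim E_cases)
  fix a b assume "a \<in> F" "b \<in> F" "z = a + b * t"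
  then show "conj z \<in> E" using E_I[of a "- b"] by (simp add: conj_eq Fs)
qed

lemma conj_conj: "z \<in> E \<Longrightarrow> conj (conj z) = z"
proof (elim E_cases)
  fix a b assume "a \<in> F" "b \<in> F" "z = a + b * t"
  then show "conj (conj z) = z" using conj_eq[of a "- b"] by (simp add: conj_eq Fs)
qed

lemma E_add_conj: assumes "z \<in> E" "w \<in> E"
  shows "z + w \<in> E" "conj (z + w) = conj z + conj w"
proof -
  from assms obtain a b c d where *: "a \<in> F" "b \<in> F" "c \<in> F" "d \<in> F" "z = a + b * t" "w = c + d * t"
    by (metis E_cases)
  have eq: "z + w = (a + c) + (b + d) * t" by (simp add: * algebra_simps)
  have F': "a + c \<in> F" "b + d \<in> F" using * by (simp_all add: Fs)
  show "z + w \<in> E" unfolding eq by (rule E_I[OF F'])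
  show "conj (z + w) = conj z + conj w"
    unfolding eq conj_eq[OF F'] unfolding * using * by (simp add: conj_eq algebra_simps)
qed

lemma E_mult_conj: assumes "z \<in> E" "w \<in> E"
  shows "z * w \<in> E" "conj (z * w) = conj z * conj w"
proof -
  from assms obtain a b c d where *: "a \<in> F" "b \<in> F" "c \<in> F" "d \<in> F" "z = a + b * t" "w = c + d * t"
    by (metis E_cases)
  have eq: "z * w = (a * c + b * d * (t * t)) + (a * d + b * c) * t" by (simp add: * algebra_simps)
  have F': "a * c + b * d * (t * t) \<in> F" "a * d + b * c \<in> F" using * tt by (simp_all add: Fs)
  show "z * w \<in> E" unfolding eq by (rule E_I[OF F'])
  show "conj (z * w) = conj z * conj w"
    unfolding eq conj_eq[OF F'] unfolding * using * by (simp add: conj_eq algebra_simps)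
qed

lemma E_times_conj_in_F: assumes "z \<in> E" shows "z * conj z \<in> F" "z + conj z \<in> F"
proof -
  from assms obtain a b where *: "a \<in> F" "b \<in> F" "z = a + b * t" by (rule E_cases)
  have eq: "z * conj z = a * a - b * b * (t * t)" "z + conj z = a + a"
    using * by (simp_all add: conj_eq algebra_simps)
  show "z * conj z \<in> F" "z + conj z \<in> F" unfolding eq using * tt by (simp_all only: Fs)
qed

lemma conj_nonzero: "z \<in> E \<Longrightarrow> z \<noteq> 0 \<Longrightarrow> conj z \<noteq> 0"
  using conj_conj conj_F[of 0] Fs by metis

lemma is_subfield_E: "is_subfield E"
  unfolding is_subfield_def
proof (intro conjI ballI impI)
  show "0 \<in> E" "1 \<in> E" using F_subset_E Fs by auto
  fix x y assume xy: "x \<in> E" "y \<in> E"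
  show "x + y \<in> E" "x * y \<in> E" using xy by (rule E_add_conj E_mult_conj)+
  have "x + (- 1) * y \<in> E" using xy F_subset_E Fs by (intro E_add_conj E_mult_conj) auto
  then show "x - y \<in> E" by simp
next
  fix x assume x: "x \<in> E" "x \<noteq> 0"
  have eq: "inverse x = inverse (x * conj x) * conj x"
    using x conj_nonzero[OF x] by (simp add: field_simps)
  have "inverse (x * conj x) \<in> E"
    by (rule subsetD[OF F_subset_E Fs(6)]) (rule E_times_conj_in_F[OF x(1)])
  from E_mult_conj(1)[OF this conj_in_E[OF x(1)]] show "inverse x \<in> E" unfolding eq .
qed

lemma E_least: "is_subfield L \<Longrightarrow> F \<subseteq> L \<Longrightarrow> t \<in> L \<Longrightarrow> E \<subseteq> L"
  unfolding E_def by (auto intro!: is_subfieldD(3,5)[of L])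

lemma field_aut_conj: "field_aut E conj"
  unfolding field_aut_def
proof (intro conjI ballI)
  show "bij_betw conj E E"
    by (rule bij_betwI[where g = conj]) (auto simp: conj_in_E conj_conj)
qed (simp_all add: conj_F Fs E_add_conj E_mult_conj)

lemma conj_nontrivial: "rel_nontriv_aut E F conj"
proof -
  have "t \<noteq> 0" using t_notin Fs by auto
  then have "conj t \<noteq> t" by (simp add: conj_t)
  then show ?thesis
    unfolding rel_nontriv_aut_def using field_aut_conj conj_F t_in_E by blast
qed

text \<open>The image of t is a square root of t^2, hence t or -t, and t would give the identity.
  This pins down the automorphisms quantified in \<open>Am_s\<close> and
  \<open>qnorm\<close>.\<close>

lemma rel_nontriv_aut_unique:
  assumes "rel_nontriv_aut E F \<tau>" and z: "z \<in> E"
  shows "\<tau> z = conj z"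
proof -
  from assms have hom: "\<And>x y. x \<in> E \<Longrightarrow> y \<in> E \<Longrightarrow> \<tau> (x + y) = \<tau> x + \<tau> y"
    "\<And>x y. x \<in> E \<Longrightarrow> y \<in> E \<Longrightarrow> \<tau> (x * y) = \<tau> x * \<tau> y"
    and fix_F: "\<And>x. x \<in> F \<Longrightarrow> \<tau> x = x" and nt: "\<exists>y\<in>E. \<tau> y \<noteq> y"
    unfolding rel_nontriv_aut_def field_aut_def by blast+
  have rep: "\<tau> (a + b * t) = a + b * \<tau> t" if "a \<in> F" "b \<in> F" for a b
  proof -
    have "a \<in> E" "b \<in> E" "b * t \<in> E" using that F_subset_E t_in_E E_mult_conj(1) by blast+
    then show ?thesis using that t_in_E by (simp add: hom fix_F)
  qed
  have "\<tau> t * \<tau> t = t * t" using hom(2)[OF t_in_E t_in_E] fix_F[OF tt] by simp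
  then have "\<tau> t = t \<or> \<tau> t = - t" by (simp only: square_eq_iff)
  moreover have "\<tau> t \<noteq> t"
  proof
    assume eq: "\<tau> t = t"
    obtain y where y: "y \<in> E" "\<tau> y \<noteq> y" using nt by blast
    from y(1) obtain a b where "a \<in> F" "b \<in> F" "y = a + b * t" by (rule E_cases)
    with rep[of a b] eq y(2) show False by simp
  qed
  ultimately have "\<tau> t = - t" by blast
  then show ?thesis using z rep by (auto elim!: E_cases simp: conj_eq)
qed

text \<open>Conjugation fixes the integers, so it commutes with evaluating integer polynomials and
  preserves a monic equation.\<close>

lemma alg_int_conj:
  assumes z: "z \<in> E" "alg_int z"
  shows "alg_int (conj z)"
proof -
  from z(2) obtain p :: "int poly" where p: "lead_coeff p = 1" "poly (map_poly of_int p) z = 0"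
    unfolding alg_int_def by blast
  have "poly (map_poly of_int q) z \<in> E \<and>
      conj (poly (map_poly of_int q) z) = poly (map_poly of_int q) (conj z)" for q :: "int poly"
  proof (induction q)
    case 0
    then show ?case using F_subset_E Fs by (auto simp: conj_F)
  next
    case (pCons a q)
    have a: "of_int a \<in> F" by (rule subfield_of_int[OF F])
    then have "of_int a \<in> E" using F_subset_E by blast
    then show ?case using pCons a z(1)
      by (simp add: E_add_conj E_mult_conj conj_F)
  qed
  from this[of p] p conj_F[of 0] Fs show ?thesis unfolding alg_int_def by metis
qed

end

section \<open>The ring of integers of k\<close>

lemma complex_of_rat: "(of_rat r :: complex) = of_real (of_rat r)"
  by (cases r) (simp add: of_rat_rat)

definition QI :: "complex set" where
  "QI = {z. Re z \<in> \<rat> \<and> Im z \<in> \<rat>}"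

lemma is_subfield_QI: "is_subfield QI"
  unfolding is_subfield_def QI_def
  by (auto simp: inverse_complex.sel intro!: Rats_divide Rats_add Rats_mult Rats_diff Rats_power Rats_minus_iff[THEN iffD2])

lemma field_gen_ii: "field_gen {\<i>} = QI"
proof
  show "field_gen {\<i>} \<subseteq> QI"
    by (rule field_gen_least[OF is_subfield_QI]) (simp add: QI_def)
  show "QI \<subseteq> field_gen {\<i>}"
  proof
    fix z assume "z \<in> QI"
    then obtain a b where ab: "Re z = of_rat a" "Im z = of_rat b"
      unfolding QI_def by (auto elim!: Rats_cases)
    note D = is_subfieldD[OF is_subfield_field_gen[of "{\<i>}"]]
    have "(of_rat a :: complex) \<in> field_gen {\<i>}" "(of_rat b :: complex) \<in> field_gen {\<i>}"
      by (rule subsetD[OF subfield_Rats[OF is_subfield_field_gen]], simp)+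
    moreover have "\<i> \<in> field_gen {\<i>}" using field_gen_superset[of "{\<i>}"] by simp
    moreover have "z = of_rat a + \<i> * of_rat b"
      using ab by (simp add: complex_eq_iff complex_of_rat)
    ultimately show "z \<in> field_gen {\<i>}" using D by simp
  qed
qed

lemma gc_in_QI: "gc x \<in> QI"
  using gc[of x] Ints_subset_Rats by (auto simp: QI_def)

lemma gcomplex_eq: "gcomplex a b = of_int a + gi * of_int b"
  by (simp add: complex_eq_iff flip: gc_inject_iff)

lemma alg_int_gc: "alg_int (gc x)"
proof -
  obtain a b where "x = gcomplex a b" by (rule gint_exhaust)
  then have "gc x = of_int a + \<i> * of_int b" by (simp add: gcomplex_eq)
  then show ?thesis by (simp add: alg_int_add alg_int_mult)
qed

lemma alg_int_of_real_Rats: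
  assumes "alg_int (of_real r)" "r \<in> \<rat>" obtains k where "r = of_int k"
proof -
  have "complex_of_real r \<in> \<int>"
    using assms by (intro alg_int_Rats_imp_Ints) (auto elim!: Rats_cases simp: Rats_of_rat)
  then obtain k where "complex_of_real r = of_int k" by (auto elim: Ints_cases)
  then have "complex_of_real r = of_real (of_int k)" by simp
  then show ?thesis using that by (simp only: of_real_eq_iff)
qed

text \<open>Traces of z and of -i z make a = 2 Re z and b = 2 Im z integers, and the norm makes a^2
  + b^2 divisible by 4, which forces both to be even.\<close>

lemma alg_int_QI_imp_gint:
  assumes "alg_int z" "z \<in> QI" obtains x where "z = gc x"
proof -
  have c: "alg_int (cnj z)" using assms(1) by (simp add: alg_int_iff_algebraic_int)
  have r: "Re z \<in> \<rat>" "Im z \<in> \<rat>" using assms(2) by (auto simp: QI_def)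
  have "z + cnj z = of_real (2 * Re z)" by (simp add: complex_eq_iff)
  then have "alg_int (of_real (2 * Re z))" using alg_int_add[OF assms(1) c] by simp
  then obtain a where a: "2 * Re z = of_int a" using alg_int_of_real_Rats r by (metis Rats_mult Rats_number_of)
  have "- \<i> * (z - cnj z) = of_real (2 * Im z)" by (simp add: complex_eq_iff)
  moreover have "alg_int (- \<i> * (z - cnj z))"
    by (intro alg_int_mult alg_int_minus alg_int_diff assms c alg_int_ii)
  ultimately have "alg_int (of_real (2 * Im z))" by simp
  then obtain b where b: "2 * Im z = of_int b" using alg_int_of_real_Rats r by (metis Rats_mult Rats_number_of)
  have "z * cnj z = of_real ((Re z)^2 + (Im z)^2)" by (rule complex_mult_cnj)
  then have "alg_int (of_real ((Re z)^2 + (Im z)^2))" using alg_int_mult[OF assms(1) c] by metis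
  then obtain n where n: "(Re z)^2 + (Im z)^2 = of_int n" using alg_int_of_real_Rats r by (metis Rats_add Rats_power)
  have "real_of_int (a^2 + b^2) = (2 * Re z)^2 + (2 * Im z)^2" unfolding a b by simp
  also have "\<dots> = 4 * ((Re z)^2 + (Im z)^2)" by (simp add: power_mult_distrib)
  finally have "real_of_int (a^2 + b^2) = real_of_int (4 * n)" unfolding n by simp
  then have n4: "a^2 + b^2 = 4 * n" by (simp only: of_int_eq_iff)
  have "even a \<and> even b"
  proof (rule ccontr)
    assume "\<not> (even a \<and> even b)"
    moreover have "even (a^2 + b^2)" unfolding n4 by simp
    ultimately have "odd a" "odd b" by auto
    from \<open>odd a\<close> obtain u where u: "a = 2 * u + 1" by (rule oddE)
    from \<open>odd b\<close> obtain v where v: "b = 2 * v + 1" by (rule oddE)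
    from u v have "a^2 + b^2 = 4 * (u * u + u + v * v + v) + 2" by (simp add: power2_eq_square algebra_simps)
    with n4 have "4 * n = 4 * (u * u + u + v * v + v) + 2" by simp
    then show False by presburger
  qed
  then obtain u v where "a = 2 * u" "b = 2 * v" unfolding dvd_def by blast
  then have "z = gc (gcomplex u v)" using a b by (simp add: complex_eq_iff)
  then show ?thesis using that by blast
qed

text \<open>\<open>square_dvd\<close> expresses that m is squarefree in Z[i], in the form in which
  it clears denominators.\<close>

locale zi_quad =
  fixes m :: nat
  assumes odd_m: "odd m" and square_dvd: "\<And>z::gint. of_nat m dvd z * z \<Longrightarrow> of_nat m dvd z"
begin

abbreviation "mg \<equiv> (of_nat m :: gint)"

abbreviation "sm \<equiv> csqrt_nat (2 * m)"

text \<open>Dividing by \<open>1 + \<i>\<close> makes \<open>\<theta>\<close> a generator of the ring of integers over the Gaussian integers.\<close>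
definition theta :: complex where "theta = sm / (1 + \<i>)"

lemma one_plus_ii_nonzero: "1 + \<i> \<noteq> 0" by (simp add: complex_eq_iff)

lemma sqrt_eq: "sm = (1 + \<i>) * theta"
  using one_plus_ii_nonzero by (simp add: theta_def)

lemma two_m_not_square: "(s::nat)^2 \<noteq> 2 * m"
proof
  assume s: "s^2 = 2 * m"
  then have "even (s^2)" by simp
  then obtain k where "s = 2 * k" by (auto elim: evenE)
  then have "m = 2 * k^2" using s by (simp add: power2_eq_square)
  with odd_m show False by simp
qed

lemma theta_squared: "theta * theta = - \<i> * of_nat m"
proof -
  have "sm * sm = of_real (sqrt (real (2 * m)) * sqrt (real (2 * m)))"
    unfolding csqrt_nat_def by (simp only: of_real_mult)
  also have "\<dots> = 2 * of_nat m" by simp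
  finally have "((1 + \<i>) * (1 + \<i>)) * (theta * theta) = 2 * of_nat m"
    unfolding sqrt_eq by (simp only: mult_ac)
  then have "(2 * \<i>) * (theta * theta) = 2 * of_nat m" by (simp add: algebra_simps)
  then have "- \<i> * (\<i> * (theta * theta)) = - \<i> * of_nat m" by simp
  then show ?thesis by (simp flip: mult.assoc)
qed

lemma theta_notin_QI: "theta \<notin> QI"
proof
  assume "theta \<in> QI"
  moreover have "1 + \<i> \<in> QI" by (simp add: QI_def)
  ultimately have "sm \<in> QI" unfolding sqrt_eq by (intro is_subfieldD(5)[OF is_subfield_QI])
  then have "sqrt (real (2 * m)) \<in> \<rat>" by (simp add: QI_def csqrt_nat_def)
  then show False using sqrt_nat_irrational[of "2 * m"] two_m_not_square by blast
qed

sublocale quad_ext QI theta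
proof
  show "theta * theta \<in> QI" unfolding theta_squared by (simp add: QI_def)
qed (rule is_subfield_QI theta_notin_QI)+

lemma field_gen_sqrt_ii: "field_gen {sm, \<i>} = E"
proof
  have "(1 + \<i>) \<in> E" "\<i> \<in> E" using F_subset_E by (auto simp: QI_def)
  then show "field_gen {sm, \<i>} \<subseteq> E"
    by (intro field_gen_least is_subfield_E) (auto simp: sqrt_eq intro!: E_mult_conj t_in_E)
  let ?L = "field_gen {sm, \<i>}"
  note D = is_subfieldD[OF is_subfield_field_gen[of "{sm, \<i>}"]]
  have g: "sm \<in> ?L" "\<i> \<in> ?L" using field_gen_superset by blast+
  show "E \<subseteq> ?L"
  proof (rule E_least)
    show "QI \<subseteq> ?L" unfolding field_gen_ii[symmetric]
      using g by (intro field_gen_least is_subfield_field_gen) auto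
    show "theta \<in> ?L" unfolding theta_def using g D by simp
  qed (rule is_subfield_field_gen)
qed

definition el :: "gint \<Rightarrow> gint \<Rightarrow> complex" where "el x y = gc x + gc y * theta"

lemma el_eq_iff [simp]: "el x y = el x' y' \<longleftrightarrow> x = x' \<and> y = y'"
  unfolding el_def using repr_unique[OF gc_in_QI gc_in_QI gc_in_QI gc_in_QI] gc_inject_iff by metis

lemma el_add: "el x y + el x' y' = el (x + x') (y + y')"
  by (simp add: el_def algebra_simps)

lemma el_mult: "el x y * el x' y' = el (x * x' - gi * mg * y * y') (x * y' + x' * y)"
proof -
  have "el x y * el x' y' = gc x * gc x' + (gc y * gc y') * (theta * theta) + (gc x * gc y' + gc x' * gc y) * theta"
    by (simp add: el_def algebra_simps)
  then show ?thesis unfolding theta_squared by (simp add: el_def algebra_simps)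
qed

lemma el_0: "el 0 0 = 0" and el_1: "el 1 0 = 1" and el_gc: "el x 0 = gc x" by (simp_all add: el_def)

lemma el_eq_0_iff [simp]: "el x y = 0 \<longleftrightarrow> x = 0 \<and> y = 0"
  using el_eq_iff[of x y 0 0] by (simp only: el_0)

lemma gc_mult_el: "gc t * el x y = el (t * x) (t * y)" by (simp add: el_def algebra_simps)

lemma conj_el: "conj (el x y) = el x (- y)"
  unfolding el_def using conj_eq[OF gc_in_QI gc_in_QI] by simp

lemma alg_int_theta: "alg_int theta"
proof (rule alg_int_if_power2)
  show "alg_int (theta^2)"
    unfolding power2_eq_square theta_squared by (intro alg_int_mult alg_int_minus alg_int_ii alg_int_of_nat)
qed

text \<open>Let z = a + b theta. The trace puts A = 2 a into Z[i]; the norm then makes (2 m b)^2 a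
  multiple of m in Z[i], so squarefreeness puts B = 2 b into Z[i]. Finally 4 divides A^2 + i m B^2,
  which forces 2 to divide A and B.\<close>

lemma OK_E: "OK E = {el x y | x y. True}"
proof (intro equalityI subsetI)
  fix z assume "z \<in> {el x y | x y. True}"
  then show "z \<in> OK E"
    unfolding OK_def el_def
    by (auto intro!: E_I gc_in_QI alg_int_add alg_int_mult alg_int_gc alg_int_theta)
next
  fix z assume "z \<in> OK E"
  then have z: "z \<in> E" "alg_int z" by (simp_all add: OK_def)
  obtain a b where ab: "a \<in> QI" "b \<in> QI" "z = a + b * theta" using z(1) by (rule E_cases)
  have c: "alg_int (conj z)" using alg_int_conj[OF z] .
  note N = E_times_conj_in_F[OF z(1)]
  have 2: "z + conj z = 2 * a" using ab by (simp add: conj_eq)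
  obtain A where A: "2 * a = gc A"
    using alg_int_QI_imp_gint[OF alg_int_add[OF z(2) c] N(2)] unfolding 2 by metis
  obtain n where n: "z * conj z = gc n" using alg_int_QI_imp_gint[OF alg_int_mult[OF z(2) c] N(1)] by metis
  have "z * conj z = a * a - b * b * (theta * theta)" using ab by (simp add: conj_eq algebra_simps)
  then have n': "gc n = a * a + \<i> * of_nat m * (b * b)" unfolding n theta_squared by simp
  have "of_nat m * ((2 * b) * (2 * b)) = - \<i> * (4 * gc n - (2 * a) * (2 * a))"
    unfolding n' by (simp add: algebra_simps)
  also have "\<dots> = gc (- gi * (4 * n - A * A))" unfolding A by simp
  finally have mb: "of_nat m * ((2 * b) * (2 * b)) = gc (- gi * (4 * n - A * A))" .
  have "(of_nat m * (2 * b))^2 = of_nat m * (of_nat m * ((2 * b) * (2 * b)))"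
    by (simp add: power2_eq_square algebra_simps)
  also have "\<dots> = gc (mg * (- gi * (4 * n - A * A)))" unfolding mb by simp
  finally have sq: "(of_nat m * (2 * b))^2 = gc (mg * (- gi * (4 * n - A * A)))" .
  then have "alg_int (of_nat m * (2 * b))" using alg_int_if_power2 alg_int_gc by metis
  moreover have "of_nat m * (2 * b) \<in> QI"
    using is_subfieldD(5)[OF is_subfield_QI subfield_of_int[OF is_subfield_QI] ab(2), of "int m * 2"]
    by (simp add: mult.assoc)
  ultimately obtain C where C: "of_nat m * (2 * b) = gc C" using alg_int_QI_imp_gint by metis
  have "gc (C * C) = (of_nat m * (2 * b))^2" unfolding C by (simp add: power2_eq_square)
  also note sq
  finally have "gc (C * C) = gc (mg * (- gi * (4 * n - A * A)))" .
  then have "C * C = mg * (- gi * (4 * n - A * A))" by (simp only: gc_inject_iff)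
  then have "mg dvd C * C" by (rule dvdI)
  then have "mg dvd C" by (rule square_dvd)
  then obtain B where B: "C = mg * B" by (rule dvdE)
  have "of_nat m * (2 * b) = of_nat m * gc B" unfolding C B by simp
  moreover have "(of_nat m :: complex) \<noteq> 0" using odd_m by (auto elim: oddE)
  ultimately have B: "2 * b = gc B" by (simp only: mult_cancel_left) blast
  have "gc (A^2 + gi * of_int (int m) * B^2) = gc (4 * n)"
    using n' by (simp add: A[symmetric] B[symmetric] power2_eq_square algebra_simps)
  then have "A^2 + gi * of_int (int m) * B^2 = 4 * n" by (simp only: gc_inject_iff)
  then have "4 dvd A^2 + gi * of_int (int m) * B^2" by (rule dvdI)
  then have "2 dvd A" "2 dvd B" using four_dvd_square_plus_i_square[of "int m"] odd_m by auto
  then obtain x y where "A = 2 * x" "B = 2 * y" by (auto elim!: dvdE)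
  then have "a = gc x" "b = gc y" using A B by simp_all
  then show "z \<in> {el x y | x y. True}" using ab(3) by (auto simp: el_def)
qed

abbreviation "R \<equiv> OK E"

lemma R_subring: "is_subring R" by (rule is_subring_OK[OF is_subfield_E])

lemma el_in_R [simp]: "el x y \<in> R" unfolding OK_E by blast

lemma R_cases: assumes "z \<in> R" obtains x y where "z = el x y"
  using assms unfolding OK_E by blast

lemma gc_in_R [simp]: "gc x \<in> R" using el_in_R[of x 0] unfolding el_gc .

end

section \<open>Ambiguous ideals\<close>

lemma dvd_diff_iff_gint: "c dvd b \<Longrightarrow> c dvd a - b \<longleftrightarrow> c dvd (a::gint)"
  using dvd_diff[of c a b] dvd_add[of c "a - b" b] by auto

lemma dvd_add_iff_gint: "c dvd b \<Longrightarrow> c dvd a + b \<longleftrightarrow> c dvd (a::gint)"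
  using dvd_add[of c a b] dvd_diff[of c "a + b" b] by auto

text \<open>This takes the place of unique factorisation: applied along a list of primes it
  determines the divisors of their product up to units.\<close>

lemma prime_gnorm_strip:
  assumes p: "prime (gnorm p)" and c: "c dvd p * b"
  obtains c' where "c = p * c'" "c' dvd b" | "c dvd b" "bezout p c"
proof (cases "p dvd c")
  case True
  then obtain c' where c': "c = p * c'" by (rule dvdE)
  have "p \<noteq> 0" using p gnorm_eq_0_iff not_prime_0 by metis
  then have "c' dvd b" using c unfolding c' by (simp add: dvd_mult_cancel_left)
  with c' show ?thesis by (rule that(1))
next
  case False
  with p have b: "bezout p c" by (rule bezout_if_prime_gnorm)
  then have "bezout c p" by (simp add: bezout_commute)
  from bezout_dvd_mult[OF this c] b show ?thesis by (rule that(2))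
qed

context zi_quad
begin

lemma mg_nonzero [simp]: "mg \<noteq> 0"
  using odd_m by (simp flip: gc_inject_iff) (auto elim: oddE)

lemma one_plus_gi_nonzero [simp]: "1 + gi \<noteq> 0"
  using gnorm_one_plus_gi gnorm_eq_0_iff[of "1 + gi"] by (metis zero_neq_numeral)

lemma mg_eq: "mg = gcomplex (int m) 0"
  by (simp add: gcomplex_eq)

lemma mg_plus_gi: "mg + gi = gcomplex (int m) 1"
  by (simp add: gcomplex_eq)

lemma one_plus_gi_dvd_mg: "1 + gi dvd mg + gi" "1 + gi dvd mg - gi" "\<not> 1 + gi dvd mg"
proof -
  have e: "mg - gi = gcomplex (int m) (-1)" "mg = gcomplex (int m) 0"
    by (simp_all add: gcomplex_eq)
  show "1 + gi dvd mg + gi" unfolding mg_plus_gi one_plus_gi_dvd_iff using odd_m by simp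
  show "1 + gi dvd mg - gi" unfolding e(1) one_plus_gi_dvd_iff using odd_m by simp
  show "\<not> 1 + gi dvd mg" unfolding e(2) one_plus_gi_dvd_iff using odd_m by simp
qed

text \<open>(1 + i) m contains each Gaussian prime ramified in k exactly once, so its divisors index
  the squarefree products of ramified primes.\<close>

definition ramdiv :: "gint \<Rightarrow> bool" where "ramdiv c \<longleftrightarrow> c dvd (1 + gi) * mg"

text \<open>The first divisibility makes \<open>Ic c\<close> an ideal, the second and third make
  products of its elements divisible by c, and the third also makes it invariant under
  conjugation.\<close>

lemma ramdiv_dvd:
  assumes "ramdiv c"
  shows "c dvd mg * (mg + gi)" "c dvd mg * (mg - gi)" "c dvd 2 * mg"
proof -
  have "(1 + gi) * mg dvd mg * (mg + gi)" "(1 + gi) * mg dvd mg * (mg - gi)"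
    using one_plus_gi_dvd_mg by (simp_all only: mult.commute[of mg] mult_dvd_mono dvd_refl)
  moreover have "2 * mg = ((1 + gi) * mg) * (1 - gi)"
    by (simp add: algebra_simps)
  then have "(1 + gi) * mg dvd 2 * mg" by (rule dvdI)
  ultimately show "c dvd mg * (mg + gi)" "c dvd mg * (mg - gi)" "c dvd 2 * mg"
    using assms unfolding ramdiv_def by (blast intro: dvd_trans)+
qed

lemma ramdiv_dvd_trans: "ramdiv d \<Longrightarrow> c dvd d \<Longrightarrow> ramdiv c"
  unfolding ramdiv_def by (rule dvd_trans)

text \<open>As x + y theta = (x - m y) + y (m + theta), this is the lattice over Z[i] with basis c,
  m + theta.\<close>

definition Ic :: "gint \<Rightarrow> complex set" where "Ic c = {el x y | x y. c dvd x - mg * y}"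

abbreviation "cl c \<equiv> cls R (Ic c)"

abbreviation "gens \<equiv> class_subgroup R"

lemma el_in_Ic [simp]: "el x y \<in> Ic c \<longleftrightarrow> c dvd x - mg * y"
  unfolding Ic_def by auto

lemma Ic_cases: assumes "z \<in> Ic c" obtains x y where "z = el x y" "c dvd x - mg * y"
  using assms unfolding Ic_def by blast

lemma Ic_subset: "Ic c \<subseteq> R"
  unfolding Ic_def by auto

lemma Ic_of_unit: "u dvd 1 \<Longrightarrow> Ic u = R"
  unfolding Ic_def OK_E using dvd_trans[of u 1] by auto

lemma phi_mult:
  fixes g m' :: gint
  shows "(x * x' - g * m' * y * y') - m' * (x * y' + x' * y)
    = (x - m' * y) * (x' - m' * y') - m' * (m' + g) * (y * y')"
  by (simp add: algebra_simps)

text \<open>The map sending \<open>x + y\<theta>\<close> to \<open>x - m y\<close> is a ring homomorphism onto the Gaussian integers modulo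
  \<open>m (m + \<i>)\<close>, and \<open>Ic c\<close> is the preimage of the multiples of \<open>c\<close>.\<close>
lemma el_mult_in_Ic_iff:
  assumes "c dvd mg * (mg + gi)"
  shows "el x y * el x' y' \<in> Ic c \<longleftrightarrow> c dvd (x - mg * y) * (x' - mg * y')"
  unfolding el_mult el_in_Ic phi_mult by (rule dvd_diff_iff_gint[OF dvd_mult2[OF assms]])

lemma is_ideal_Ic:
  assumes c: "c dvd mg * (mg + gi)"
  shows "is_ideal R (Ic c)"
proof (rule is_idealI)
  show "0 \<in> Ic c" using el_in_Ic[of 0 0 c] unfolding el_0 by simp
  show "z + w \<in> Ic c" if zw: "z \<in> Ic c" "w \<in> Ic c" for z w
  proof -
    obtain x y where 1: "z = el x y" "c dvd x - mg * y" using zw(1) by (rule Ic_cases)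
    obtain x' y' where 2: "w = el x' y'" "c dvd x' - mg * y'" using zw(2) by (rule Ic_cases)
    have eq: "x + x' - mg * (y + y') = (x - mg * y) + (x' - mg * y')" by (simp add: algebra_simps)
    show ?thesis unfolding 1(1) 2(1) el_add el_in_Ic eq using 1(2) 2(2) by (rule dvd_add)
  qed
  show "r * z \<in> Ic c" if rz: "r \<in> R" "z \<in> Ic c" for r z
  proof -
    obtain x y where 1: "z = el x y" "c dvd x - mg * y" using rz(2) by (rule Ic_cases)
    obtain x' y' where 2: "r = el x' y'" using rz(1) by (rule R_cases)
    show ?thesis unfolding 1 2 el_mult_in_Ic_iff[OF c] using 1(2) by (rule dvd_mult)
  qed
qed (rule Ic_subset)

lemma nz_ideal_Ic:
  assumes c: "ramdiv c"
  shows "nz_ideal R (Ic c)"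
proof -
  have "el ((1 + gi) * mg) 0 \<in> Ic c" using c by (simp add: ramdiv_def)
  moreover have "el ((1 + gi) * mg) 0 \<noteq> 0" by simp
  ultimately show ?thesis using is_ideal_Ic[OF ramdiv_dvd(1)[OF c]] unfolding nz_ideal_def by blast
qed

lemma el_m_1_in_Ic [simp]: "el mg 1 \<in> Ic c" by simp

text \<open>The coordinates of z w are combinations of x - m y, x' - m y', m (m - i) and 2 m, all
  divisible by c. On ideals this says that the square of \<open>Ic c\<close> lies in c R.\<close>

lemma Ic_mult_Ic_dvd:
  assumes c: "ramdiv c" and zw: "z \<in> Ic c" "w \<in> Ic c"
  obtains v where "v \<in> R" "z * w = gc c * v"
proof -
  obtain x y where 1: "z = el x y" "c dvd x - mg * y" using zw(1) by (rule Ic_cases)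
  obtain x' y' where 2: "w = el x' y'" "c dvd x' - mg * y'" using zw(2) by (rule Ic_cases)
  have X: "x * x' - gi * mg * y * y'
      = (x - mg * y) * x' + (x' - mg * y') * (mg * y) + mg * (mg - gi) * (y * y')"
    by (simp add: algebra_simps)
  have Y: "x * y' + x' * y = (x - mg * y) * y' + (x' - mg * y') * y + 2 * mg * (y * y')"
    by (simp add: algebra_simps)
  have "c dvd x * x' - gi * mg * y * y'"
    unfolding X by (intro dvd_add dvd_mult2[OF 1(2)] dvd_mult2[OF 2(2)] dvd_mult2[OF ramdiv_dvd(2)[OF c]])
  moreover have "c dvd x * y' + x' * y"
    unfolding Y by (intro dvd_add dvd_mult2[OF 1(2)] dvd_mult2[OF 2(2)] dvd_mult2[OF ramdiv_dvd(3)[OF c]])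
  ultimately obtain X' Y' where "x * x' - gi * mg * y * y' = c * X'" "x * y' + x' * y = c * Y'"
    unfolding dvd_def by blast
  then have "z * w = gc c * el X' Y'" unfolding 1 2 el_mult gc_mult_el by simp
  then show ?thesis by (intro that[of "el X' Y'"]) simp_all
qed

text \<open>A prime dividing m is coprime to m + i, and its square does not divide the squarefree m.
  The remaining prime 1 + i divides m + i only once, because the norm m^2 + 1 is 2 modulo 4.\<close>

lemma prime_square_not_dvd:
  assumes q: "prime (gnorm q)" and r: "ramdiv q"
  shows "\<not> q * q dvd mg * (mg + gi)"
proof
  assume d: "q * q dvd mg * (mg + gi)"
  have q0: "q \<noteq> 0" using q gnorm_eq_0_iff not_prime_0 by metis
  show False
  proof (cases "q dvd mg")
    case True
    have "\<not> q dvd mg + gi"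
    proof
      assume "q dvd mg + gi"
      then have "q dvd gi" using True by (simp add: dvd_add_right_iff)
      then have "q dvd 1" using gi_unit by (rule dvd_trans)
      then show False using prime_gnorm_not_unit[OF q] by blast
    qed
    then have b: "bezout q (mg + gi)" by (rule bezout_if_prime_gnorm[OF q])
    then have "bezout (mg + gi) (q * q)" by (auto simp: bezout_commute[of q] intro: bezout_mult)
    then have "bezout (q * q) (mg + gi)" by (simp add: bezout_commute)
    from bezout_dvd_mult[OF this, of mg] d have "q * q dvd mg" by (simp add: mult.commute)
    then obtain w where w: "mg = q * q * w" by (rule dvdE)
    have "(q * w) * (q * w) = mg * w" unfolding w by (simp only: mult_ac)
    then have "mg dvd (q * w) * (q * w)" by (rule dvdI)
    then have "mg dvd q * w" by (rule square_dvd)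
    then have "(q * w) * q dvd (q * w) * 1" unfolding w by (simp only: mult_ac mult_1_left mult_1_right)
    moreover have "q * w \<noteq> 0" using mg_nonzero w by auto
    ultimately have "q dvd 1" by (simp only: dvd_mult_cancel_left) simp
    then show False using prime_gnorm_not_unit[OF q] by blast
  next
    case False
    then have b: "bezout q mg" by (rule bezout_if_prime_gnorm[OF q])
    have "q dvd 1 + gi" using bezout_dvd_mult[OF b, of "1 + gi"] r by (simp add: ramdiv_def mult.commute)
    then have "gnorm q dvd 2" using gnorm_dvd by fastforce
    then have n2: "gnorm q = 2" using q by (simp add: primes_dvd_imp_eq)
    have "bezout mg (q * q)" using b by (auto simp: bezout_commute[of q] intro: bezout_mult)
    then have "bezout (q * q) mg" by (simp add: bezout_commute)
    from bezout_dvd_mult[OF this d] have "gnorm (q * q) dvd gnorm (mg + gi)" by (rule gnorm_dvd)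
    then have "4 dvd (int m)^2 + 1" by (simp add: gnorm_mult n2 mg_plus_gi)
    moreover obtain k where "m = 2 * k + 1" using odd_m by (rule oddE)
    then have "(int m)^2 + 1 = 4 * (int k * int k + int k) + 2" by (simp add: power2_eq_square algebra_simps)
    ultimately show False by presburger
  qed
qed

lemma prime_ramdiv_bezout:
  assumes q: "prime (gnorm q)" and r: "ramdiv (q * b)"
  shows "bezout q b"
proof (rule bezout_if_prime_gnorm[OF q])
  have rq: "ramdiv q" by (rule ramdiv_dvd_trans[OF r]) simp
  show "\<not> q dvd b"
  proof
    assume "q dvd b"
    then have "q * q dvd q * b" by (rule mult_dvd_mono[OF dvd_refl])
    then have "q * q dvd mg * (mg + gi)" using ramdiv_dvd(1)[OF r] by (rule dvd_trans)
    then show False using prime_square_not_dvd[OF q rq] by blast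
  qed
qed

text \<open>Both q^2 and (m + theta) (m - theta) = m (m + i) lie in the square of
  \<open>Ic q\<close>, and their gcd is q. Coprimality of q to its cofactor is a hypothesis so that
  prime and composite q are covered alike.\<close>

lemma gc_in_Ic_square:
  assumes r: "ramdiv q" and b: "\<And>w. mg * (mg + gi) = q * w \<Longrightarrow> bezout q w"
  obtains u v where "gc q = gc u * (gc q * gc q) + gc v * (el mg 1 * el mg (-1))" "el mg (-1) \<in> Ic q"
proof -
  obtain w where w: "mg * (mg + gi) = q * w" using ramdiv_dvd(1)[OF r] by (rule dvdE)
  obtain u v where uv: "u * q + v * w = 1" using b[OF w] unfolding bezout_def by blast
  have "el mg 1 * el mg (-1) = gc (mg * (mg + gi))"
    unfolding el_mult by (simp add: el_def algebra_simps)
  moreover have "gc u * (gc q * gc q) + gc v * gc (q * w) = gc ((u * q + v * w) * q)"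
    by (simp add: algebra_simps)
  ultimately have "gc q = gc u * (gc q * gc q) + gc v * (el mg 1 * el mg (-1))"
    unfolding w uv by simp
  moreover have "el mg (-1) \<in> Ic q"
    using ramdiv_dvd(3)[OF r]
    by (simp only: el_in_Ic mult_minus_right mult_1_right diff_minus_eq_add mult_2)
  ultimately show ?thesis by (rule that)
qed

lemma prime_ramdiv_cofactor:
  assumes q: "prime (gnorm q)" and r: "ramdiv q" and w: "mg * (mg + gi) = q * w"
  shows "bezout q w"
proof (rule bezout_if_prime_gnorm[OF q])
  show "\<not> q dvd w"
  proof
    assume "q dvd w"
    then have "q * q dvd mg * (mg + gi)" unfolding w by (rule mult_dvd_mono[OF dvd_refl])
    then show False using prime_square_not_dvd[OF q r] by blast
  qed
qed

lemma gc_in_Ic [simp]: "gc c \<in> Ic c"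
  using el_in_Ic[of c 0 c] unfolding el_gc by simp

lemma Ic_square:
  assumes q: "prime (gnorm q)" and r: "ramdiv q"
  shows "ideal_mult R (Ic q) (Ic q) = gen_ideal R {gc q}"
proof
  have I: "is_ideal R (Ic q)" by (rule is_ideal_Ic[OF ramdiv_dvd(1)[OF r]])
  show "ideal_mult R (Ic q) (Ic q) \<subseteq> gen_ideal R {gc q}"
  proof (rule ideal_mult_least)
    show "is_ideal R (gen_ideal R {gc q})" by (rule is_ideal_gen_ideal[OF R_subring]) simp
    fix z w assume "z \<in> Ic q" "w \<in> Ic q"
    then obtain v where "v \<in> R" "z * w = gc q * v" by (rule Ic_mult_Ic_dvd[OF r])
    then show "z * w \<in> gen_ideal R {gc q}" unfolding gen_ideal_singleton[OF R_subring gc_in_R] by blast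
  qed
  have M: "is_ideal R (ideal_mult R (Ic q) (Ic q))" by (rule is_ideal_ideal_mult[OF R_subring I I])
  obtain u v where uv: "gc q = gc u * (gc q * gc q) + gc v * (el mg 1 * el mg (-1))" "el mg (-1) \<in> Ic q"
    by (rule gc_in_Ic_square[OF r prime_ramdiv_cofactor[OF q r]])
  have "gc u * (gc q * gc q) + gc v * (el mg 1 * el mg (-1)) \<in> ideal_mult R (Ic q) (Ic q)"
    by (intro is_idealD(3,4)[OF M] ideal_multI gc_in_R gc_in_Ic el_m_1_in_Ic uv(2))
  then show "gen_ideal R {gc q} \<subseteq> ideal_mult R (Ic q) (Ic q)"
    unfolding uv(1)[symmetric] by (intro gen_ideal_least M) simp
qed

lemma Ic_prime:
  assumes q: "prime (gnorm q)" and r: "ramdiv q"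
  shows "Ic q \<noteq> R" "a \<in> R \<Longrightarrow> b \<in> R \<Longrightarrow> a * b \<in> Ic q \<Longrightarrow> a \<in> Ic q \<or> b \<in> Ic q"
proof -
  have "el 1 0 \<notin> Ic q" using prime_gnorm_not_unit[OF q] by simp
  then show "Ic q \<noteq> R" using el_in_R by metis
next
  assume a: "a \<in> R" and b: "b \<in> R" and ab: "a * b \<in> Ic q"
  obtain x y where 1: "a = el x y" using a by (rule R_cases)
  obtain x' y' where 2: "b = el x' y'" using b by (rule R_cases)
  have "q dvd (x - mg * y) * (x' - mg * y')"
    using ab unfolding 1 2 el_mult_in_Ic_iff[OF ramdiv_dvd(1)[OF r]] .
  then show "a \<in> Ic q \<or> b \<in> Ic q"
    unfolding 1 2 el_in_Ic by (rule prime_gnorm_dvd_mult[OF q])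
qed

text \<open>A prime ideal that contains the square of an ideal contains the ideal. Two primes with
  the same square therefore contain each other, which gives the uniqueness in
  \<open>ram_prime\<close>.\<close>

lemma ram_prime_Ic:
  assumes q: "prime (gnorm q)" and r: "ramdiv q"
  shows "ram_prime R (gc q) = Ic q"
  unfolding ram_prime_def
proof (rule the_equality)
  show P: "nz_ideal R (Ic q) \<and> Ic q \<noteq> R \<and> (\<forall>a\<in>R. \<forall>b\<in>R. a * b \<in> Ic q \<longrightarrow> a \<in> Ic q \<or> b \<in> Ic q) \<and>
      ideal_mult R (Ic q) (Ic q) = gen_ideal R {gc q}"
    using nz_ideal_Ic[OF r] Ic_prime[OF q r] Ic_square[OF q r] by blast
  have sub: "A \<subseteq> B"
    if A: "nz_ideal R A" and B: "nz_ideal R B" "\<forall>a\<in>R. \<forall>b\<in>R. a * b \<in> B \<longrightarrow> a \<in> B \<or> b \<in> B"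
      and eq: "ideal_mult R A A = ideal_mult R B B" for A B
  proof
    fix a assume a: "a \<in> A"
    have "ideal_mult R B B \<subseteq> B"
      using B(1) unfolding nz_ideal_def by (intro ideal_mult_least) (auto simp: is_ideal_def)
    moreover have "a * a \<in> ideal_mult R B B" unfolding eq[symmetric] using a a by (rule ideal_multI)
    moreover have "a \<in> R" using a A by (auto simp: nz_ideal_def is_ideal_def)
    ultimately show "a \<in> B" using B(2) by blast
  qed
  fix P assume P': "nz_ideal R P \<and> P \<noteq> R \<and> (\<forall>a\<in>R. \<forall>b\<in>R. a * b \<in> P \<longrightarrow> a \<in> P \<or> b \<in> P) \<and>
      ideal_mult R P P = gen_ideal R {gc q}"
  note p = P[THEN conjunct1] P[THEN conjunct2, THEN conjunct2, THEN conjunct1]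
    P'[THEN conjunct1] P'[THEN conjunct2, THEN conjunct2, THEN conjunct1]
  have eq: "ideal_mult R P P = ideal_mult R (Ic q) (Ic q)"
    unfolding Ic_square[OF q r] using P' by blast
  show "P = Ic q" by (rule equalityI[OF sub[OF p(3,1,2) eq] sub[OF p(1,3,4) eq[symmetric]]])
qed

text \<open>The lattice on the right has the basis c d, m + theta. The first is visibly a product,
  and m + theta = u c (m + theta) + v d (m + theta) by the Bezout identity.\<close>

lemma Ic_mult:
  assumes b: "bezout c d" and r: "ramdiv (c * d)"
  shows "ideal_mult R (Ic c) (Ic d) = Ic (c * d)"
proof
  have rc: "c dvd mg * (mg + gi)" "d dvd mg * (mg + gi)"
    using ramdiv_dvd(1)[OF r] by (blast intro: dvd_mult_left dvd_mult_right)+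
  have I: "is_ideal R (Ic c)" "is_ideal R (Ic d)" "is_ideal R (Ic (c * d))"
    by (rule is_ideal_Ic, rule rc ramdiv_dvd(1)[OF r])+
  show "ideal_mult R (Ic c) (Ic d) \<subseteq> Ic (c * d)"
  proof (rule ideal_mult_least[OF I(3)])
    fix z w assume zw: "z \<in> Ic c" "w \<in> Ic d"
    obtain x y where 1: "z = el x y" "c dvd x - mg * y" using zw(1) by (rule Ic_cases)
    obtain x' y' where 2: "w = el x' y'" "d dvd x' - mg * y'" using zw(2) by (rule Ic_cases)
    show "z * w \<in> Ic (c * d)"
      unfolding 1 2 el_mult_in_Ic_iff[OF ramdiv_dvd(1)[OF r]] using 1(2) 2(2) by (rule mult_dvd_mono)
  qed
  have M: "is_ideal R (ideal_mult R (Ic c) (Ic d))" by (rule is_ideal_ideal_mult[OF R_subring I(1,2)])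
  obtain u v where uv: "u * c + v * d = 1" using b by (auto simp: bezout_def)
  show "Ic (c * d) \<subseteq> ideal_mult R (Ic c) (Ic d)"
  proof
    fix z assume "z \<in> Ic (c * d)"
    then obtain x y where z: "z = el x y" "c * d dvd x - mg * y" by (rule Ic_cases)
    from z(2) obtain k where k: "x - mg * y = c * d * k" by (rule dvdE)
    have "gc u * (gc c * el mg 1) + gc v * (el mg 1 * gc d) = gc (u * c + v * d) * el mg 1"
      by (simp add: algebra_simps)
    also have "\<dots> = el mg 1" by (simp add: uv)
    finally have e: "gc u * (gc c * el mg 1) + gc v * (el mg 1 * gc d) = el mg 1" .
    have "z = gc (x - mg * y) + gc y * el mg 1" unfolding z by (simp add: el_def algebra_simps)
    then have "z = gc k * (gc c * gc d) + gc y * (gc u * (gc c * el mg 1) + gc v * (el mg 1 * gc d))"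
      unfolding e k by (simp add: mult_ac)
    also have "\<dots> \<in> ideal_mult R (Ic c) (Ic d)"
      by (intro is_idealD(3,4)[OF M] ideal_multI gc_in_R gc_in_Ic el_m_1_in_Ic)
    finally show "z \<in> ideal_mult R (Ic c) (Ic d)" .
  qed
qed

lemma cls_Ic_in_subgroup:
  assumes "\<forall>q\<in>set ps. prime (gnorm q) \<and> cl q \<in> gens G"
    and "ramdiv (prod_list ps)" and "c dvd prod_list ps"
  shows "cl c \<in> gens G"
  using assms
proof (induction ps arbitrary: c)
  case Nil
  then show ?case using Ic_of_unit[of c] class_subgroup.one[of R G] by simp
next
  case (Cons q ps)
  have q: "prime (gnorm q)" "cl q \<in> gens G" using Cons.prems(1) by simp_all
  have ps: "ramdiv (prod_list ps)" by (rule ramdiv_dvd_trans[OF Cons.prems(2)]) simp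
  have "c dvd q * prod_list ps" using Cons.prems(3) by simp
  then consider c' where "c = q * c'" "c' dvd prod_list ps" | "c dvd prod_list ps" "bezout q c"
    by (rule prime_gnorm_strip[OF q(1)])
  then show ?case
  proof cases
    case (1 c')
    have r: "ramdiv (q * c')" by (rule ramdiv_dvd_trans[OF Cons.prems(2)]) (use Cons.prems(3) 1(1) in simp)
    have r': "ramdiv q" "ramdiv c'" by (rule ramdiv_dvd_trans[OF r], simp)+
    have "cl c' \<in> gens G" using Cons.IH[OF _ ps 1(2)] Cons.prems(1) by simp
    then show ?thesis
      using class_subgroup_mult[OF R_subring nz_ideal_Ic[OF r'(1)] nz_ideal_Ic[OF r'(2)] q(2)]
      unfolding 1(1) Ic_mult[OF prime_ramdiv_bezout[OF q(1) r] r, symmetric] by blast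
  next
    case 2
    then show ?thesis using Cons.IH[OF _ ps] Cons.prems(1) by simp
  qed
qed

section \<open>Classification of the ideals invariant under conjugation\<close>

lemma conj_image_Ic:
  assumes c: "ramdiv c"
  shows "conj ` Ic c = Ic c"
proof -
  have sub: "conj z \<in> Ic c" if "z \<in> Ic c" for z
  proof -
    obtain x y where z: "z = el x y" "c dvd x - mg * y" using \<open>z \<in> Ic c\<close> by (rule Ic_cases)
    have "x - mg * - y = (x - mg * y) + 2 * mg * y" by (simp add: algebra_simps)
    also have "c dvd \<dots>" using z(2) dvd_mult2[OF ramdiv_dvd(3)[OF c]] by (rule dvd_add)
    finally show ?thesis unfolding z conj_el el_in_Ic .
  qed
  moreover have "z \<in> conj ` Ic c" if z: "z \<in> Ic c" for z
  proof -
    have "z \<in> E" using z Ic_subset by (auto simp: OK_def)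
    then have "z = conj (conj z)" by (simp add: conj_conj)
    then show ?thesis using sub[OF z] by blast
  qed
  ultimately show ?thesis by blast
qed

text \<open>An invariant ideal not divisible by a nonunit of the Gaussian integers has a basis
  \<open>c\<close>, \<open>b + \<theta>\<close>; invariance and multiplication by \<open>\<theta>\<close> give the two divisibilities below.\<close>
lemma ramified_divisor:
  assumes c2: "c dvd 2 * b" and cb: "c dvd b * b + gi * mg"
  shows "ramdiv c \<and> c dvd b - mg"
proof -
  \<comment> \<open>Eliminating b leaves c as a divisor of 4 m, up to the unit i.\<close>
  have "c dvd (2 * b) * (2 * b) - 4 * (b * b + gi * mg)" by (rule dvd_diff[OF dvd_mult2[OF c2] dvd_mult[OF cb]])
  also have "(2 * b) * (2 * b) - 4 * (b * b + gi * mg) = gi * (- 4 * mg)" by (simp add: algebra_simps)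
  finally have "c dvd gi * (- 4 * mg)" .
  then have "c dvd gi * (gi * (- 4 * mg))" by (rule dvd_mult)
  then have c4: "c dvd 4 * mg" by simp
  have odd_case: "d dvd mg \<and> d dvd b" if d: "\<not> 1 + gi dvd d" "d dvd 4 * mg" "d dvd 2 * b" for d
  proof -
    have "bezout d (1 + gi)" using bezout_one_plus_gi[OF d(1)] by (simp add: bezout_commute)
    then have "bezout d ((1 + gi) * (1 + gi))" by (auto intro: bezout_mult)
    then have b: "bezout d (2 * gi)" unfolding one_plus_gi_squared .
    then have b2: "bezout d (2 * gi * (2 * gi))" by (rule bezout_mult[OF b])
    have "d dvd 2 * gi * (2 * gi) * mg" using d(2) by (simp add: mult.assoc mult.left_commute)
    moreover have "d dvd 2 * gi * b" using dvd_mult[OF d(3), of gi] by (simp add: mult_ac)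
    ultimately show ?thesis using bezout_dvd_mult[OF b] bezout_dvd_mult[OF b2] by blast
  qed
  show ?thesis
  proof (cases "1 + gi dvd c")
    case False
    from odd_case[OF this c4 c2] show ?thesis unfolding ramdiv_def by simp
  next
    case True
    then obtain d where d: "c = (1 + gi) * d" by (rule dvdE)
    have "\<not> 1 + gi dvd d"
    proof
      \<comment> \<open>Then 2 would divide b^2 + i m, which is impossible: the congruence modulo 2
        would make 1 + i divide 1.\<close>
      assume "1 + gi dvd d"
      then have "(1 + gi) * (1 + gi) dvd c" unfolding d by (rule mult_dvd_mono[OF dvd_refl])
      then have "gi * 2 dvd c" by (simp add: one_plus_gi_squared mult.commute)
      then have "2 dvd c" by (rule dvd_mult_right)
      then have "2 dvd b^2 + gi * of_int (int m) * 1^2" using cb by (auto simp: power2_eq_square intro: dvd_trans)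
      then have "1 + gi dvd 1" using two_dvd_square_plus_i_square(2)[of "int m" b 1] odd_m by simp
      then show False using prime_gnorm_not_unit[of "1 + gi"] by simp
    qed
    moreover have "d dvd 4 * mg" "d dvd 2 * b" using c4 c2 unfolding d by (blast intro: dvd_mult_right)+
    ultimately have dm: "d dvd mg" "d dvd b" and bz: "bezout (1 + gi) d"
      using odd_case bezout_one_plus_gi by blast+
    \<comment> \<open>Modulo 1 + i the number b^2 + i m is congruent to b - m.\<close>
    have "1 + gi dvd b - mg"
    proof -
      obtain x y where b: "b = gcomplex x y" by (rule gint_exhaust)
      have "b * b + gi * mg = gcomplex (x * x - y * y) (2 * (x * y) + int m)"
        unfolding b gi_def mg_eq by (simp add: gcomplex_simps)
      moreover have "1 + gi dvd b * b + gi * mg" using True cb by (rule dvd_trans)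
      ultimately have "even (x * x - y * y + (2 * (x * y) + int m))" using one_plus_gi_dvd_iff by metis
      then have "even (x - int m + y)" using odd_m by auto
      moreover have "b - mg = gcomplex (x - int m) y"
        unfolding b mg_eq by (simp add: gcomplex_simps)
      ultimately show ?thesis using one_plus_gi_dvd_iff by metis
    qed
    then have "(1 + gi) * d dvd b - mg" using dm by (intro bezout_mult_dvd[OF bz]) simp_all
    moreover have "(1 + gi) * d dvd (1 + gi) * mg" using dm(1) by (rule mult_dvd_mono[OF dvd_refl])
    ultimately show ?thesis unfolding d ramdiv_def by blast
  qed
qed

text \<open>The coordinates along theta form an ideal t Z[i]. As theta (x + y theta) = -i m y + x
  theta, t divides the other coordinates too, so I = t I' with some b + theta in I'. If c generates
  the Gaussian integers in I', then c, b + theta is a basis of I', and modulo c the number b may be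
  replaced by m.\<close>

lemma invariant_ideal:
  assumes I: "nz_ideal R I" and inv: "conj ` I = I"
  obtains t c where "t \<noteq> 0" "ramdiv c" "I = (*) (gc t) ` Ic c"
proof -
  have II: "is_ideal R I" using I by (simp add: nz_ideal_def)
  note D = is_idealD[OF II]
  have gcI: "el (r * x) (r * y) \<in> I" if "el x y \<in> I" for r x y
    using D(4)[OF gc_in_R that, of r] unfolding gc_mult_el .
  have thI: "el (- gi * mg * y) x \<in> I" if "el x y \<in> I" for x y
    using D(4)[OF el_in_R that, of 0 1] by (simp add: el_mult)
  have addI: "el (x + x') (y + y') \<in> I" if "el x y \<in> I" "el x' y' \<in> I" for x y x' y'
    using D(3)[OF that] unfolding el_add .
  have conjI: "el x (- y) \<in> I" if "el x y \<in> I" for x y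
    using that inv conj_el by (metis imageI)
  obtain t where t: "{y. \<exists>x. el x y \<in> I} = {y. t dvd y}"
  proof (rule gint_ideal_principal[of "{y. \<exists>x. el x y \<in> I}"])
    show "0 \<in> {y. \<exists>x. el x y \<in> I}" using D(2) el_0 by (metis mem_Collect_eq)
  qed (use addI gcI in blast)+
  have tdvd: "t dvd x" "t dvd y" if "el x y \<in> I" for x y
    using that thI[OF that] t by blast+
  have "t \<noteq> 0"
  proof
    assume t0: "t = 0"
    have "z = 0" if zI: "z \<in> I" for z
    proof -
      obtain x y where "z = el x y" using D(1)[OF zI] by (rule R_cases)
      then show ?thesis using tdvd[of x y] zI t0 by simp
    qed
    then show False using I D(2) by (auto simp: nz_ideal_def)
  qed
  have "t \<in> {y. \<exists>x. el x y \<in> I}" unfolding t by simp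
  then obtain x0 where x0: "el x0 t \<in> I" by blast
  obtain b where b: "x0 = t * b" using tdvd(1)[OF x0] by (rule dvdE)
  define P where "P x y \<longleftrightarrow> el (t * x) (t * y) \<in> I" for x y
  have Padd: "P x y \<Longrightarrow> P x' y' \<Longrightarrow> P (x + x') (y + y')" for x y x' y'
    unfolding P_def distrib_left by (rule addI)
  have Pmul: "P x y \<Longrightarrow> P (r * x) (r * y)" for r x y
    unfolding P_def mult.left_commute[of t r] by (rule gcI)
  have Pth: "P x y \<Longrightarrow> P (- gi * mg * y) x" for x y
    unfolding P_def using thI[of "t * x" "t * y"] by (simp add: mult_ac)
  have Pconj: "P x y \<Longrightarrow> P x (- y)" for x y
    unfolding P_def using conjI[of "t * x" "t * y"] by simp
  have Pb: "P b 1" using x0 by (simp add: P_def b)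
  obtain c where c: "{x. P x 0} = {x. c dvd x}"
  proof (rule gint_ideal_principal[of "{x. P x 0}"])
    show "0 \<in> {x. P x 0}" using D(2) by (simp add: P_def el_0)
    show "x + y \<in> {x. P x 0}" if "x \<in> {x. P x 0}" "y \<in> {x. P x 0}" for x y
      using Padd[of x 0 y 0] that by simp
    show "r * x \<in> {x. P x 0}" if "x \<in> {x. P x 0}" for r x using Pmul[of x 0 r] that by simp
  qed
  have Piff: "P x y \<longleftrightarrow> c dvd x - b * y" for x y
  proof -
    have "P x y \<longleftrightarrow> P (x - b * y) 0"
      using Padd[of x y "- y * b" "- y * 1"] Padd[of "x - b * y" 0 "y * b" "y * 1"]
        Pmul[OF Pb, of "- y"] Pmul[OF Pb, of y] by (auto simp: algebra_simps)
    also have "\<dots> \<longleftrightarrow> c dvd x - b * y" using c by blast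
    finally show ?thesis .
  qed
  have "c dvd 2 * b" using Pconj[OF Pb] unfolding Piff
    by (simp only: mult_minus_right mult_1_right diff_minus_eq_add mult_2)
  moreover have "c dvd b * b + gi * mg"
  proof -
    have "c dvd - gi * mg * 1 - b * b" using Pth[OF Pb] unfolding Piff .
    then have "c dvd - (- gi * mg * 1 - b * b)" by (simp only: dvd_minus_iff)
    then show ?thesis by (simp add: algebra_simps)
  qed
  ultimately have rc: "ramdiv c" "c dvd b - mg" using ramified_divisor by blast+
  have Piff': "P x y \<longleftrightarrow> c dvd x - mg * y" for x y
  proof -
    have eq: "x - mg * y = (x - b * y) + (b - mg) * y" by (simp add: algebra_simps)
    show ?thesis unfolding Piff eq by (rule dvd_add_iff_gint[OF dvd_mult2[OF rc(2)], symmetric])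
  qed
  have "I = (*) (gc t) ` Ic c"
  proof (intro equalityI subsetI)
    fix z assume z: "z \<in> I"
    obtain x y where xy: "z = el x y" using D(1)[OF z] by (rule R_cases)
    obtain x' y' where "x = t * x'" "y = t * y'" using tdvd[of x y] z xy unfolding dvd_def by blast
    then have "P x' y'" "z = gc t * el x' y'" using z xy by (simp_all add: P_def gc_mult_el)
    moreover from this(1) have "el x' y' \<in> Ic c" by (simp add: Piff')
    ultimately show "z \<in> (*) (gc t) ` Ic c" by blast
  next
    fix z assume "z \<in> (*) (gc t) ` Ic c"
    then obtain x y where "z = gc t * el x y" "P x y" unfolding Piff' by (auto elim!: Ic_cases)
    then show "z \<in> I" by (simp add: P_def gc_mult_el)
  qed
  with \<open>t \<noteq> 0\<close> rc(1) show ?thesis by (rule that)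
qed

text \<open>\<open>ps\<close> lists all the ramified primes, while G may contain the ideals of only
  some of them; that the other classes also lie in the subgroup has to come from relations.\<close>

lemma Am_s_eq:
  assumes ps: "\<forall>q\<in>set ps. prime (gnorm q) \<and> cl q \<in> gens G"
    and prod: "prod_list ps = (1 + gi) * mg"
    and G: "\<forall>I\<in>G. \<exists>q\<in>set ps. I = Ic q"
  shows "Am_s E QI = gens G"
proof
  show "Am_s E QI \<subseteq> gens G"
    unfolding Am_s_def
  proof (rule class_subgroup_subsetI)
    fix I assume "I \<in> {I. nz_ideal R I \<and> (\<exists>\<sigma>. rel_nontriv_aut E QI \<sigma> \<and> \<sigma> ` I = I)}"
    then obtain \<sigma> where I: "nz_ideal R I" and s: "rel_nontriv_aut E QI \<sigma>" "\<sigma> ` I = I" by blast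
    have "z \<in> E" if "z \<in> I" for z using that I by (auto simp: nz_ideal_def is_ideal_def OK_def)
    then have "conj ` I = \<sigma> ` I" using rel_nontriv_aut_unique[OF s(1)] by (intro image_cong) simp_all
    then have "conj ` I = I" using s(2) by simp
    then obtain t c where tc: "t \<noteq> 0" "ramdiv c" "I = (*) (gc t) ` Ic c"
      by (rule invariant_ideal[OF I])
    have "cls R I = cl c" unfolding tc(3) using tc(1) by (intro cls_times R_subring nz_ideal_Ic tc) simp_all
    moreover have "cl c \<in> gens G"
      using tc(2) by (intro cls_Ic_in_subgroup[OF ps]) (simp_all add: prod ramdiv_def)
    ultimately show "cls R I \<in> gens G" by simp
  qed
  show "gens G \<subseteq> Am_s E QI"
    unfolding Am_s_def
  proof (rule class_subgroup_subsetI)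
    fix I assume "I \<in> G" and nz: "nz_ideal R I"
    then obtain q where q: "q \<in> set ps" "I = Ic q" using G by blast
    have "ramdiv q" unfolding ramdiv_def prod[symmetric] using q(1) by (rule prod_list_dvd)
    then have "conj ` I = I" unfolding q(2) by (rule conj_image_Ic)
    then show "cls R I \<in> gens {I. nz_ideal R I \<and> (\<exists>\<sigma>. rel_nontriv_aut E QI \<sigma> \<and> \<sigma> ` I = I)}"
      using nz conj_nontrivial by (intro class_subgroup.gen) blast+
  qed
qed

end

section \<open>Real quadratic units\<close>

lemma csqrt_nat_squared: "csqrt_nat n * csqrt_nat n = of_nat n"
  unfolding csqrt_nat_def by (simp flip: of_real_mult)

lemma csqrt_nat_mult: "csqrt_nat (a * b) = csqrt_nat a * csqrt_nat b"
  by (simp add: csqrt_nat_def real_sqrt_mult)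

lemma csqrt_nat_real [simp]: "Im (csqrt_nat n) = 0" "Re (csqrt_nat n) = sqrt n"
  by (simp_all add: csqrt_nat_def)

lemma alg_int_csqrt_nat: "alg_int (csqrt_nat n)"
  by (rule alg_int_if_power2) (simp add: power2_eq_square csqrt_nat_squared)

lemma units_OK_I:
  assumes "u \<in> OK K" "v \<in> OK K" "u * v = 1" shows "u \<in> units_OK K"
proof -
  have "inverse u = v" using inverse_unique[OF assms(3)] .
  then show ?thesis using assms by (auto simp: units_OK_def)
qed

lemma units_OK_D: "u \<in> units_OK K \<Longrightarrow> u \<in> OK K" "u \<in> units_OK K \<Longrightarrow> u \<noteq> 0"
  "u \<in> units_OK K \<Longrightarrow> inverse u \<in> OK K"
  by (simp_all add: units_OK_def)

lemma int_unit_cases: "a * b = 1 \<Longrightarrow> a = 1 \<or> a = (-1::int)"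
  using zmult_eq_1_iff by blast

locale rat_quad =
  fixes n :: nat
  assumes not_square: "\<And>s::nat. s^2 \<noteq> n"
begin

sublocale quad_ext "\<rat>" "csqrt_nat n"
proof
  show "csqrt_nat n * csqrt_nat n \<in> \<rat>" unfolding csqrt_nat_squared by simp
  show "csqrt_nat n \<notin> \<rat>"
  proof
    assume "csqrt_nat n \<in> \<rat>"
    then have "csqrt_nat n \<in> \<int>"
      using alg_int_Rats_imp_Ints[OF alg_int_csqrt_nat] by blast
    then obtain k where "csqrt_nat n = of_int k" by (auto elim: Ints_cases)
    then have "Re (csqrt_nat n) = of_int k" by simp
    then have "sqrt (real n) \<in> \<rat>" by simp
    then show False using sqrt_nat_irrational[of n] not_square by blast
  qed
qed (rule is_subfield_Rats)

lemma field_gen_csqrt: "field_gen {csqrt_nat n} = E"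
proof
  show "field_gen {csqrt_nat n} \<subseteq> E"
    by (rule field_gen_least[OF is_subfield_E]) (simp add: t_in_E)
  show "E \<subseteq> field_gen {csqrt_nat n}"
    by (rule E_least[OF is_subfield_field_gen subfield_Rats[OF is_subfield_field_gen]])
      (use field_gen_superset[of "{csqrt_nat n}"] in simp)
qed

lemma Im_E: "z \<in> E \<Longrightarrow> Im z = 0"
  by (auto elim!: E_cases Rats_cases' simp: Im_divide)

lemma norm_OK_int:
  assumes "z \<in> OK E" obtains k where "z * conj z = of_int k"
proof -
  have z: "z \<in> E" "alg_int z" using assms by (simp_all add: OK_def)
  have "z * conj z \<in> \<int>"
    using alg_int_Rats_imp_Ints[OF alg_int_mult[OF z(2) alg_int_conj[OF z]] E_times_conj_in_F(1)[OF z(1)]] .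
  then show ?thesis using that by (auto elim: Ints_cases)
qed

lemma norm_unit:
  assumes "u \<in> units_OK E" shows "u * conj u = 1 \<or> u * conj u = -1"
proof -
  note u = units_OK_D[OF assms]
  obtain k where k: "u * conj u = of_int k" by (rule norm_OK_int[OF u(1)])
  obtain l where l: "inverse u * conj (inverse u) = of_int l" by (rule norm_OK_int[OF u(3)])
  have E: "u \<in> E" "inverse u \<in> E" using u by (simp_all add: OK_def)
  have "(1::complex) = (u * inverse u) * conj (u * inverse u)" using u(2) conj_F[of 1] by simp
  also have "\<dots> = (u * conj u) * (inverse u * conj (inverse u))" unfolding E_mult_conj(2)[OF E] by (simp only: mult_ac)
  also have "\<dots> = of_int (k * l)" unfolding k l by simp
  finally have "(of_int (k * l) :: complex) = of_int 1" by simp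
  then have "k * l = 1" by (simp only: of_int_eq_iff)
  then have "k = 1 \<or> k = -1" by (rule int_unit_cases)
  then show ?thesis using k by auto
qed

lemma qnorm_eq:
  assumes u: "u \<in> E" shows "qnorm E u = u * conj u"
  unfolding qnorm_def field_gen_empty
proof (rule the_equality)
  show "\<exists>\<tau>. rel_nontriv_aut E \<rat> \<tau> \<and> u * conj u = u * \<tau> u" using conj_nontrivial by blast
  fix k assume "\<exists>\<tau>. rel_nontriv_aut E \<rat> \<tau> \<and> k = u * \<tau> u"
  then obtain \<tau> where "rel_nontriv_aut E \<rat> \<tau>" "k = u * \<tau> u" by blast
  then show "k = u * conj u" using rel_nontriv_aut_unique[OF _ u] by simp
qed

text \<open>These elements form Z[sqrt n], which can be smaller than the ring of integers: it is for
  n = p1 p2, which is 1 modulo 4.\<close>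

definition ze :: "int \<Rightarrow> int \<Rightarrow> complex" where "ze x y = of_int x + of_int y * csqrt_nat n"

lemma ze_in_OK: "ze x y \<in> OK E"
  unfolding ze_def OK_def
  by (auto intro!: E_I alg_int_add alg_int_mult alg_int_csqrt_nat)

lemma conj_ze: "conj (ze x y) = ze x (- y)"
  unfolding ze_def using conj_eq[of "of_int x" "of_int y"] by simp

lemma ze_mult: "ze x y * ze x' y' = ze (x * x' + int n * (y * y')) (x * y' + x' * y)"
proof -
  have "ze x y * ze x' y' = of_int x * of_int x' + of_int y * of_int y' * (csqrt_nat n * csqrt_nat n)
    + (of_int x * of_int y' + of_int x' * of_int y) * csqrt_nat n"
    by (simp add: ze_def algebra_simps)
  then show ?thesis
    unfolding csqrt_nat_squared by (simp only: ze_def of_int_add of_int_mult of_int_of_nat_eq mult_ac)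
qed

lemma ze_of_int: "ze k 0 = of_int k" by (simp add: ze_def)

lemma ze_norm: "ze x y * conj (ze x y) = of_int (x^2 - int n * y^2)"
  unfolding conj_ze ze_mult by (simp add: power2_eq_square ze_of_int)

lemma Re_ze: "Re (ze x y) = of_int x + of_int y * sqrt n" and Im_ze: "Im (ze x y) = 0"
  by (simp_all add: ze_def)

lemma ze_unit:
  assumes "x^2 - int n * y^2 = 1 \<or> x^2 - int n * y^2 = -1"
  shows "ze x y \<in> units_OK E"
proof -
  have *: "ze x y * ze x (- y) = of_int (x^2 - int n * y^2)" using ze_norm[of x y] by (simp add: conj_ze)
  have "ze x y * ze (- x) y = - (ze x y * ze x (- y))" by (simp add: ze_def algebra_simps)
  with * assms have "ze x y * ze x (- y) = 1 \<or> ze x y * ze (- x) y = 1"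
    by (elim disjE) (simp_all only: of_int_1 of_int_minus minus_minus simp_thms)
  then show ?thesis using units_OK_I ze_in_OK by blast
qed

lemma n_ge_2: "n \<ge> 2"
proof (rule ccontr)
  assume "\<not> n \<ge> 2"
  then have "n = 0 \<or> n = 1" by linarith
  then show False using not_square[of 0] not_square[of 1] by auto
qed

lemma sqrt_n_gt_1: "sqrt n > 1"
  using n_ge_2 by simp

text \<open>The conjugate b of a unit a > 1 has |b| = 1 / a < 1, so 2 x = a + b and 2 y sqrt n = a -
  b are both positive.\<close>

lemma unit_gt_one_bounds:
  assumes u: "ze x y \<in> units_OK E" and gt: "Re (ze x y) > 1"
  shows "0 < x" "0 < y" "of_int x \<le> Re (ze x y)" "of_int y \<le> Re (ze x y)"
    "x^2 - int n * y^2 = 1 \<or> x^2 - int n * y^2 = -1"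
proof -
  have "(of_int (x^2 - int n * y^2) :: complex) = of_int 1 \<or> (of_int (x^2 - int n * y^2) :: complex) = of_int (-1)"
    using norm_unit[OF u] unfolding ze_norm by simp
  then show N: "x^2 - int n * y^2 = 1 \<or> x^2 - int n * y^2 = -1" unfolding of_int_eq_iff .
  define s where "s = sqrt n"
  have s: "s > 1" using sqrt_n_gt_1 by (simp add: s_def)
  have ss: "s * s = n" by (simp add: s_def)
  define a b where "a = real_of_int x + of_int y * s" and "b = real_of_int x - of_int y * s"
  have a: "a = Re (ze x y)" "a > 1" using gt by (simp_all add: Re_ze a_def s_def)
  have "a * b = of_int (x^2 - int n * y^2)"
    by (simp add: a_def b_def power2_eq_square algebra_simps ss[symmetric])
  with N have "\<bar>a * b\<bar> = 1"
    by (elim disjE) (simp_all only: of_int_1 of_int_minus abs_1 abs_minus_cancel)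
  then have "a * \<bar>b\<bar> = 1" using a(2) by (simp add: abs_mult)
  then have b: "\<bar>b\<bar> < 1" using a(2) by (metis abs_ge_zero less_eq_real_def linorder_not_less mult_le_cancel_right1 mult.commute mult_1 not_one_le_zero order_less_le)
  have "2 * real_of_int x = a + b" by (simp add: a_def b_def)
  then show x: "0 < x" using a(2) b by linarith
  have "2 * (of_int y * s) = a - b" by (simp add: a_def b_def)
  then have "of_int y * s > 0" using a(2) b by linarith
  then show y: "0 < y" using s by (simp add: zero_less_mult_iff)
  have "of_int y * s \<ge> of_int y * 1" using y s by (intro mult_left_mono) auto
  then show "of_int x \<le> Re (ze x y)" "of_int y \<le> Re (ze x y)"
    unfolding a(1)[symmetric] a_def using x y by linarith+
qed

text \<open>Pell's equation supplies a unit above 1, and the bounds on the coordinates leave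
  finitely many units between 1 and it. A least one therefore exists, as the description in
  \<open>fund_unit\<close> demands.\<close>

lemma fund_unit_exists:
  assumes int: "\<And>z. z \<in> OK E \<Longrightarrow> \<exists>x y. z = ze x y"
  obtains x y where "fund_unit E = ze x y" "0 < x" "0 < y"
    "x^2 - int n * y^2 = 1 \<or> x^2 - int n * y^2 = -1" "Re (ze x y) > 1"
    "\<And>v. v \<in> units_OK E \<Longrightarrow> Re v > 1 \<Longrightarrow> Re (ze x y) \<le> Re v"
proof -
  define A where "A = {v \<in> units_OK E. Re v > 1}"
  have AE: "Im v = 0" if "v \<in> A" for v
    using that Im_E by (auto simp: A_def units_OK_def OK_def)
  obtain a b where ab: "a^2 - int n * b^2 = 1" "0 < a" "0 < b"
    by (rule pell_equation_solvable[OF not_square])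
  define v0 where "v0 = ze a b"
  have "Re v0 > 1"
  proof -
    have "of_int b * sqrt n > 0" using ab(3) sqrt_n_gt_1 by (intro mult_pos_pos) auto
    moreover have "real_of_int a \<ge> 1" using ab(2) by simp
    ultimately show ?thesis unfolding v0_def Re_ze by linarith
  qed
  then have v0: "v0 \<in> A" using ze_unit[of a b] ab(1) by (simp add: A_def v0_def)
  define B where "B = {v \<in> A. Re v \<le> Re v0}"
  have "B \<subseteq> (\<lambda>(x,y). ze x y) ` ({0..\<lceil>Re v0\<rceil>} \<times> {0..\<lceil>Re v0\<rceil>})"
  proof
    fix v assume v: "v \<in> B"
    then obtain x y where xy: "v = ze x y" using int[of v] by (auto simp: B_def A_def units_OK_def)
    have "0 < x" "0 < y" "of_int x \<le> Re v" "of_int y \<le> Re v"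
      using unit_gt_one_bounds[of x y] v by (simp_all add: B_def A_def xy)
    moreover have "Re v \<le> Re v0" using v by (simp add: B_def)
    ultimately have "0 \<le> x" "x \<le> \<lceil>Re v0\<rceil>" "0 \<le> y" "y \<le> \<lceil>Re v0\<rceil>" by linarith+
    then show "v \<in> (\<lambda>(x,y). ze x y) ` ({0..\<lceil>Re v0\<rceil>} \<times> {0..\<lceil>Re v0\<rceil>})" unfolding xy by auto
  qed
  then have "finite B" by (rule finite_subset) simp
  moreover have "v0 \<in> B" using v0 by (simp add: B_def)
  ultimately obtain w where w: "w \<in> B" "\<forall>v\<in>B. Re w \<le> Re v"
    using ex_min_if_finite[of "Re ` B"] by (metis (no_types, lifting) empty_iff finite_imageI image_iff linorder_not_less)
  have wA: "w \<in> A" using w(1) by (simp add: B_def)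
  have min: "Re w \<le> Re v" if "v \<in> A" for v
  proof (cases "Re v \<le> Re v0")
    case True
    then show ?thesis using w(2) that by (simp add: B_def)
  next
    case False
    then show ?thesis using w(1) by (simp add: B_def)
  qed
  have "fund_unit E = w"
    unfolding fund_unit_def
  proof (rule the_equality)
    show "w \<in> units_OK E \<and> Im w = 0 \<and> 1 < Re w \<and>
        (\<forall>v\<in>units_OK E. Im v = 0 \<and> 1 < Re v \<longrightarrow> Re w \<le> Re v)"
      using wA AE[OF wA] min by (simp add: A_def)
    fix u assume u: "u \<in> units_OK E \<and> Im u = 0 \<and> 1 < Re u \<and>
        (\<forall>v\<in>units_OK E. Im v = 0 \<and> 1 < Re v \<longrightarrow> Re u \<le> Re v)"
    then have "u \<in> A" by (simp add: A_def)
    have "Re u \<le> Re w" using u wA AE[OF wA] by (simp add: A_def)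
    then have "Re u = Re w" using min[OF \<open>u \<in> A\<close>] by simp
    then show "u = w" using u AE[OF wA] by (simp add: complex_eq_iff)
  qed
  moreover obtain x y where xy: "w = ze x y" using int[of w] wA by (auto simp: A_def units_OK_def)
  ultimately show ?thesis
    using that[of x y] wA min unit_gt_one_bounds[of x y] by (simp add: A_def xy)
qed

end

section \<open>Descent on a unit of norm 1\<close>

lemma coprime_mult_prime_cases:
  fixes u v k :: nat
  assumes "prime p" "u * v = p * k"
  obtains u' where "u = p * u'" "u' * v = k" | v' where "v = p * v'" "u * v' = k"
proof -
  have "p dvd u \<or> p dvd v" using assms prime_dvd_mult_iff by (metis dvd_triv_left)
  moreover have "p > 0" using assms(1) prime_gt_0_nat by blast
  ultimately show ?thesis using assms(2) that by (auto elim!: dvdE)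
qed

lemma coprime_mult_square_nat:
  fixes u v w :: nat
  assumes "coprime u v" "u * v = w^2"
  obtains r t where "u = r^2" "v = t^2" "w = r * t"
proof -
  have "is_nth_power 2 (u * v)" unfolding assms(2) by (rule is_nth_powerI[OF refl])
  then have "is_nth_power 2 u" "is_nth_power 2 v"
    using is_nth_power_mult_coprime_nat_iff[OF assms(1)] by auto
  then obtain r t where rt: "u = r^2" "v = t^2" by (auto elim!: is_nth_powerE)
  then have "w^2 = (r * t)^2" using assms(2) by (simp add: power_mult_distrib)
  then have "w = r * t" by (simp add: power2_eq_iff_nonneg)
  with rt show ?thesis by (rule that)
qed

text \<open>The classical descent: \<open>x^2 - 2 p q y^2 = 1\<close> splits as the product of the coprime numbers
  \<open>(x + 1) / 2\<close> and \<open>(x - 1) / 2\<close>.\<close>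
lemma norm_one_descent:
  fixes x y p q :: nat
  assumes p: "prime p" and q: "prime q" and "odd p" "odd q" and xy: "x^2 = 2 * (p * q) * y^2 + 1" and y: "0 < y"
  obtains A B r t where "(A, B) \<in> {(1, 2 * (p * q)), (2, p * q), (p, 2 * q), (q, 2 * p)}"
    "x = A * r^2 + B * t^2" "y = 2 * r * t" "A * r^2 = B * t^2 + 1 \<or> B * t^2 = A * r^2 + 1"
proof -
  define D where "D = {(1, 2 * (p * q)), (2, p * q), (p, 2 * q), (q, 2 * p)}"
  note goal = that[folded D_def]
  have "odd (x^2)" unfolding xy by simp
  then have "odd x" by simp
  then obtain v where v: "x = 2 * v + 1" by (rule oddE)
  have "4 * (v * (v + 1)) = 2 * (p * q) * y^2" using xy unfolding v by (simp add: power2_eq_square algebra_simps)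
  then have vy: "2 * (v * (v + 1)) = p * q * y^2" by simp
  then have "even (p * q * y^2)" by (metis dvd_triv_left)
  then have "even y" using assms(3,4) by simp
  then obtain w where w: "y = 2 * w" by (rule evenE)
  have eq: "(v + 1) * v = 2 * (p * (q * w^2))" using vy unfolding w by (simp add: power2_eq_square algebra_simps)
  have cop: "coprime (v + 1) v" by simp
  \<comment> \<open>Here a and b are the shares of 2, p, q that fall to v + 1 and to v.
    \<open>D\<close> lists only one order of each complementary pair, hence the two possible signs
    of A r^2 - B t^2.\<close>
  have fin: thesis
    if e1: "v + 1 = a * u'" and e2: "v = b * v'" and e3: "u' * v' = w^2"
      and e4: "(a, b) \<in> D \<or>
       (b, a) \<in> D" for a b u' v'
  proof -
    have "coprime (a * u') (b * v')" using cop by (simp only: e1[symmetric] e2[symmetric])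
    then have "coprime u' v'" by (simp add: coprime_mult_left_iff coprime_mult_right_iff)
    then obtain r t where rt: "u' = r^2" "v' = t^2" "w = r * t"
      using e3 by (rule coprime_mult_square_nat)
    have x1: "x = a * r^2 + b * t^2" "a * r^2 = b * t^2 + 1" using v e1 e2 rt by (simp_all add: algebra_simps)
    have y1: "y = 2 * r * t" "y = 2 * t * r" using w rt by simp_all
    from e4 show thesis
    proof
      assume "(a, b) \<in> D"
      then show thesis by (rule goal[OF _ x1(1) y1(1) disjI1[OF x1(2)]])
    next
      assume "(b, a) \<in> D"
      then show thesis by (rule goal[OF _ _ y1(2) disjI2[OF x1(2)]]) (use x1(1) in simp)
    qed
  qed
  have two: "prime (2::nat)" by simp
  from eq show thesis
  proof (rule coprime_mult_prime_cases[OF two])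
    fix u1 assume u1: "v + 1 = 2 * u1" "u1 * v = p * (q * w^2)"
    from u1(2) show thesis
    proof (rule coprime_mult_prime_cases[OF p])
      fix u2 assume u2: "u1 = p * u2" "u2 * v = q * w^2"
      from u2(2) show thesis
      proof (rule coprime_mult_prime_cases[OF q])
        fix u3 assume "u2 = q * u3" "u3 * v = w^2"
        then show thesis using fin[of "2 * (p * q)" u3 1 v] u1 u2 by (simp add: D_def)
      next
        fix v3 assume "v = q * v3" "u2 * v3 = w^2"
        then show thesis using fin[of "2 * p" u2 q v3] u1 u2 by (simp add: D_def)
      qed
    next
      fix v2 assume v2: "v = p * v2" "u1 * v2 = q * w^2"
      from v2(2) show thesis
      proof (rule coprime_mult_prime_cases[OF q])
        fix u3 assume "u1 = q * u3" "u3 * v2 = w^2"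
        then show thesis using fin[of "2 * q" u3 p v2] u1 v2 by (simp add: D_def)
      next
        fix v3 assume "v2 = q * v3" "u1 * v3 = w^2"
        then show thesis using fin[of 2 u1 "p * q" v3] u1 v2 by (simp add: D_def)
      qed
    qed
  next
    fix v1 assume v1: "v = 2 * v1" "(v + 1) * v1 = p * (q * w^2)"
    from v1(2) show thesis
    proof (rule coprime_mult_prime_cases[OF p])
      fix u2 assume u2: "v + 1 = p * u2" "u2 * v1 = q * w^2"
      from u2(2) show thesis
      proof (rule coprime_mult_prime_cases[OF q])
        fix u3 assume "u2 = q * u3" "u3 * v1 = w^2"
        then show thesis using fin[of "p * q" u3 2 v1] v1 u2 by (simp add: D_def)
      next
        fix v3 assume "v1 = q * v3" "u2 * v3 = w^2"
        then show thesis using fin[of p u2 "2 * q" v3] v1 u2 by (simp add: D_def)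
      qed
    next
      fix v2 assume v2: "v1 = p * v2" "(v + 1) * v2 = q * w^2"
      from v2(2) show thesis
      proof (rule coprime_mult_prime_cases[OF q])
        fix u3 assume "v + 1 = q * u3" "u3 * v2 = w^2"
        then show thesis using fin[of q u3 "2 * p" v2] v1 v2 by (simp add: D_def)
      next
        fix v3 assume "v2 = q * v3" "(v + 1) * v3 = w^2"
        then show thesis using fin[of 1 "v + 1" "2 * (p * q)" v3] v1 v2 by (simp add: D_def)
      qed
    qed
  qed
qed

section \<open>Relations between the ramified primes\<close>

lemma field_gen_base: "x \<in> S \<Longrightarrow> x \<in> field_gen S"
  using field_gen_superset by blast

text \<open>Otherwise the prime divides the sum 2 a, so p divides 4 a^2 and hence a. Now a = 0 would
  make p even, and a nonzero multiple of p contradicts a^2 <= p.\<close>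

lemma conjugate_primes_not_dvd:
  assumes p: "prime p" "odd p" and ab: "int p = a^2 + 4 * b^2"
  shows "\<not> gcomplex a (2 * b) dvd gcomplex a (- 2 * b)"
proof
  assume "gcomplex a (2 * b) dvd gcomplex a (- 2 * b)"
  then have "gcomplex a (2 * b) dvd gcomplex a (2 * b) + gcomplex a (- 2 * b)" by simp
  also have "gcomplex a (2 * b) + gcomplex a (- 2 * b) = of_int (2 * a)"
    by (simp only: gcomplex_simps of_int_gcomplex) simp
  finally have "gnorm (gcomplex a (2 * b)) dvd gnorm (of_int (2 * a))" by (rule gnorm_dvd)
  moreover have "gnorm (gcomplex a (2 * b)) = int p" by (simp add: ab power_mult_distrib)
  ultimately have "int p dvd (2 * a)^2" unfolding gnorm_of_int by simp
  then have "int p dvd 2 * 2 * (a * a)" by (simp add: power2_eq_square)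
  moreover have pp: "prime (int p)" using p(1) by simp
  moreover have "\<not> int p dvd 2"
  proof
    assume "int p dvd 2"
    then have "p dvd 2" by (metis int_dvd_int_iff of_nat_numeral)
    then have "p \<le> 2" by (rule dvd_imp_le) simp
    then show False using p(2) prime_ge_2_nat[OF p(1)] by (cases "p = 2") auto
  qed
  ultimately have "int p dvd a" by (metis prime_dvd_mult_iff)
  then obtain k where k: "a = int p * k" by (rule dvdE)
  have "k \<noteq> 0"
  proof
    assume "k = 0"
    then have "int p = 2 * (2 * b^2)" using ab k by simp
    then have "even (int p)" by (rule dvdI)
    then show False using p(2) by simp
  qed
  then have "k * k \<ge> 1" by (metis int_one_le_iff_zero_less not_square_less_zero linorder_neqE_linordered_idom mult_eq_0_iff)
  have p2: "int p \<ge> 2" using p(1) prime_ge_2_nat by fastforce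
  have "int p * int p \<le> int p * int p * (k * k)" using \<open>k * k \<ge> 1\<close> p2 by simp
  also have "\<dots> = a^2" by (simp add: k power2_eq_square)
  also have "\<dots> \<le> int p" using ab by simp
  finally show False using p2 by simp
qed

text \<open>The squares contribute even multiplicities, and p A contributes exactly 1.\<close>

lemma odd_multiplicity_if_square_ratio:
  fixes p :: int
  assumes p: "prime p" and A: "\<not> p dvd A" and eq: "p * A * s^2 = k * t^2" and s: "s \<noteq> 0"
  shows "odd (multiplicity p k)"
proof -
  have pe: "prime_elem p" by (rule prime_imp_prime_elem[OF p])
  have nz: "p \<noteq> 0" "A \<noteq> 0" using A p not_prime_0 by (metis, metis dvd_0_right)
  then have "p * A * s^2 \<noteq> 0" using s by simp
  then have nz': "k \<noteq> 0" "t \<noteq> 0" using eq by auto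
  have "multiplicity p (p * A * s^2) = 1 + 2 * multiplicity p s"
    using nz s pe p A
    by (simp add: prime_elem_multiplicity_mult_distrib prime_elem_multiplicity_power_distrib not_dvd_imp_multiplicity_0
        multiplicity_same_power[of p 1, simplified])
  moreover have "multiplicity p (k * t^2) = multiplicity p k + 2 * multiplicity p t"
    using nz' pe by (simp add: prime_elem_multiplicity_mult_distrib prime_elem_multiplicity_power_distrib)
  ultimately have "multiplicity p k + 2 * multiplicity p t = 1 + 2 * multiplicity p s"
    using eq by simp
  then show ?thesis by presburger
qed

locale biquad =
  fixes p1 p2 :: nat and e f g h :: int
  assumes p1: "prime p1" and p2: "prime p2" and p12: "p1 \<noteq> p2"
    and mod1: "p1 mod 4 = 1" and mod2: "p2 mod 4 = 1"
    and ef: "int p1 = e^2 + 4 * f^2" and gh: "int p2 = g^2 + 4 * h^2"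
begin

definition pi1 :: gint where "pi1 = gcomplex e (2 * f)"
definition pi2 :: gint where "pi2 = gcomplex e (- 2 * f)"
definition pi3 :: gint where "pi3 = gcomplex g (2 * h)"
definition pi4 :: gint where "pi4 = gcomplex g (- 2 * h)"

lemma odd_primes: "odd p1" "odd p2"
  using mod1 mod2 by presburger+

lemma gnorms: "gnorm pi1 = int p1" "gnorm pi2 = int p1" "gnorm pi3 = int p2" "gnorm pi4 = int p2"
  by (simp_all add: pi1_def pi2_def pi3_def pi4_def ef gh power_mult_distrib)

lemma prime_gnorms: "prime (gnorm pi1)" "prime (gnorm pi2)" "prime (gnorm pi3)" "prime (gnorm pi4)"
  "prime (gnorm (1 + gi))"
  using p1 p2 by (simp_all add: gnorms)

lemma pi12: "pi1 * pi2 = of_nat p1" and pi34: "pi3 * pi4 = of_nat p2"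
proof -
  have "pi1 * pi2 = of_int (int p1)"
    unfolding ef pi1_def pi2_def gcomplex_simps of_int_gcomplex by (simp add: power2_eq_square)
  then show "pi1 * pi2 = of_nat p1" by simp
  have "pi3 * pi4 = of_int (int p2)"
    unfolding gh pi3_def pi4_def gcomplex_simps of_int_gcomplex by (simp add: power2_eq_square)
  then show "pi3 * pi4 = of_nat p2" by simp
qed

lemma p_not_dvd: "\<not> p1 dvd p2" "\<not> p2 dvd p1"
  using p1 p2 p12 primes_dvd_imp_eq by blast+

lemma bezout_pi: "bezout pi1 pi2" "bezout pi3 pi4" "bezout pi1 pi3" "bezout pi1 pi4" "bezout pi2 pi3" "bezout pi2 pi4"
proof -
  show "bezout pi1 pi2" "bezout pi3 pi4"
    using conjugate_primes_not_dvd[OF p1 odd_primes(1) ef] conjugate_primes_not_dvd[OF p2 odd_primes(2) gh]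
    by (intro bezout_if_prime_gnorm prime_gnorms; simp add: pi1_def pi2_def pi3_def pi4_def)+
  have *: "bezout x y" if "gnorm x = int p1" "gnorm y = int p2" for x y
  proof (rule bezout_if_prime_gnorm)
    show "prime (gnorm x)" using that(1) p1 by simp
    show "\<not> x dvd y" using gnorm_dvd[of x y] p_not_dvd by (auto simp: that)
  qed
  show "bezout pi1 pi3" "bezout pi1 pi4" "bezout pi2 pi3" "bezout pi2 pi4"
    by (rule *; rule gnorms)+
qed

definition m :: nat where "m = p1 * p2"

lemma of_nat_m: "(of_nat m :: gint) = (pi1 * pi2) * (pi3 * pi4)"
  by (simp add: m_def pi12 pi34)

sublocale zi_quad m
proof
  show "odd m" using odd_primes by (simp add: m_def)
  fix z :: gint assume z: "of_nat m dvd z * z"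
  have "q dvd z" if "prime (gnorm q)" "q dvd of_nat m" for q
    using prime_gnorm_dvd_mult[OF that(1) dvd_trans[OF that(2) z]] by blast
  then have d: "pi1 dvd z" "pi2 dvd z" "pi3 dvd z" "pi4 dvd z"
    using prime_gnorms unfolding of_nat_m by (auto simp: dvd_mult dvd_mult2)
  have "bezout pi1 (pi3 * pi4)" "bezout pi2 (pi3 * pi4)"
    using bezout_pi by (auto intro: bezout_mult)
  then have "bezout (pi3 * pi4) (pi1 * pi2)" by (intro bezout_mult) (simp_all add: bezout_commute)
  then have b: "bezout (pi1 * pi2) (pi3 * pi4)" by (simp add: bezout_commute)
  show "of_nat m dvd z" unfolding of_nat_m
    by (intro bezout_mult_dvd b bezout_pi d)
qed

lemma prod_list_pi: "prod_list [1 + gi, pi1, pi2, pi3, pi4] = (1 + gi) * mg"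
  unfolding of_nat_m by (simp add: mult_ac)

lemma ramdiv_pi: "ramdiv (1 + gi)" "ramdiv pi1" "ramdiv pi2" "ramdiv pi3" "ramdiv pi4"
  unfolding ramdiv_def prod_list_pi[symmetric] by (rule prod_list_dvd; simp)+

lemma nat_ramdiv: "c dvd mg \<Longrightarrow> ramdiv c"
  unfolding ramdiv_def by (rule dvd_mult)

text \<open>The multiples of theta are the elements -i m y + x theta, that is, those whose first
  coordinate is divisible by m.\<close>

lemma cls_Ic_m: "cl mg = cls R R"
proof -
  have th: "theta = el 0 1" by (simp add: el_def)
  have "Ic mg = (*) theta ` R"
  proof (intro equalityI subsetI)
    fix z assume "z \<in> Ic mg"
    then obtain x y where z: "z = el x y" "mg dvd x - mg * y" by (rule Ic_cases)
    have "mg dvd (x - mg * y) + mg * y" using z(2) by (rule dvd_add) simp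
    then obtain k where k: "x = mg * k" by (auto elim: dvdE)
    have "gi * mg * (gi * k) = (gi * gi) * (mg * k)" by (simp only: mult_ac)
    then have "z = theta * el y (gi * k)" unfolding z(1) th el_mult k by simp
    then show "z \<in> (*) theta ` R" using el_in_R by blast
  next
    fix z assume "z \<in> (*) theta ` R"
    then obtain w where w: "z = theta * w" "w \<in> R" by blast
    obtain x y where "w = el x y" using w(2) by (rule R_cases)
    then have "z = el (mg * (- gi * y)) x" unfolding w(1) th by (simp add: el_mult mult.left_commute)
    then show "z \<in> Ic mg" by (simp flip: right_diff_distrib)
  qed
  then show ?thesis using cls_principal[OF R_subring el_in_R, of 0 1] unfolding th by simp
qed

lemma cls_cancel:
  assumes r: "ramdiv (c * d)" and b: "bezout c d" and one: "cl (c * d) = cls R R"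
    and c: "cl c \<in> gens G"
  shows "cl d \<in> gens G"
proof (rule class_subgroup_cancel[OF R_subring _ _ c])
  show "nz_ideal R (Ic c)" "nz_ideal R (Ic d)"
    using ramdiv_dvd_trans[OF r] by (auto intro!: nz_ideal_Ic)
  show "cls R (ideal_mult R (Ic c) (Ic d)) = cls R R" unfolding Ic_mult[OF b r] by (rule one)
qed

text \<open>The relation given by theta, solved for one factor; the four primes may come in any
  order.\<close>

lemma cls_last:
  assumes m: "mg = q1 * (q2 * q3) * q4"
    and q: "prime (gnorm q1)" "prime (gnorm q2)" "prime (gnorm q3)" "prime (gnorm q4)"
    and G: "cl q1 \<in> gens G" "cl q2 \<in> gens G" "cl q3 \<in> gens G"
  shows "cl q4 \<in> gens G"
proof (rule cls_cancel[of "q1 * (q2 * q3)"])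
  show r: "ramdiv (q1 * (q2 * q3) * q4)" unfolding m[symmetric] by (rule nat_ramdiv) simp
  show "bezout (q1 * (q2 * q3)) q4"
    using prime_ramdiv_bezout[OF q(4), of "q1 * (q2 * q3)"] r by (simp add: bezout_commute mult.commute)
  show "cl (q1 * (q2 * q3) * q4) = cls R R" unfolding m[symmetric] by (rule cls_Ic_m)
  show "cl (q1 * (q2 * q3)) \<in> gens G"
    by (rule cls_Ic_in_subgroup[of "[q1, q2, q3]"])
      (use q G ramdiv_dvd_trans[OF r] in \<open>auto simp: mult.assoc\<close>)
qed

lemma m_not_square: "(s::nat)^2 \<noteq> m"
proof
  assume s: "s^2 = m"
  then have "p1 dvd s^2" by (simp add: m_def)
  then have "p1 dvd s" using p1 prime_dvd_power by blast
  then obtain k where "s = p1 * k" by (rule dvdE)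
  then have "p1 * (p1 * k^2) = p1 * p2" using s by (simp add: m_def power2_eq_square mult_ac)
  then have "p1 * k^2 = p2" using p1 by (metis mult_cancel_left not_prime_0)
  then have "p1 dvd p2" by (metis dvd_triv_left)
  with p_not_dvd show False by blast
qed

lemma two_not_square: "(s::nat)^2 \<noteq> 2"
proof
  assume "s^2 = 2"
  moreover have "s \<le> 1 \<or> 2 \<le> s" by linarith
  moreover have "2 * 2 \<le> s * s" if "2 \<le> s" using that by (intro mult_le_mono) auto
  moreover have "s * s \<le> 1 * 1" if "s \<le> 1" using that by (intro mult_le_mono) auto
  ultimately show False by (auto simp: power2_eq_square)
qed

sublocale k3: rat_quad "2 * m"
  using two_m_not_square by unfold_locales

sublocale k1: rat_quad 2
  using two_not_square by unfold_locales

sublocale k2: rat_quad m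
  using m_not_square by unfold_locales

lemma k3_subset_E: "k3.E \<subseteq> E"
proof (rule k3.E_least[OF is_subfield_E subfield_Rats[OF is_subfield_E]])
  have "(1 + \<i>) \<in> E" using F_subset_E by (auto simp: QI_def)
  then show "sm \<in> E" unfolding sqrt_eq using t_in_E by (rule E_mult_conj)
qed

lemma ze_eq_el: "k3.ze x y = el (of_int x) (of_int y * (1 + gi))"
  unfolding k3.ze_def sqrt_eq el_def by simp

text \<open>An integer a + b sqrt(2m) of the real field is an integer of k, and its coordinates
  there are a and b (1 + i). Both are Gaussian integers, and a, b are rational, hence
  integers.\<close>

lemma OK_k3: assumes "z \<in> OK k3.E" shows "\<exists>x y. z = k3.ze x y"
proof -
  have z: "z \<in> k3.E" "alg_int z" using assms by (simp_all add: OK_def)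
  obtain a b where ab: "a \<in> \<rat>" "b \<in> \<rat>" "z = a + b * sm" using z(1) by (rule k3.E_cases)
  have "z \<in> R" using z k3_subset_E by (auto simp: OK_def)
  then obtain X Y where XY: "z = el X Y" by (rule R_cases)
  have QI: "a \<in> QI" "b * (1 + \<i>) \<in> QI"
    using ab subfield_Rats[OF is_subfield_QI] by (auto intro!: is_subfieldD(5)[OF is_subfield_QI] simp: QI_def)
  have "gc X + gc Y * theta = a + (b * (1 + \<i>)) * theta"
    using XY ab(3) unfolding el_def sqrt_eq by (simp add: mult.assoc)
  then have eq: "gc X = a" "gc Y = b * (1 + \<i>)"
    using repr_unique[OF gc_in_QI gc_in_QI QI] by simp_all
  have "a \<in> \<int>" using alg_int_Rats_imp_Ints[OF alg_int_gc[of X]] ab(1) eq(1) by simp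
  moreover have "b \<in> \<int>"
  proof -
    obtain r where r: "b = of_rat r" using ab(2) by (auto elim: Rats_cases)
    have "Re (gc Y) \<in> \<int>" using gc[of Y] by simp
    then have "Re b \<in> \<int>" unfolding eq(2) r complex_of_rat by simp
    then obtain k where "Re b = of_int k" by (auto elim: Ints_cases)
    then have "b = of_int k" unfolding r complex_of_rat by (simp add: complex_eq_iff)
    then show ?thesis by simp
  qed
  ultimately obtain x y where "a = of_int x" "b = of_int y" by (auto elim!: Ints_cases)
  then show ?thesis using ab(3) unfolding k3.ze_def by blast
qed

section \<open>The relation given by a unit of norm -1\<close>

lemma ideal_eq_times:
  assumes v: "v \<in> R" "w \<in> R" and eq: "b = a * v" "a = b * w"
  shows "(*) a ` R = (*) b ` R"
proof -
  have sub: "(*) x ` R \<subseteq> (*) y ` R" if "w' \<in> R" "x = y * w'" for x y w'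
  proof
    fix z assume "z \<in> (*) x ` R"
    then obtain r where "r \<in> R" "z = y * (w' * r)" using \<open>x = y * w'\<close> by (auto simp: mult.assoc)
    then show "z \<in> (*) y ` R" using R_subring \<open>w' \<in> R\<close> by (auto simp: is_subring_def)
  qed
  show ?thesis using sub[OF v(1) eq(1)] sub[OF v(2) eq(2)] by blast
qed

lemma unit_or_prime_factor:
  assumes "\<forall>q\<in>set ps. prime (gnorm q)" "d dvd prod_list ps"
  shows "d dvd 1 \<or> (\<exists>q\<in>set ps. q dvd d)"
  using assms
proof (induction ps)
  case (Cons q ps)
  then have "d dvd q * prod_list ps" "prime (gnorm q)" by simp_all
  then consider c' where "d = q * c'" | "d dvd prod_list ps"
    using prime_gnorm_strip by metis
  then show ?case using Cons by cases auto
qed simp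

text \<open>A common nonunit divisor of c and its cofactor would contain a ramified prime, whose
  square would divide m (m + i).\<close>

lemma ramdiv_cofactor:
  assumes r: "ramdiv c" and w: "mg * (mg + gi) = c * w"
  shows "bezout c w"
proof -
  obtain d s t where d: "d = s * c + t * w" "d dvd c" "d dvd w" by (rule gint_gcd_exists)
  have rd: "ramdiv d" by (rule ramdiv_dvd_trans[OF r d(2)])
  have "d * d dvd c * w" using d(2,3) by (rule mult_dvd_mono)
  then have dd: "d * d dvd mg * (mg + gi)" unfolding w .
  have "d dvd prod_list [1 + gi, pi1, pi2, pi3, pi4]" using rd unfolding ramdiv_def prod_list_pi .
  moreover have "\<forall>q\<in>set [1 + gi, pi1, pi2, pi3, pi4]. prime (gnorm q)" using prime_gnorms by simp
  ultimately have "d dvd 1 \<or> (\<exists>q\<in>set [1 + gi, pi1, pi2, pi3, pi4]. q dvd d)"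
    by (intro unit_or_prime_factor)
  moreover have False if q: "q \<in> set [1 + gi, pi1, pi2, pi3, pi4]" "q dvd d" for q
  proof -
    have "prime (gnorm q)" using q(1) prime_gnorms by auto
    moreover have "ramdiv q" by (rule ramdiv_dvd_trans[OF rd q(2)])
    moreover have "q * q dvd mg * (mg + gi)" using mult_dvd_mono[OF q(2) q(2)] dd by (rule dvd_trans)
    ultimately show False using prime_square_not_dvd by blast
  qed
  ultimately have "d dvd 1" by blast
  then obtain u where "1 = d * u" by (rule dvdE)
  then have "(u * s) * c + (u * t) * w = 1" unfolding d(1) by (simp add: algebra_simps)
  then show ?thesis by (rule bezoutI)
qed

text \<open>For a = 1 + i ep the conjugate is a' = a (i ep'), because ep ep' = -1. So a R is
  invariant and equals t (Ic c). The product n = a a' = 2 (1 + i x) is shown to be associated to t^2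
  c, and norms are compared in Z[i].\<close>

lemma norm_minus_one_relation:
  assumes N: "x^2 - int (2 * m) * y^2 = -1"
  obtains c t where "ramdiv c" "cl c = cls R R" "gnorm c * (gnorm t)^2 = 4 * (1 + x^2)"
proof -
  define ep where "ep = k3.ze x y"
  define ep' where "ep' = k3.ze x (- y)"
  define a where "a = 1 + \<i> * ep"
  define a' where "a' = 1 + \<i> * ep'"
  have epep: "ep * ep' = -1" using k3.ze_norm[of x y] unfolding N k3.conj_ze ep_def ep'_def by simp
  have tr: "ep + ep' = 2 * of_int x" by (simp add: ep_def ep'_def k3.ze_def)
  have R': "ep \<in> R" "ep' \<in> R" unfolding ep_def ep'_def ze_eq_el by simp_all
  have iR: "\<i> \<in> R" using gc_in_R[of gi] by simp
  have mR: "v * w \<in> R" if "v \<in> R" "w \<in> R" for v w using R_subring that by (simp add: is_subring_def)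
  have v: "\<i> * ep \<in> R" "\<i> * ep' \<in> R" using R' iR mR by blast+
  have eq: "a' = a * (\<i> * ep')" "a = a' * (\<i> * ep)"
    unfolding a_def a'_def using epep by (simp_all add: algebra_simps)
  have aN: "a * a' = gc (2 + 2 * gi * of_int x)"
  proof -
    have "a * a' = 1 + \<i> * (ep + ep') - ep * ep'" by (simp add: a_def a'_def algebra_simps)
    then show ?thesis unfolding epep tr by simp
  qed
  have ael: "a = el (1 + gi * of_int x) (gi * (of_int y * (1 + gi)))"
    unfolding a_def ep_def ze_eq_el by (simp add: el_def algebra_simps)
  have a'el: "a' = el (1 + gi * of_int x) (- (gi * (of_int y * (1 + gi))))"
    unfolding a'_def ep'_def ze_eq_el by (simp add: el_def algebra_simps)
  have aa': "conj a = a'" unfolding ael conj_el a'el ..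
  have aR: "a \<in> R" unfolding ael by simp
  have N0: "2 + 2 * gi * of_int x \<noteq> 0"
  proof -
    have "2 + 2 * gi * of_int x = gcomplex 2 (2 * x)" by (simp add: gcomplex_eq mult_ac)
    then show ?thesis by simp
  qed
  have a0: "a \<noteq> 0"
  proof
    assume "a = 0"
    then have "gc (2 + 2 * gi * of_int x) = 0" using aN by (metis mult_zero_left)
    then show False using N0 by (simp only: gc_eq_0_iff)
  qed
  define I where "I = (*) a ` R"
  have I: "nz_ideal R I"
  proof -
    have "a * 1 \<in> I" unfolding I_def by (rule imageI) (use R_subring in \<open>simp add: is_subring_def\<close>)
    then show ?thesis using is_ideal_times[OF R_subring is_ideal_self[OF R_subring] aR] a0
      unfolding nz_ideal_def I_def by auto
  qed
  have RE: "z \<in> E" if "z \<in> R" for z using that by (simp add: OK_def)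
  have cR: "conj ` R = R"
  proof -
    have "Ic 1 = R" by (rule Ic_of_unit) simp
    moreover have "ramdiv 1" by (simp add: ramdiv_def)
    ultimately show ?thesis using conj_image_Ic[of 1] by simp
  qed
  have "conj ` I = (\<lambda>z. conj (a * z)) ` R" by (simp add: I_def image_image)
  also have "\<dots> = (\<lambda>z. a' * conj z) ` R"
    by (rule image_cong[OF refl]) (simp add: E_mult_conj(2) RE aR aa')
  also have "\<dots> = (*) a' ` (conj ` R)" by (simp add: image_image)
  also have "\<dots> = I" unfolding cR I_def using ideal_eq_times[OF v(2,1) eq] by simp
  finally have inv: "conj ` I = I" .
  obtain t c where tc: "t \<noteq> 0" "ramdiv c" "I = (*) (gc t) ` Ic c"
    by (rule invariant_ideal[OF I inv])
  have "cl c = cls R I" unfolding tc(3) using tc(1)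
    by (intro cls_times[symmetric] R_subring nz_ideal_Ic tc) simp_all
  also have "\<dots> = cls R R" unfolding I_def by (rule cls_principal[OF R_subring aR a0])
  finally have cl: "cl c = cls R R" .
  define n where "n = 2 + 2 * gi * of_int x"
  have aI: "a \<in> I" "a' \<in> I"
  proof -
    have "1 \<in> R" using R_subring by (simp add: is_subring_def)
    then show "a \<in> I" unfolding I_def by force
    show "a' \<in> I" unfolding I_def eq(1) using v by blast
  qed
  then obtain z1 z2 where z: "z1 \<in> Ic c" "z2 \<in> Ic c" "a = gc t * z1" "a' = gc t * z2" unfolding tc(3) by blast
  \<comment> \<open>Both a and a' lie in t (Ic c), so t^2 c divides their product n.\<close>
  obtain v where v': "v \<in> R" "z1 * z2 = gc c * v" using Ic_mult_Ic_dvd[OF tc(2) z(1,2)] .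
  obtain v1 v2 where v12: "v = el v1 v2" using v'(1) by (rule R_cases)
  have "gc n = (gc t * gc t) * (z1 * z2)" using aN z by (simp add: n_def mult_ac)
  also have "\<dots> = gc (t * t * c) * el v1 v2" unfolding v'(2) v12 by simp
  finally have "el n 0 = el (t * t * c * v1) (t * t * c * v2)" unfolding gc_mult_el el_gc .
  then have n1: "n = t * t * c * v1" by simp
  \<comment> \<open>Conversely, t^2 c is a combination of products of two elements of a R, hence a
    multiple of a^2, which is n times the unit i ep.\<close>
  obtain u w where uw: "gc c = gc u * (gc c * gc c) + gc w * (el mg 1 * el mg (-1))" "el mg (-1) \<in> Ic c"
    by (rule gc_in_Ic_square[OF tc(2) ramdiv_cofactor[OF tc(2)]])
  have inI: "\<exists>r\<in>R. gc t * z = a * r" if "z \<in> Ic c" for z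
    using that tc(3) unfolding I_def by blast
  obtain r1 where r1: "r1 \<in> R" "gc t * gc c = a * r1" using inI[OF gc_in_Ic] by blast
  obtain r2 where r2: "r2 \<in> R" "gc t * el mg 1 = a * r2" using inI[OF el_m_1_in_Ic] by blast
  obtain r3 where r3: "r3 \<in> R" "gc t * el mg (-1) = a * r3" using inI[OF uw(2)] by blast
  have "gc (t * t * c) = (gc t * gc t) * gc c" by simp
  also have "\<dots> = gc u * ((gc t * gc c) * (gc t * gc c)) + gc w * ((gc t * el mg 1) * (gc t * el mg (-1)))"
    by (subst uw(1)) (simp add: algebra_simps)
  also have "\<dots> = (a * a) * (gc u * (r1 * r1) + gc w * (r2 * r3))"
    unfolding r1 r2 r3 by (simp add: algebra_simps)
  also have "a * a = a * (a' * (\<i> * ep))" by (rule arg_cong[OF eq(2)])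
  also have "\<dots> = gc n * (\<i> * ep)" unfolding n_def aN[symmetric] by (simp only: mult.assoc)
  finally have 2: "gc (t * t * c) = gc n * ((\<i> * ep) * (gc u * (r1 * r1) + gc w * (r2 * r3)))"
    by (simp only: mult.assoc)
  have "(\<i> * ep) * (gc u * (r1 * r1) + gc w * (r2 * r3)) \<in> R"
    using R_subring \<open>\<i> * ep \<in> R\<close> r1(1) r2(1) r3(1) by (simp add: is_subring_def)
  then obtain s1 s2 where "(\<i> * ep) * (gc u * (r1 * r1) + gc w * (r2 * r3)) = el s1 s2" by (rule R_cases)
  then have "el (t * t * c) 0 = el (n * s1) (n * s2)" using 2 unfolding el_gc gc_mult_el[symmetric] by simp
  then have n2: "t * t * c = n * s1" by simp
  have "n * (s1 * v1) = (n * s1) * v1" by (simp only: mult.assoc)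
  also have "\<dots> = n * 1" unfolding n2[symmetric] n1[symmetric] by simp
  finally have "n * (s1 * v1) = n * 1" .
  then have "s1 * v1 = 1" using N0 unfolding n_def[symmetric] by (simp only: mult_cancel_left) blast
  then have "v1 dvd 1" by (metis dvd_triv_right)
  then have "gnorm v1 = 1" by (simp add: gnorm_unit_iff)
  then have "gnorm n = gnorm c * (gnorm t)^2" unfolding n1 by (simp add: gnorm_mult power2_eq_square)
  moreover have "n = gcomplex 2 (2 * x)" by (simp add: n_def gcomplex_eq mult_ac)
  then have "gnorm n = 4 * (1 + x^2)" by (simp add: power_mult_distrib)
  ultimately show ?thesis using tc(2) cl that by metis
qed

end

context biquad
begin

text \<open>The norm of c times a square is 4 (1 + x^2) = 2 p1 p2 (2 y)^2, so p2 has odd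
  multiplicity in the norm of c. If pi3 and pi4 both divided c this multiplicity would be 2, and if
  neither did it would be 0.\<close>

lemma norm_minus_one_H3:
  assumes N: "x^2 - int (2 * m) * y^2 = -1"
    and G: "cl (1 + gi) \<in> gens G" "cl pi1 \<in> gens G"
      "cl pi2 \<in> gens G"
  shows "cl pi3 \<in> gens G"
proof -
  obtain c t where c: "ramdiv c" "cl c = cls R R" "gnorm c * (gnorm t)^2 = 4 * (1 + x^2)"
    by (rule norm_minus_one_relation[OF N])
  have "y \<noteq> 0"
  proof
    assume "y = 0"
    then have "x^2 = -1" using N by simp
    then show False by (metis not_one_le_zero power2_less_0 zero_le_power2 neg_0_le_iff_le)
  qed
  have "1 + x^2 = int (2 * m) * y^2" using N by linarith
  then have eq: "int p2 * (2 * int p1) * (2 * y)^2 = gnorm c * (gnorm t)^2"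
    unfolding c(3) by (simp add: m_def power_mult_distrib)
  have nd2: "\<not> int p2 dvd 2"
  proof
    assume "int p2 dvd 2"
    then have "p2 dvd 2" by (metis int_dvd_int_iff of_nat_numeral)
    then have "p2 \<le> 2" by (rule dvd_imp_le) simp
    then show False using odd_primes(2) prime_ge_2_nat[OF p2] by (cases "p2 = 2") auto
  qed
  have nd1: "\<not> int p2 dvd int p1" using p_not_dvd(2) by simp
  have pp: "prime (int p2)" using p2 by simp
  have "\<not> int p2 dvd 2 * int p1" using nd1 nd2 pp prime_dvd_mult_iff by blast
  then have odd: "odd (multiplicity (int p2) (gnorm c))"
    using odd_multiplicity_if_square_ratio[OF pp _ eq] \<open>y \<noteq> 0\<close> by simp
  \<comment> \<open>\<open>B\<close> collects the ramified primes whose norm is coprime to p2; the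
    classes of all its divisors are already available.\<close>
  define B where "B = (1 + gi) * (pi1 * pi2)"
  have prod: "(1 + gi) * mg = pi4 * (pi3 * B)" unfolding of_nat_m B_def by (simp only: mult_ac)
  have nB: "\<not> int p2 dvd gnorm d" if "d dvd B" for d
  proof
    assume "int p2 dvd gnorm d"
    then have "int p2 dvd gnorm B" using gnorm_dvd[OF that] by (rule dvd_trans)
    then have "int p2 dvd 2 * (int p1 * int p1)" unfolding B_def gnorm_mult gnorms by simp
    then show False using nd1 nd2 pp prime_dvd_mult_iff by blast
  qed
  have clB: "cl d \<in> gens G" if "d dvd B" for d
  proof (rule cls_Ic_in_subgroup[of "[1 + gi, pi1, pi2]"])
    show "ramdiv (prod_list [1 + gi, pi1, pi2])"
      unfolding ramdiv_def of_nat_m by (simp add: mult.assoc dvd_mult_left)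
    show "d dvd prod_list [1 + gi, pi1, pi2]" using that by (simp add: B_def)
  qed (use G prime_gnorms in auto)
  have mult0: "multiplicity (int p2) (gnorm d) = 0" if "d dvd B" for d
    using nB[OF that] by (rule not_dvd_imp_multiplicity_0)
  have q_in: "cl q \<in> gens G" if "c = q * d" "d dvd B" "prime (gnorm q)" for q d
  proof (rule cls_cancel[of d q])
    show "ramdiv (d * q)" using c(1) that(1) by (simp add: mult.commute)
    show "cl (d * q) = cls R R" using c(2) that(1) by (simp add: mult.commute)
    have "ramdiv (q * d)" using c(1) that(1) by simp
    then show "bezout d q" using prime_ramdiv_bezout[OF that(3)] bezout_commute by blast
  qed (rule clB[OF that(2)])
  have "c dvd pi4 * (pi3 * B)" using c(1) unfolding ramdiv_def prod .
  then show ?thesis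
  proof (rule prime_gnorm_strip[OF prime_gnorms(4)])
    fix c' assume c': "c = pi4 * c'" "c' dvd pi3 * B"
    from c'(2) show ?thesis
    proof (rule prime_gnorm_strip[OF prime_gnorms(3)])
      fix d assume d: "c' = pi3 * d" "d dvd B"
      have "gnorm d \<noteq> 0" using nB[OF d(2)] by (metis dvd_0_right)
      have "gnorm c = int p2 * (int p2 * gnorm d)" unfolding c'(1) d(1) gnorm_mult gnorms ..
      moreover have "multiplicity (int p2) (int p2 * k) = Suc (multiplicity (int p2) k)" if "k \<noteq> 0" for k
        using that pp not_prime_unit[of "int p2"] p2 by (intro multiplicity_times_same) auto
      ultimately have "multiplicity (int p2) (gnorm c) = 2"
        using \<open>gnorm d \<noteq> 0\<close> mult0[OF d(2)] p2 by (simp del: gnorm_eq_0_iff)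
      with odd show ?thesis by simp
    next
      assume d: "c' dvd B"
      \<comment> \<open>Here c contains pi4 instead of pi3; the relation given by theta then passes
        from pi4 to pi3.\<close>
      have 4: "cl pi4 \<in> gens G" by (rule q_in[OF c'(1) d prime_gnorms(4)])
      have "mg = pi1 * (pi2 * pi4) * pi3" unfolding of_nat_m by (simp only: mult_ac)
      then show ?thesis by (rule cls_last) (use prime_gnorms G 4 in auto)
    qed
  next
    assume c3: "c dvd pi3 * B"
    then show ?thesis
    proof (rule prime_gnorm_strip[OF prime_gnorms(3)])
      fix d assume "c = pi3 * d" "d dvd B"
      then show ?thesis using q_in prime_gnorms(3) by blast
    next
      assume "c dvd B"
      with mult0[OF this] odd show ?thesis by simp
    qed
  qed
qed

text \<open>The generator is b = A r + t sqrt(2m), formally sqrt A times r sqrt A + t sqrt B. Since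
  A B = 2 m, its square is A times the unit x + y sqrt(2m), so z b in A R gives z in b R for every z
  in the ideal.\<close>

lemma cls_Ic_factor_trivial:
  assumes ep: "k3.ze x y * k3.ze x (- y) = 1" and xy: "x = A * r^2 + B * t^2" "y = 2 * r * t"
    and AB: "A * B = 2 * int m" and A: "of_int A dvd mg" "A \<noteq> 0"
  shows "cl (of_int A) = cls R R"
proof -
  define b where "b = k3.ze (A * r) t"
  define ep where "ep = k3.ze x y"
  define ep' where "ep' = k3.ze x (- y)"
  have ee: "ep * ep' = 1" using assms(1) by (simp add: ep_def ep'_def)
  have R': "ep \<in> R" "ep' \<in> R" "b \<in> R" unfolding ep_def ep'_def b_def ze_eq_el by simp_all
  have e: "int (2 * m) = A * B" using AB by simp
  have "(A * r) * (A * r) + A * B * (t * t) = A * x" "(A * r) * t + (A * r) * t = A * y"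
    unfolding xy by (simp_all add: power2_eq_square algebra_simps)
  then have "b * b = k3.ze (A * x) (A * y)" unfolding b_def k3.ze_mult e by (simp only:)
  also have "\<dots> = gc (of_int A) * ep"
    by (simp only: ep_def k3.ze_def distrib_left mult.assoc of_int_mult gc_of_int)
  finally have bb: "b * b = gc (of_int A) * ep" .
  have b0: "b \<noteq> 0"
  proof
    assume "b = 0"
    then have "of_int A * ep = 0" using bb by simp
    then have "ep = 0" using A(2) by simp
    then show False using ee by simp
  qed
  have rA: "ramdiv (of_int A)" using A(1) by (rule nat_ramdiv)
  have "(of_int A :: gint) dvd of_int (A * r) - mg * (of_int t * (1 + gi))"
    using A(1) by simp
  then have bI: "b \<in> Ic (of_int A)" unfolding b_def ze_eq_el el_in_Ic .
  have "Ic (of_int A) = (*) b ` R"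
  proof (intro equalityI subsetI)
    fix z assume z: "z \<in> Ic (of_int A)"
    obtain v where v: "v \<in> R" "b * z = gc (of_int A) * v" by (rule Ic_mult_Ic_dvd[OF rA bI z])
    have "b * (b * (ep' * v)) = (b * b) * ep' * v" by (simp only: mult.assoc)
    also have "\<dots> = gc (of_int A) * (ep * ep') * v" unfolding bb by (simp only: mult.assoc)
    also have "\<dots> = b * z" unfolding ee v(2) by simp
    finally have "z = b * (ep' * v)" using b0 by simp
    moreover have "ep' * v \<in> R" using R_subring R'(2) v(1) by (simp add: is_subring_def)
    ultimately show "z \<in> (*) b ` R" by blast
  next
    fix z assume "z \<in> (*) b ` R"
    then obtain w where "w \<in> R" "z = w * b" by (auto simp: mult.commute)
    then show "z \<in> Ic (of_int A)"
      using is_idealD(4)[OF is_ideal_Ic[OF ramdiv_dvd(1)[OF rA]] _ bI] by simp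
  qed
  then show ?thesis using cls_principal[OF R_subring R'(3) b0] by simp
qed

section \<open>The square root of the fundamental unit and the unit index\<close>

abbreviation "s2 \<equiv> csqrt_nat 2"

lemma sqrt2_notin_k3: "s2 \<notin> k3.E"
proof
  assume "s2 \<in> k3.E"
  then obtain a b where ab: "a \<in> \<rat>" "b \<in> \<rat>" "s2 = a + b * sm" by (rule k3.E_cases)
  have "s2 * s2 = (a * a + b * b * (sm * sm)) + (2 * a * b) * sm"
    unfolding ab(3) by (simp add: algebra_simps)
  then have eq: "2 + 0 * sm = (a * a + b * b * of_nat (2 * m)) + (2 * a * b) * sm"
    unfolding csqrt_nat_squared by simp
  have "2 * a * b = 0" using k3.repr_unique[OF _ _ _ _ eq] ab(1,2) by simp
  then consider "b = 0" | "a = 0" by auto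
  then show False
  proof cases
    case 1
    then have "s2 \<in> \<rat>" using ab by simp
    then show False using k1.t_notin by blast
  next
    case 2
    have "csqrt_nat m * s2 = sm" by (simp add: csqrt_nat_mult)
    then have "s2 = (b * csqrt_nat m) * s2" using ab(3) 2 by (simp add: mult_ac)
    moreover have "s2 \<noteq> 0" using k1.t_notin by auto
    ultimately have "b * csqrt_nat m = 1" by (metis mult_cancel_right2)
    then have "csqrt_nat m = inverse b" by (metis inverse_unique)
    then have "csqrt_nat m \<in> \<rat>" using ab(2) by simp
    then show False using k2.t_notin by blast
  qed
qed

text \<open>The conjugation of Q(sqrt 2, sqrt m) over Q(sqrt(2m)) negates both sqrt 2 and sqrt m, so
  it restricts to the nontrivial automorphism of each of the other two quadratic subfields.\<close>

sublocale kk: quad_ext k3.E s2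
proof
  show "s2 * s2 \<in> k3.E" unfolding csqrt_nat_squared using k3.F_subset_E by auto
qed (rule k3.is_subfield_E sqrt2_notin_k3)+

lemma sqrt_m_eq: "csqrt_nat m = (sm / 2) * s2"
proof -
  have "sm * s2 = csqrt_nat m * (s2 * s2)" by (simp add: csqrt_nat_mult mult_ac)
  then show ?thesis unfolding csqrt_nat_squared by simp
qed

lemma kk_conj_k1: "a \<in> k1.E \<Longrightarrow> a \<in> kk.E \<and> kk.conj a = k1.conj a"
proof (elim k1.E_cases)
  fix x y assume "x \<in> \<rat>" "y \<in> \<rat>" and a: "a = x + y * s2"
  then have "x \<in> k3.E" "y \<in> k3.E" using k3.F_subset_E by auto
  then show ?thesis unfolding a using \<open>x \<in> \<rat>\<close> \<open>y \<in> \<rat>\<close> by (simp add: kk.E_I kk.conj_eq k1.conj_eq)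
qed

lemma kk_conj_k2: "a \<in> k2.E \<Longrightarrow> a \<in> kk.E \<and> kk.conj a = k2.conj a"
proof (elim k2.E_cases)
  fix x y assume xy: "x \<in> \<rat>" "y \<in> \<rat>" and a: "a = x + y * csqrt_nat m"
  have F: "x \<in> k3.E" "y * (sm / 2) \<in> k3.E"
    using xy k3.F_subset_E k3.t_in_E
    by (auto intro!: is_subfieldD(5,8)[OF k3.is_subfield_E])
  have a': "a = x + (y * (sm / 2)) * s2" unfolding a sqrt_m_eq by (simp only: mult.assoc)
  have "k2.conj a = x - (y * (sm / 2)) * s2"
    unfolding a k2.conj_eq[OF xy] unfolding sqrt_m_eq by (simp only: mult.assoc)
  then show ?thesis unfolding a' using kk.E_I[OF F] kk.conj_eq[OF F] by simp
qed

text \<open>Relative norms to Q(sqrt(2m)): \<open>eta\<close> has norm -ep, the factors a and b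
  contribute their rational norms 1 or -1, and c contributes c^2.\<close>

lemma k3_unit_not_square_times_unit_squares:
  assumes eta: "eta * eta = ep" "eta \<in> kk.E" "kk.conj eta = - eta"
    and abc: "eta = a * b * c" "a \<in> units_OK k1.E" "b \<in> units_OK k2.E" "c \<in> units_OK k3.E"
  shows "ep = c * c \<or> ep = - (c * c)"
proof -
  have E: "a \<in> k1.E" "b \<in> k2.E" "c \<in> k3.E" using abc by (auto simp: units_OK_def OK_def)
  have c: "c \<in> kk.E" "kk.conj c = c" using E(3) kk.F_subset_E kk.conj_F by auto
  note ab = kk_conj_k1[OF E(1)] kk_conj_k2[OF E(2)]
  have "eta * kk.conj eta = (a * kk.conj a) * (b * kk.conj b) * (c * c)"
    unfolding abc(1) using ab c by (simp add: kk.E_mult_conj mult_ac)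
  then have "- ep = (a * k1.conj a) * (b * k2.conj b) * (c * c)" using eta ab by simp
  moreover have "a * k1.conj a = 1 \<or> a * k1.conj a = -1" "b * k2.conj b = 1 \<or> b * k2.conj b = -1"
    using k1.norm_unit k2.norm_unit abc by blast+
  ultimately have "- ep = c * c \<or> - ep = - (c * c)" by (elim disjE) simp_all
  then show ?thesis by (metis minus_minus)
qed

text \<open>With a single coset, the coset of u is the coset of 1, which contains u.\<close>

lemma unit_index_one:
  assumes Q: "unit_index K K1 K2 K3 = 1" and K: "is_subfield K" "is_subfield K1" "is_subfield K2" "is_subfield K3"
    and u: "u \<in> units_OK K"
  obtains a b c where "a \<in> units_OK K1" "b \<in> units_OK K2" "c \<in> units_OK K3" "u = a * b * c"
proof -
  define H where "H = {a * b * c | a b c. a \<in> units_OK K1 \<and> b \<in> units_OK K2 \<and> c \<in> units_OK K3}"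
  have one: "1 \<in> units_OK F" if "is_subfield F" for F
    using is_subring_OK[OF that] by (intro units_OK_I[of _ _ 1]) (auto simp: is_subring_def)
  have "card {(*) u ` H | u. u \<in> units_OK K} = 1"
    using Q unfolding unit_index_def H_def Let_def .
  then obtain X where X: "{(*) u ` H | u. u \<in> units_OK K} = {X}" by (auto simp: card_1_singleton_iff)
  have "(*) 1 ` H \<in> {X}" "(*) u ` H \<in> {X}" unfolding X[symmetric] using one[OF K(1)] u by blast+
  then have eq: "(*) u ` H = H" by simp
  have "1 * 1 * 1 \<in> H" unfolding H_def using one K by blast
  then have "u * 1 \<in> (*) u ` H" by (intro imageI) simp
  then have "u \<in> H" unfolding eq by simp
  then show ?thesis using that unfolding H_def by blast
qed

text \<open>Of the four shapes given by the descent, A = 1 makes the fundamental unit a square,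
  against its minimality, and A = 2 puts its square root into the biquadratic field, against index
  1. The shapes A = p1 and A = p2 give the two relations.\<close>

lemma norm_one_Q_one:
  assumes fu: "0 < x" "0 < y" "Re (k3.ze x y) > 1"
      "\<And>v. v \<in> units_OK k3.E \<Longrightarrow> Re v > 1 \<Longrightarrow> Re (k3.ze x y) \<le> Re v"
    and N: "x^2 - int (2 * m) * y^2 = 1"
    and Q: "unit_index (field_gen {s2, csqrt_nat m}) k1.E k2.E k3.E = 1"
  shows "cl (pi1 * pi2) = cls R R \<or> cl (pi3 * pi4) = cls R R"
proof -
  define ep where "ep = k3.ze x y"
  have Imep: "Im ep = 0" and Reep: "Re ep > 1" using fu(3) by (simp_all add: ep_def k3.Im_ze)
  \<comment> \<open>A square root c satisfies 1 < |c| < ep, so c or -c would be a unit above 1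
    smaller than the fundamental unit.\<close>
  have no_root: False if c: "c \<in> units_OK k3.E" and sq: "ep = c * c" for c
  proof -
    have Imc: "Im c = 0" using c k3.Im_E by (auto simp: units_OK_def OK_def)
    have "- c \<in> units_OK k3.E"
      using c is_subring_uminus[OF is_subring_OK[OF k3.is_subfield_E]] by (simp add: units_OK_def)
    then have min: "Re c > 1 \<Longrightarrow> Re ep \<le> Re c" "- Re c > 1 \<Longrightarrow> Re ep \<le> - Re c"
      using fu(4)[of c] fu(4)[of "- c"] c by (simp_all add: ep_def)
    have Re: "Re ep = Re c * Re c" unfolding sq using Imc by simp
    define r where "r = \<bar>Re c\<bar>"
    have r: "Re ep = r * r" "r \<ge> 0" unfolding Re r_def by simp_all
    have "r > 1"
    proof (rule ccontr)
      assume "\<not> r > 1"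
      then have "r * r \<le> 1 * 1" using r(2) by (intro mult_mono) auto
      then show False using Reep r(1) by simp
    qed
    then have "Re ep \<le> r" using min by (auto simp: r_def abs_if split: if_splits)
    moreover have "r * 1 < r * r" using \<open>r > 1\<close> by (intro mult_strict_left_mono) auto
    ultimately show False using r(1) by simp
  qed
  define X Y where "X = nat x" and "Y = nat y"
  have XY: "x = int X" "y = int Y" "0 < Y" using fu(1,2) by (simp_all add: X_def Y_def)
  have "int (X^2) = int (2 * (p1 * p2) * Y^2 + 1)" using N unfolding XY by (simp add: m_def)
  then have XYN: "X^2 = 2 * (p1 * p2) * Y^2 + 1" by (simp only: of_nat_eq_iff)
  obtain A B r t where AB: "(A, B) \<in> {(1, 2 * (p1 * p2)), (2, p1 * p2), (p1, 2 * p2), (p2, 2 * p1)}"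
    and rt: "X = A * r^2 + B * t^2" "Y = 2 * r * t" and d: "A * r^2 = B * t^2 + 1 \<or> B * t^2 = A * r^2 + 1"
    by (rule norm_one_descent[OF p1 p2 odd_primes XYN XY(3)])
  have rt0: "r > 0" "t > 0" using rt(2) XY(3) by (auto intro: Nat.gr0I)
  have ez: "k3.ze x y * k3.ze x (- y) = 1" using k3.ze_norm[of x y] unfolding N k3.conj_ze by simp
  have rt': "x = int A * (int r)^2 + int B * (int t)^2" "y = 2 * int r * int t" unfolding XY rt by simp_all
  have d': "int A * (int r)^2 - int B * (int t)^2 = 1 \<or> int A * (int r)^2 - int B * (int t)^2 = -1"
  proof -
    have "int (A * r^2) = int (B * t^2 + 1) \<or> int (B * t^2) = int (A * r^2 + 1)" using d by (simp only: of_nat_eq_iff)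
    then show ?thesis by auto
  qed
  have triv: "cl (of_int (int A)) = cls R R" if "A * B = 2 * m" "A dvd m" "A > 0"
  proof (rule cls_Ic_factor_trivial[OF ez rt'])
    show "int A * int B = 2 * int m" using that(1) by (metis of_nat_mult of_nat_numeral)
    show "of_int (int A) dvd mg" using that(2) by (auto elim!: dvdE)
  qed (use that in simp)
  from AB consider "A = 1" "B = 2 * m" | "A = 2" "B = m" | "A = p1" "B = 2 * p2" | "A = p2" "B = 2 * p1"
    by (auto simp: m_def)
  then show ?thesis
  proof cases
    case 1
    have "k3.ze (int r) (int t) * k3.ze (int r) (int t) = ep"
      unfolding ep_def k3.ze_mult rt' 1 by (simp add: power2_eq_square mult_ac)
    moreover have "k3.ze (int r) (int t) \<in> units_OK k3.E"
      using d' unfolding 1 by (intro k3.ze_unit) simp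
    ultimately have False using no_root by metis
    then show ?thesis ..
  next
    case 2
    let ?K = "field_gen {s2, csqrt_nat m}"
    \<comment> \<open>For A = 2 and B = m this is the square root r sqrt A + t sqrt B of the
      unit.\<close>
    define eta where "eta = of_nat r * s2 + of_nat t * csqrt_nat m"
    define eta' where "eta' = of_nat r * s2 - of_nat t * csqrt_nat m"
    have s2m: "s2 * csqrt_nat m = sm" by (simp add: csqrt_nat_mult)
    have "eta * eta = of_nat r * of_nat r * (s2 * s2) + of_nat t * of_nat t * (csqrt_nat m * csqrt_nat m)
        + of_nat (2 * r * t) * (s2 * csqrt_nat m)"
      by (simp add: eta_def algebra_simps)
    also have "\<dots> = ep"
      unfolding csqrt_nat_squared s2m ep_def k3.ze_def rt' 2 by (simp add: power2_eq_square)
    finally have ee: "eta * eta = ep" .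
    have "eta * eta' = of_nat r * of_nat r * (s2 * s2) - of_nat t * of_nat t * (csqrt_nat m * csqrt_nat m)"
      by (simp add: eta_def eta'_def algebra_simps)
    also have "\<dots> = of_int (int A * (int r)^2 - int B * (int t)^2)"
      unfolding csqrt_nat_squared 2 by (simp add: power2_eq_square)
    finally have "eta * eta' = 1 \<or> eta * eta' = -1" using d' by (elim disjE) simp_all
    then have "eta * eta' = 1 \<or> eta * (- eta') = 1" by auto
    moreover have F: "s2 \<in> ?K" "csqrt_nat m \<in> ?K" using field_gen_superset[of "{s2, csqrt_nat m}"] by auto
    have nK: "of_nat k \<in> ?K" for k using subfield_of_int[OF is_subfield_field_gen, of "int k" "{s2, csqrt_nat m}"] by simp
    note D = is_subfieldD[OF is_subfield_field_gen[of "{s2, csqrt_nat m}"]]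
    have "eta \<in> ?K" "eta' \<in> ?K" unfolding eta_def eta'_def by (intro D(3,4,5) F nK)+
    then have "eta \<in> OK ?K" "eta' \<in> OK ?K"
      unfolding OK_def by (auto simp: eta_def eta'_def intro!: alg_int_add alg_int_diff alg_int_mult alg_int_csqrt_nat)
    moreover from this have "- eta' \<in> OK ?K" using is_subring_uminus[OF is_subring_OK[OF is_subfield_field_gen]] by blast
    ultimately have u: "eta \<in> units_OK ?K" using units_OK_I by blast
    have F3: "of_nat r + of_nat t * (sm / 2) \<in> k3.E"
      using k3.t_in_E k3.F_subset_E by (auto intro!: is_subfieldD(3,5,8)[OF k3.is_subfield_E])
    have ek: "eta = 0 + (of_nat r + of_nat t * (sm / 2)) * s2"
      unfolding eta_def sqrt_m_eq by (simp add: algebra_simps)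
    have "0 \<in> k3.E" using k3.F_subset_E by auto
    then have "eta \<in> kk.E" "kk.conj eta = - eta"
      unfolding ek by (rule kk.E_I[OF _ F3], subst kk.conj_eq[OF _ F3]) simp_all
    moreover obtain a b c where abc: "a \<in> units_OK k1.E" "b \<in> units_OK k2.E" "c \<in> units_OK k3.E" "eta = a * b * c"
      by (rule unit_index_one[OF Q is_subfield_field_gen k1.is_subfield_E k2.is_subfield_E k3.is_subfield_E u])
    ultimately have "ep = c * c \<or> ep = - (c * c)"
      using k3_unit_not_square_times_unit_squares[OF ee] by blast
    \<comment> \<open>The field is real, so -c^2 is not positive.\<close>
    moreover have "ep \<noteq> - (c * c)"
    proof
      assume "ep = - (c * c)"
      moreover have "Im c = 0" using abc(3) k3.Im_E by (auto simp: units_OK_def OK_def)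
      ultimately have "Re ep = - (Re c * Re c)" by simp
      then show False using Reep zero_le_square[of "Re c"] by linarith
    qed
    ultimately show ?thesis using no_root[OF abc(3)] by blast
  next
    case 3
    then have "cl (of_int (int A)) = cls R R" using prime_gt_0_nat[OF p1] by (intro triv) (simp_all add: m_def)
    then show ?thesis unfolding pi12 3 by simp
  next
    case 4
    then have "cl (of_int (int A)) = cls R R" using prime_gt_0_nat[OF p2] by (intro triv) (simp_all add: m_def)
    then show ?thesis unfolding pi34 4 by simp
  qed
qed

end

section \<open>Capitulation in the genus field\<close>

context zi_quad
begin

text \<open>If z lies in \<open>Ic q\<close>, then z^2 lies in q R, so (z / b)^2 and therefore z / b
  is integral. Hence b divides the extended ideal; that b also belongs to it follows from the
  expression of q through products of two elements of \<open>Ic q\<close>.\<close>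

lemma Ic_extension_principal:
  assumes L: "is_subfield L" "E \<subseteq> L" and q: "prime (gnorm q)" "ramdiv q"
    and b: "b \<in> L" "u \<in> units_OK L" "b * b = u * gc q"
  shows "principal (OK L) (gen_ideal (OK L) (Ic q))"
proof -
  note S = is_subring_OK[OF L(1)]
  have RS: "R \<subseteq> OK L" by (rule OK_mono[OF L(2)])
  have IS: "Ic q \<subseteq> OK L" using Ic_subset RS by blast
  have q0: "gc q \<noteq> 0" using q(1) not_prime_0 gnorm_eq_0_iff gc_eq_0_iff by metis
  note u = units_OK_D[OF b(2)]
  have "alg_int (b^2)"
    unfolding power2_eq_square b(3) using u(1) by (intro alg_int_mult alg_int_gc) (simp add: OK_def)
  then have bS: "b \<in> OK L" using b(1) alg_int_if_power2 by (simp add: OK_def)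
  have b0: "b \<noteq> 0" using b(3) u(2) q0 by auto
  have quot: "z / b \<in> OK L" if z: "z \<in> Ic q" for z
  proof -
    obtain v where v: "v \<in> R" "z * z = gc q * v" by (rule Ic_mult_Ic_dvd[OF q(2) z z])
    have "(z / b)^2 = (z * z) / (b * b)" by (simp add: power2_eq_square)
    also have "\<dots> = v * inverse u" unfolding v(2) b(3) using q0 u(2) by (simp add: field_simps)
    also have "alg_int \<dots>" using v(1) u(3) by (auto simp: OK_def intro: alg_int_mult)
    finally have "alg_int (z / b)" by (rule alg_int_if_power2)
    moreover have "z \<in> L" using z IS by (auto simp: OK_def)
    ultimately show ?thesis using is_subfieldD(8)[OF L(1)] b(1) by (simp add: OK_def)
  qed
  let ?J = "gen_ideal (OK L) (Ic q)"
  have J: "is_ideal (OK L) ?J" by (rule is_ideal_gen_ideal[OF S IS])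
  have mem: "r * z \<in> ?J" if "r \<in> OK L" "z \<in> Ic q" for r z
    by (rule is_idealD(4)[OF J that(1)]) (rule gen_ideal_superset[THEN subsetD, OF that(2)])
  have "?J = (*) b ` OK L"
  proof
    show "?J \<subseteq> (*) b ` OK L"
    proof (rule gen_ideal_least[OF is_ideal_times[OF S is_ideal_self[OF S] bS]])
      show "Ic q \<subseteq> (*) b ` OK L"
      proof
        fix z assume "z \<in> Ic q"
        then have "z = b * (z / b)" "z / b \<in> OK L" using b0 quot by simp_all
        then show "z \<in> (*) b ` OK L" by blast
      qed
    qed
    obtain c w where cw: "gc q = gc c * (gc q * gc q) + gc w * (el mg 1 * el mg (-1))" "el mg (-1) \<in> Ic q"
      by (rule gc_in_Ic_square[OF q(2) prime_ramdiv_cofactor[OF q]])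
    \<comment> \<open>In each product that makes up q, one factor is divided by b and stays
      integral, while the other remains in the ideal.\<close>
    have "b = u * gc q / b" using b(3) b0 by (simp add: field_simps)
    also have "\<dots> = u * ((gc c * (gc q / b)) * gc q + (gc w * (el mg 1 / b)) * el mg (-1))"
      by (subst cw(1)) (use b0 in \<open>simp add: field_simps\<close>)
    finally have b_eq: "b = u * ((gc c * (gc q / b)) * gc q + (gc w * (el mg 1 / b)) * el mg (-1))" .
    have gS: "gc x \<in> OK L" for x using RS gc_in_R by blast
    have mS: "x * y \<in> OK L" if "x \<in> OK L" "y \<in> OK L" for x y using S that by (simp add: is_subring_def)
    have "u * ((gc c * (gc q / b)) * gc q + (gc w * (el mg 1 / b)) * el mg (-1)) \<in> ?J"
      by (intro is_idealD(4)[OF J u(1)] is_idealD(3)[OF J] mem mS gS quot gc_in_Ic el_m_1_in_Ic cw(2))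
    then have "b \<in> ?J" using b_eq by simp
    then show "(*) b ` OK L \<subseteq> ?J" using is_idealD(4)[OF J] by (auto simp: mult.commute[of b])
  qed
  then show ?thesis unfolding principal_iff[OF S] using bS by blast
qed

end

text \<open>In the solution of X^2 = p Y^2 + 1 with least Y > 0, X = 2 v + 1 and v (v + 1) = p w^2.
  If p divides v + 1, then v and (v + 1) / p are squares, which solves the negative equation; if p
  divides v, a smaller solution appears.\<close>

lemma negative_pell_solvable:
  fixes p :: nat
  assumes p: "prime p" and p4: "p mod 4 = 1"
  obtains x y :: nat where "x^2 + 1 = p * y^2"
proof -
  have nsq: "s^2 \<noteq> p" for s :: nat
  proof
    assume "s^2 = p"
    with p have "prime (s * s)" by (simp add: power2_eq_square)
    then show False by (metis not_prime_1 prime_product mult_1)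
  qed
  obtain X0 Y0 where "X0^2 - int p * Y0^2 = 1" "0 < X0" "0 < Y0"
    by (rule pell_equation_solvable[OF nsq])
  then have "int ((nat X0)^2) = int (p * (nat Y0)^2 + 1)" "0 < nat Y0" by simp_all
  then have "\<exists>Y. 0 < Y \<and> (\<exists>X. X^2 = p * Y^2 + 1)" unfolding of_nat_eq_iff by blast
  then obtain Y where Y: "0 < Y" "\<exists>X. X^2 = p * Y^2 + 1"
    and least: "\<And>Z. Z < Y \<Longrightarrow> \<not> (0 < Z \<and> (\<exists>X. X^2 = p * Z^2 + 1))"
    using exists_least_iff[of "\<lambda>Y. 0 < Y \<and> (\<exists>X. X^2 = p * Y^2 + 1)"] by blast
  then obtain X where X: "X^2 = p * Y^2 + 1" by blast
  obtain k where k: "p = 4 * k + 1" using p4 by (metis mult_div_mod_eq)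
  \<comment> \<open>For even X the number Y is odd, and p Y^2 + 1 is 2 modulo 4.\<close>
  have "odd X"
  proof
    assume "even X"
    then obtain a where a: "X = 2 * a" by (rule evenE)
    have "odd (p * Y^2)" using X unfolding a by (metis dvd_triv_left even_Suc Suc_eq_plus1 power2_eq_square mult.assoc)
    then have "odd Y" by simp
    then obtain b where b: "Y = 2 * b + 1" by (rule oddE)
    have "4 * (a * a) = 4 * (k * (Y * Y) + b * b + b) + 2"
      using X unfolding a k b by (simp add: power2_eq_square algebra_simps)
    then show False by presburger
  qed
  then obtain v where v: "X = 2 * v + 1" by (rule oddE)
  have vY: "4 * (v * (v + 1)) = p * Y^2" using X unfolding v by (simp add: power2_eq_square algebra_simps)
  then have "even (p * Y^2)" by (metis dvd_mult2 even_numeral)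
  moreover have "odd p" unfolding k by simp
  ultimately have "even Y" by simp
  then obtain w where w: "Y = 2 * w" by (rule evenE)
  have eq: "(v + 1) * v = p * w^2" using vY unfolding w by (simp add: power2_eq_square algebra_simps)
  have cop: "coprime (v + 1) v" by simp
  from eq show thesis
  proof (rule coprime_mult_prime_cases[OF p])
    fix u' assume u': "v + 1 = p * u'" "u' * v = w^2"
    have "coprime (p * u') v" using cop unfolding u'(1) .
    then have "coprime u' v" by simp
    then obtain r t where "u' = r^2" "v = t^2" "w = r * t"
      using u'(2) by (rule coprime_mult_square_nat)
    then have "t^2 + 1 = p * r^2" using u'(1) by simp
    then show thesis by (rule that)
  next
    fix v' assume v': "v = p * v'" "(v + 1) * v' = w^2"
    have "coprime (v + 1) (p * v')" using cop by (simp only: v'(1)[symmetric])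
    then have "coprime (v + 1) v'" by simp
    then obtain r t where rt: "v + 1 = r^2" "v' = t^2" "w = r * t"
      using v'(2) by (rule coprime_mult_square_nat)
    \<comment> \<open>This solution has t <= w < Y, against the choice of Y.\<close>
    have 1: "r^2 = p * t^2 + 1" using rt(1,2) v'(1) by simp
    have "w > 0" using Y(1) w by simp
    then have rt0: "0 < t" "0 < r" using rt(3) by (auto intro: Nat.gr0I)
    have "t \<le> w" unfolding rt(3) using rt0 by simp
    then have "t < Y" using w \<open>w > 0\<close> by simp
    with least[of t] rt0 1 show thesis by blast
  qed
qed

text \<open>For even x, w = 1 + i x is prime to 1 + i and has w + cnj w = 2, so w is coprime to its
  conjugate. Cancelling p = q cnj q from w cnj w = p y^2 leaves y^2 as the product of w / q and its
  conjugate, so w / q is a square up to a unit.\<close>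

lemma bezout_square_norm:
  assumes pi: "prime (gnorm q)" and q: "q * gcnj q = of_nat p" and dvd: "q dvd 1 + gi * of_int x"
    and x: "even x" and xy: "1 + x^2 = int p * y^2"
  obtains e d where "e dvd 1" "d \<noteq> 0" "1 + gi * of_int x = q * e * d^2"
proof -
  define w where "w = 1 + gi * of_int x"
  have wg: "w = gcomplex 1 x" by (simp add: w_def gcomplex_eq)
  have ww: "w * gcnj w = of_nat p * (of_int y)^2"
  proof -
    have "w * gcnj w = of_int (1 + x^2)" unfolding mult_gcnj wg by simp
    also have "\<dots> = of_nat p * (of_int y)^2" unfolding xy by simp
    finally show ?thesis .
  qed
  have "\<not> 1 + gi dvd w" unfolding wg one_plus_gi_dvd_iff using x by simp
  then have "bezout w (1 + gi)" using bezout_one_plus_gi bezout_commute by blast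
  then have "bezout w ((1 + gi) * (1 + gi))" using bezout_mult by blast
  then obtain u v where "u * w + v * (2 * gi) = 1" unfolding one_plus_gi_squared bezout_def by blast
  moreover have "w + gcnj w = 2" unfolding wg gcomplex_simps using of_int_gcomplex[of 2] by simp
  ultimately have "(u + v * gi) * w + (v * gi) * gcnj w = 1" by (simp add: algebra_simps)
      (metis distrib_left mult.commute)
  then have bw: "bezout w (gcnj w)" by (rule bezoutI)
  obtain w1 where w1: "w = q * w1" using dvd unfolding w_def[symmetric] by (rule dvdE)
  have p0: "(of_nat p :: gint) \<noteq> 0"
    using pi q by (metis gnorm_eq_0_iff mult_gcnj not_prime_0 of_int_eq_0_iff gc_of_int gc_eq_0_iff)
  have "of_nat p * (w1 * gcnj w1) = w * gcnj w"
    unfolding q[symmetric] w1 gcnj_mult by (simp only: mult_ac)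
  also note ww
  finally have "of_nat p * (w1 * gcnj w1) = of_nat p * (of_int y)^2" .
  then have sq: "w1 * gcnj w1 = (of_int y)^2" using p0 by (simp only: mult_cancel_left) blast
  have "bezout w1 (gcnj w)" by (rule bezout_dvd_left[OF bw]) (simp add: w1)
  then have "bezout (gcnj w) w1" by (simp add: bezout_commute)
  then have "bezout (gcnj w1) w1" by (rule bezout_dvd_left) (simp add: w1 gcnj_mult)
  then have b1: "bezout w1 (gcnj w1)" by (simp add: bezout_commute)
  have "w \<noteq> 0" unfolding wg by simp
  then have w10: "w1 \<noteq> 0" unfolding w1 by auto
  obtain e d where ed: "e dvd 1" "w1 = e * d^2" by (rule bezout_square_factor[OF b1 sq w10])
  have "d \<noteq> 0" using w10 ed(2) by auto
  moreover have "1 + gi * of_int x = q * e * d^2" using w1 ed(2) by (simp add: w_def mult.assoc)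
  ultimately show ?thesis using ed(1) that by blast
qed

lemma gc_in_subfield: assumes "is_subfield L" "\<i> \<in> L" shows "gc x \<in> L"
proof -
  have "QI \<subseteq> L" unfolding field_gen_ii[symmetric] using assms by (intro field_gen_least) auto
  then show ?thesis using gc_in_QI by blast
qed

text \<open>Let ep = x + y sqrt p have norm -1 and al = 1 + i ep. Then al^2 = 2 (1 + i x) i ep,
  where 2 i = (1 + i)^2 and 1 + i x = q e d^2 with a unit e. So B = al / ((1 + i) d) has square e ep
  q.\<close>

lemma gaussian_prime_square_up_to_unit:
  assumes p: "prime p" "p mod 4 = 1" and ab: "int p = a^2 + 4 * b^2"
    and L: "is_subfield L" "\<i> \<in> L" "csqrt_nat p \<in> L"
  obtains B u where "B \<in> L" "u \<in> units_OK L" "B * B = u * gc (gcomplex a (2 * b))"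
proof -
  define q where "q = gcomplex a (2 * b)"
  have nq: "gnorm q = int p" by (simp add: q_def ab power_mult_distrib)
  then have pq: "prime (gnorm q)" using p(1) by simp
  have qq: "q * gcnj q = of_nat p" unfolding mult_gcnj nq by simp
  obtain X Y :: nat where XY: "X^2 + 1 = p * Y^2" by (rule negative_pell_solvable[OF p])
  obtain k where k: "p = 4 * k + 1" using p(2) by (metis mult_div_mod_eq)
  \<comment> \<open>For odd X the left side X^2 + 1 is 2 modulo 4, while p Y^2 is 0 or 1.\<close>
  have evX: "even X"
  proof (rule ccontr)
    assume "odd X"
    then obtain c where c: "X = 2 * c + 1" by (rule oddE)
    show False
    proof (cases "even Y")
      case True
      then obtain d where d: "Y = 2 * d" by (rule evenE)
      have "4 * (c * c + c) + 2 = 4 * (p * (d * d))"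
        using XY unfolding c d by (simp add: power2_eq_square algebra_simps)
      then show False by presburger
    next
      case False
      then obtain d where d: "Y = 2 * d + 1" by (rule oddE)
      have "4 * (c * c + c) + 2 = 4 * (k * (Y * Y) + d * d + d) + 1"
        using XY unfolding c d k by (simp add: power2_eq_square algebra_simps)
      then show False by presburger
    qed
  qed
  have "(1 + gi * of_int (int X)) * (1 + gi * of_int (- int X)) = of_nat (X^2 + 1)"
    by (simp add: algebra_simps power2_eq_square)
  also have "\<dots> = q * (gcnj q * of_nat (Y^2))" unfolding XY of_nat_mult qq[symmetric] by (simp only: mult.assoc)
  finally have "q dvd (1 + gi * of_int (int X)) * (1 + gi * of_int (- int X))" by (rule dvdI)
  then have "q dvd 1 + gi * of_int (int X) \<or> q dvd 1 + gi * of_int (- int X)" by (rule prime_gnorm_dvd_mult[OF pq])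
  \<comment> \<open>The sign of x decides whether the given prime or its conjugate divides 1 + i x,
    so it is chosen to fit q.\<close>
  then obtain x where x: "q dvd 1 + gi * of_int x" "x = int X \<or> x = - int X" by blast
  define y where "y = int Y"
  have "int (X^2 + 1) = int (p * Y^2)" unfolding XY ..
  then have xy: "1 + x^2 = int p * y^2" using x(2) by (auto simp: y_def)
  have ex: "even x" using x(2) evX by auto
  obtain e d where ed: "e dvd 1" "d \<noteq> 0" "1 + gi * of_int x = q * e * d^2"
    by (rule bezout_square_norm[OF pq qq x(1) ex xy])
  define s where "s = csqrt_nat p"
  define ep where "ep = of_int x + of_int y * s"
  define ep' where "ep' = of_int x - of_int y * s"
  have "ep * ep' = of_int x * of_int x - of_int y * of_int y * (s * s)" by (simp add: ep_def ep'_def algebra_simps)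
  also have "\<dots> = of_int (x^2 - int p * y^2)" unfolding s_def csqrt_nat_squared by (simp add: power2_eq_square)
  also have "x^2 - int p * y^2 = -1" using xy by linarith
  finally have ee: "ep * ep' = -1" by simp
  define al where "al = 1 + \<i> * ep"
  define al' where "al' = 1 + \<i> * ep'"
  have "al * al' = 1 + \<i> * (ep + ep') - ep * ep'" by (simp add: al_def al'_def algebra_simps)
  also have "\<dots> = 2 * (1 + \<i> * of_int x)" unfolding ee by (simp add: ep_def ep'_def)
  finally have aa': "al * al' = 2 * gc (1 + gi * of_int x)" by simp
  have "al = al' * (\<i> * ep)" unfolding al_def al'_def using ee by (simp add: algebra_simps)
  then have "al * al = al * (al' * (\<i> * ep))" by (rule arg_cong)
  also have "\<dots> = (al * al') * (\<i> * ep)" by (simp only: mult.assoc)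
  also have "\<dots> = (2 * \<i>) * (gc q * gc e * (gc d * gc d)) * ep"
    unfolding aa' ed(3) by (simp add: power2_eq_square)
  also have "2 * \<i> = (1 + \<i>) * (1 + \<i>)" by (simp add: algebra_simps)
  finally have al2: "al * al = ((1 + \<i>) * (1 + \<i>)) * (gc q * gc e * (gc d * gc d)) * ep" .
  define c where "c = (1 + \<i>) * gc d"
  have "1 + \<i> \<noteq> 0" by (simp add: complex_eq_iff)
  then have c0: "c \<noteq> 0" using ed(2) by (simp add: c_def)
  define B where "B = al / c"
  have "al * al = (c * c) * ((gc e * ep) * gc q)" unfolding al2 c_def by (simp only: mult_ac)
  then have BB: "B * B = (gc e * ep) * gc q" unfolding B_def using c0 by simp
  note D = is_subfieldD[OF L(1)]
  note gL = gc_in_subfield[OF L(1,2)]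
  have iL: "of_int n \<in> L" for n by (rule subfield_of_int[OF L(1)])
  have epL: "ep \<in> L" "ep' \<in> L" unfolding ep_def ep'_def s_def by (intro D(3,4,5) iL L(3))+
  have "B \<in> L" unfolding B_def c_def al_def by (intro D(2,3,5,8) L(2) epL gL)
  moreover have "gc e * ep \<in> units_OK L"
  proof -
    obtain e' where e': "1 = e * e'" using ed(1) by (rule dvdE)
    have ep_alg: "alg_int ep" "alg_int ep'"
      unfolding ep_def ep'_def s_def
      by (intro alg_int_add alg_int_diff alg_int_mult alg_int_of_int alg_int_csqrt_nat)+
    have OK: "gc e * ep \<in> OK L" "gc e' * (- ep') \<in> OK L"
      unfolding OK_def
      using D(5)[OF gL epL(1)] alg_int_mult[OF alg_int_gc ep_alg(1)]
        D(5)[OF gL D(7)[OF epL(2)]] alg_int_mult[OF alg_int_gc alg_int_minus[OF ep_alg(2)]] by blast+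
    have "(gc e * ep) * (gc e' * (- ep')) = - (gc (e * e') * (ep * ep'))" by (simp add: mult_ac)
    also have "\<dots> = 1" unfolding ee e'[symmetric] by simp
    finally show ?thesis by (rule units_OK_I[OF OK])
  qed
  ultimately show ?thesis using BB unfolding q_def by (rule that)
qed

section \<open>Capitulation of the ambiguous classes and the three cases of the theorem\<close>

context biquad
begin

lemma E_subset_genus_field:
  assumes kg: "kg = field_gen {csqrt_nat 2, csqrt_nat p1, csqrt_nat p2, \<i>}"
  shows "E \<subseteq> kg"
proof -
  have "sm \<in> kg"
    unfolding m_def csqrt_nat_mult kg
    by (intro is_subfieldD(5)[OF is_subfield_field_gen] field_gen_base; simp)
  then show ?thesis unfolding field_gen_sqrt_ii[symmetric] kg
    by (intro field_gen_least is_subfield_field_gen) (simp add: field_gen_base)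
qed

lemma genus_field_capitulation:
  assumes kg: "kg = field_gen {csqrt_nat 2, csqrt_nat p1, csqrt_nat p2, \<i>}"
    and q: "q \<in> {1 + gi, pi1, pi2, pi3, pi4}"
  shows "principal (OK kg) (gen_ideal (OK kg) (Ic q))"
proof -
  have L: "is_subfield kg" unfolding kg by (rule is_subfield_field_gen)
  have g: "csqrt_nat 2 \<in> kg" "csqrt_nat p1 \<in> kg" "csqrt_nat p2 \<in> kg" "\<i> \<in> kg"
    unfolding kg by (rule field_gen_base, simp)+
  note D = is_subfieldD[OF L]
  note EL = E_subset_genus_field[OF kg]
  have "\<exists>B u. B \<in> kg \<and> u \<in> units_OK kg \<and> B * B = u * gc q"
  proof -
    have pi: "\<exists>B u. B \<in> kg \<and> u \<in> units_OK kg \<and> B * B = u * gc (gcomplex a (2 * b))"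
      if "prime p" "p mod 4 = 1" "int p = a^2 + 4 * b^2" "csqrt_nat p \<in> kg" for p a b
      using gaussian_prime_square_up_to_unit[OF that(1-3) L g(4) that(4)] by metis
    \<comment> \<open>Changing the signs of f and h turns pi1 and pi3 into their conjugates pi2 and
      pi4.\<close>
    have ef': "int p1 = e^2 + 4 * (- f)^2" and gh': "int p2 = g^2 + 4 * (- h)^2" using ef gh by simp_all
    have P0: "\<exists>B u. B \<in> kg \<and> u \<in> units_OK kg \<and> B * B = u * gc (1 + gi)"
    proof (intro exI conjI)
      \<comment> \<open>A primitive eighth root of unity: z^2 = i and 2 z = (1 + i) sqrt 2, so (1 -
        z)^2 = (1 + i) (1 - sqrt 2) with the unit 1 - sqrt 2.\<close>
      define z where "z = (1 + \<i>) / s2"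
      have s20: "s2 \<noteq> 0" using k1.t_notin by auto
      have "z * s2 = 1 + \<i>" using s20 by (simp add: z_def)
      then have "z * (s2 * s2) = (1 + \<i>) * s2" by (metis mult.assoc)
      then have z1: "2 * z = (1 + \<i>) * s2" unfolding csqrt_nat_squared by (simp add: mult.commute)
      have "z * z = ((1 + \<i>) * (1 + \<i>)) / (s2 * s2)" by (simp add: z_def)
      then have z2: "z * z = \<i>" unfolding csqrt_nat_squared by (simp add: algebra_simps)
      show "(1 - z) \<in> kg" unfolding z_def by (intro D(2,3,4,8) g)
      have "(1 - s2) * (- (1 + s2)) = s2 * s2 - 1" by (simp add: algebra_simps)
      also have "\<dots> = 1" unfolding csqrt_nat_squared by simp
      finally have e: "(1 - s2) * (- (1 + s2)) = 1" .
      have "1 - s2 \<in> OK kg" "- (1 + s2) \<in> OK kg"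
        unfolding OK_def using D g
        by (auto intro!: alg_int_minus alg_int_add alg_int_diff alg_int_csqrt_nat simp del: minus_add_distrib)
      then show "1 - s2 \<in> units_OK kg" using e by (rule units_OK_I)
      have "(1 - z) * (1 - z) = 1 + z * z - 2 * z" by (simp add: algebra_simps)
      also have "\<dots> = (1 - s2) * gc (1 + gi)" unfolding z1 z2 by (simp add: algebra_simps)
      finally show "(1 - z) * (1 - z) = (1 - s2) * gc (1 + gi)" .
    qed
    have "2 * - f = - 2 * f" "2 * - h = - 2 * h" by simp_all
    note P = pi[OF p1 mod1 ef g(2), folded pi1_def] pi[OF p1 mod1 ef' g(2), unfolded this, folded pi2_def]
      pi[OF p2 mod2 gh g(3), folded pi3_def] pi[OF p2 mod2 gh' g(3), unfolded this, folded pi4_def]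
    from q consider "q = 1 + gi" | "q = pi1" | "q = pi2" | "q = pi3" | "q = pi4" by blast
    then show ?thesis by cases (simp_all only: P0 P)
  qed
  then obtain B u where "B \<in> kg" "u \<in> units_OK kg" "B * B = u * gc q" by blast
  then show ?thesis
    using q prime_gnorms ramdiv_pi by (intro Ic_extension_principal[OF L EL, of q B u]) auto
qed

text \<open>The class of pi4 comes from the relation given by theta, which completes the list of
  ramified primes; capitulation is then checked on the generators alone.\<close>

lemma Am_s_capitulates:
  assumes kg: "kg = field_gen {csqrt_nat 2, csqrt_nat p1, csqrt_nat p2, \<i>}"
    and G: "\<forall>I\<in>G. \<exists>q\<in>{1 + gi, pi1, pi2, pi3, pi4}. I = Ic q"
    and cl: "\<forall>q\<in>{1 + gi, pi1, pi2, pi3}. cl q \<in> gens G"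
  shows "Am_s E QI = gens G \<and> Am_s E QI \<subseteq> capit_ker E kg"
proof -
  have "mg = pi1 * (pi2 * pi3) * pi4" unfolding of_nat_m by (simp only: mult_ac)
  then have c4: "cl pi4 \<in> gens G" by (rule cls_last) (use prime_gnorms cl in auto)
  have "Am_s E QI = gens G"
    by (rule Am_s_eq[OF _ prod_list_pi]) (use prime_gnorms cl c4 G in auto)
  moreover have "gens G \<subseteq> capit_ker E kg"
  proof
    fix C assume C: "C \<in> gens G"
    have L: "is_subfield kg" unfolding kg by (rule is_subfield_field_gen)
    have "C \<in> classes R \<and> (\<forall>I\<in>C. principal (OK kg) (gen_ideal (OK kg) I))"
    proof (rule class_subgroup_capitulates[OF R_subring is_subring_OK[OF L] OK_mono[OF E_subset_genus_field[OF kg]] _ C])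
      fix I assume "I \<in> G"
      then obtain q where q: "q \<in> {1 + gi, pi1, pi2, pi3, pi4}" "I = Ic q" using G by blast
      show "principal (OK kg) (gen_ideal (OK kg) I)" unfolding q(2) by (rule genus_field_capitulation[OF kg q(1)])
    qed
    then show "C \<in> capit_ker E kg" unfolding capit_ker_def by simp
  qed
  ultimately show ?thesis by simp
qed

lemma cls_gen: "ramdiv q \<Longrightarrow> Ic q \<in> G \<Longrightarrow> cl q \<in> gens G"
  by (rule class_subgroup.gen[OF _ nz_ideal_Ic])

lemma ambiguous_classes:
  assumes kg: "kg = field_gen {csqrt_nat 2, csqrt_nat p1, csqrt_nat p2, \<i>}"
    and Q: "Q = unit_index (field_gen {s2, csqrt_nat m}) k1.E k2.E k3.E"
  shows "(qnorm k3.E (fund_unit k3.E) = -1 \<longrightarrow>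
          Am_s E QI = gens {Ic (1 + gi), Ic pi1, Ic pi2} \<and> Am_s E QI \<subseteq> capit_ker E kg) \<and>
       (qnorm k3.E (fund_unit k3.E) = 1 \<longrightarrow>
          (Q = 2 \<longrightarrow> Am_s E QI = gens {Ic (1 + gi), Ic pi1, Ic pi2, Ic pi3} \<and> Am_s E QI \<subseteq> capit_ker E kg) \<and>
          (Q = 1 \<longrightarrow> Am_s E QI = gens {Ic (1 + gi), Ic pi1, Ic pi3} \<and> Am_s E QI \<subseteq> capit_ker E kg))"
proof -
  obtain x y where fu: "fund_unit k3.E = k3.ze x y" "0 < x" "0 < y" "Re (k3.ze x y) > 1"
    "\<And>v. v \<in> units_OK k3.E \<Longrightarrow> Re v > 1 \<Longrightarrow> Re (k3.ze x y) \<le> Re v"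
    by (rule k3.fund_unit_exists[OF OK_k3]) blast+
  have "k3.ze x y \<in> k3.E" using k3.ze_in_OK by (simp add: OK_def)
  then have qn: "qnorm k3.E (fund_unit k3.E) = of_int (x^2 - int (2 * m) * y^2)"
    unfolding fu(1) using k3.qnorm_eq k3.ze_norm by simp
  have N1: "x^2 - int (2 * m) * y^2 = -1" if "qnorm k3.E (fund_unit k3.E) = -1"
  proof -
    have "(of_int (x^2 - int (2 * m) * y^2) :: complex) = of_int (-1)" using that unfolding qn by simp
    then show ?thesis by (simp only: of_int_eq_iff)
  qed
  have N2: "x^2 - int (2 * m) * y^2 = 1" if "qnorm k3.E (fund_unit k3.E) = 1"
  proof -
    have "(of_int (x^2 - int (2 * m) * y^2) :: complex) = of_int 1" using that unfolding qn by simp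
    then show ?thesis by (simp only: of_int_eq_iff)
  qed
  have "Am_s E QI = gens {Ic (1 + gi), Ic pi1, Ic pi2} \<and> Am_s E QI \<subseteq> capit_ker E kg"
    if "qnorm k3.E (fund_unit k3.E) = -1"
  proof (rule Am_s_capitulates[OF kg])
    let ?G = "{Ic (1 + gi), Ic pi1, Ic pi2}"
    have "cl (1 + gi) \<in> gens ?G" "cl pi1 \<in> gens ?G"
      "cl pi2 \<in> gens ?G"
      by (simp_all add: cls_gen ramdiv_pi)
    then show "\<forall>q\<in>{1 + gi, pi1, pi2, pi3}. cl q \<in> gens ?G"
      using norm_minus_one_H3[OF N1[OF that]] by simp
  qed auto
  moreover have "Am_s E QI = gens {Ic (1 + gi), Ic pi1, Ic pi2, Ic pi3} \<and> Am_s E QI \<subseteq> capit_ker E kg"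
    by (rule Am_s_capitulates[OF kg]) (auto intro!: cls_gen ramdiv_pi)
  moreover have "Am_s E QI = gens {Ic (1 + gi), Ic pi1, Ic pi3} \<and> Am_s E QI \<subseteq> capit_ker E kg"
    if n: "qnorm k3.E (fund_unit k3.E) = 1" and Q1: "Q = 1"
  proof (rule Am_s_capitulates[OF kg])
    let ?G = "{Ic (1 + gi), Ic pi1, Ic pi3}"
    have G: "cl (1 + gi) \<in> gens ?G" "cl pi1 \<in> gens ?G"
      "cl pi3 \<in> gens ?G"
      by (simp_all add: cls_gen ramdiv_pi)
    \<comment> \<open>Either relation yields the class of pi2: the first directly from pi1, the
      second by way of pi4 and the relation between all four primes.\<close>
    have "cl (pi1 * pi2) = cls R R \<or> cl (pi3 * pi4) = cls R R"
      by (rule norm_one_Q_one[OF fu(2-5) N2[OF n]]) (use Q1 Q in simp_all)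
    then have "cl pi2 \<in> gens ?G"
    proof
      assume one: "cl (pi1 * pi2) = cls R R"
      have "ramdiv (pi1 * pi2)" by (rule nat_ramdiv) (simp only: of_nat_m dvd_triv_left)
      then show ?thesis by (rule cls_cancel[OF _ bezout_pi(1) one G(2)])
    next
      assume one: "cl (pi3 * pi4) = cls R R"
      have "ramdiv (pi3 * pi4)" by (rule nat_ramdiv) (simp only: of_nat_m dvd_triv_right)
      then have 4: "cl pi4 \<in> gens ?G"
        by (rule cls_cancel[OF _ bezout_pi(2) one G(3)])
      have "mg = pi1 * (pi3 * pi4) * pi2" unfolding of_nat_m by (simp only: mult_ac)
      then show ?thesis by (rule cls_last) (use prime_gnorms G 4 in auto)
    qed
    with G show "\<forall>q\<in>{1 + gi, pi1, pi2, pi3}. cl q \<in> gens ?G" by simp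
  qed auto
  ultimately show ?thesis by blast
qed

end

theorem theorem47:
  fixes p1 p2 :: nat and e f g h :: int
  assumes "prime p1" and "prime p2" and "p1 \<noteq> p2"
    and "p1 mod 4 = 1" and "p2 mod 4 = 1"
    and "int p1 = e\<^sup>2 + 4 * f\<^sup>2" and "int p2 = g\<^sup>2 + 4 * h\<^sup>2"
  shows
   "let k = field_gen {csqrt_nat (2 * p1 * p2), \<i>};
        kg = field_gen {csqrt_nat 2, csqrt_nat p1, csqrt_nat p2, \<i>};
        Qi = field_gen {\<i>};
        Ok = OK k;
        Q = unit_index (field_gen {csqrt_nat 2, csqrt_nat (p1 * p2)})
              (field_gen {csqrt_nat 2}) (field_gen {csqrt_nat (p1 * p2)})
              (field_gen {csqrt_nat (2 * p1 * p2)});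
        k3 = field_gen {csqrt_nat (2 * p1 * p2)};
        \<epsilon>3 = fund_unit k3;
        H0 = ram_prime Ok (1 + \<i>);
        H1 = ram_prime Ok (Complex (of_int e) (of_int (2 * f)));
        H2 = ram_prime Ok (Complex (of_int e) (of_int (- 2 * f)));
        H3 = ram_prime Ok (Complex (of_int g) (of_int (2 * h)))
    in (qnorm k3 \<epsilon>3 = -1 \<longrightarrow>
          Am_s k Qi = class_subgroup Ok {H0, H1, H2} \<and> Am_s k Qi \<subseteq> capit_ker k kg) \<and>
       (qnorm k3 \<epsilon>3 = 1 \<longrightarrow>
          (Q = 2 \<longrightarrow> Am_s k Qi = class_subgroup Ok {H0, H1, H2, H3} \<and> Am_s k Qi \<subseteq> capit_ker k kg) \<and>
          (Q = 1 \<longrightarrow> Am_s k Qi = class_subgroup Ok {H0, H1, H3} \<and> Am_s k Qi \<subseteq> capit_ker k kg))"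
proof -
  interpret biquad p1 p2 e f g h
    by unfold_locales (fact assms)+
  have m2: "2 * p1 * p2 = 2 * m" "p1 * p2 = m" by (simp_all add: m_def)
  have gens: "1 + \<i> = gc (1 + gi)" "Complex (of_int e) (of_int (2 * f)) = gc pi1"
    "Complex (of_int e) (of_int (- 2 * f)) = gc pi2" "Complex (of_int g) (of_int (2 * h)) = gc pi3"
    by (simp_all only: pi1_def pi2_def pi3_def gc_gcomplex gc_add gc_1 gc_gi)
  show ?thesis
    unfolding Let_def m2 gens field_gen_sqrt_ii field_gen_ii k1.field_gen_csqrt k2.field_gen_csqrt
      k3.field_gen_csqrt ram_prime_Ic[OF prime_gnorms(5) ramdiv_pi(1)] ram_prime_Ic[OF prime_gnorms(1) ramdiv_pi(2)]
      ram_prime_Ic[OF prime_gnorms(2) ramdiv_pi(3)] ram_prime_Ic[OF prime_gnorms(3) ramdiv_pi(4)]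
    by (rule ambiguous_classes[OF refl refl])
qed

end
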